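(* Let $k\ge1$ be an integer and let $\Lambda$ be a locally finite measure on $\mathbb{R}^2$ with $\sup_{x}\int_{\mathbb{R}^2}h(x,y)\,\Lambda(dy)<\infty$. For all measurable $v_0,\dots,v_k:\mathbb{R}^2\to[0,1]$ with $\int_{\mathbb{R}^2}|1-v_i(x)|\,\Lambda(dx)<\infty$ for $i=0,\dots,k$, one has $g_{k,\Lambda}(0,v_0,\dots,v_k)=1$ and, for all $t\ge0$ (right derivative at $t=0$), $$\begin{aligned}\frac{d g_{k,\Lambda}}{dt}(t,v_0,\dots,v_k)=&-\int_{\mathbb{R}^2}(1-v_0(x))\,g_{k,\Lambda}(t,v_0,\dots,v_k)\,\Lambda(dx)\\&-\sum_{i=0}^{\lfloor k/2\rfloor-1}\int_{\mathbb{R}^2}(v_i(x)-v_{i+1}(x))\,g_{k,\Lambda}\bigl(t,v_0,\dots,v_{k-i-1},H(v_{k-i},x),\dots,H(v_k,x)\bigr)\Lambda(dx)\\&-\sum_{i=\lfloor k/2\rfloor}^{k-1}\int_{\mathbb{R}^2}(v_i(x)-v_{i+1}(x))\,g_{k,\Lambda}\bigl(t,v_0,\dots,v_{k-i-2},H(v_{k-i-1},x),\dots,H(v_k,x)\bigr)\Lambda(dx),\end{aligned}$$ where $H(v,x)$ is the function $y\mapsto v(y)(1-h(x,y))$ (in each term $H(\cdot,x)$ is applied to all arguments from the indicated index up to $k$, the earlier ones being unchanged).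
   Context: Contention: $h:\mathbb{R}^2\times\mathbb{R}^2\to[0,1]$ is measurable, symmetric and translation invariant ($h(x,y)=h(0,y-x)$). $\Phi$ is a Poisson point process on $\mathbb{R}^2\times[0,\infty)$ with intensity measure $\Lambda(dx)\,dt$; a point is identified with its position $x\in\mathbb{R}^2$, and its second coordinate $t(x)$ is called its timer. To each unordered pair of distinct points $x,y$ is attached a Boolean variable $C(x,y)=C(y,x)$; given all points and timers these variables are independent with $\mathbf{P}(C(x,y)=1)=h(x,y)$. $T_{[0,t)}(\Phi)=\{x\in\Phi:t(x)<t\}$. For a point process $\Xi$ with timers put $e_0(x)=1$ and, for $k\ge1$, $e_k(x)=\prod_{y\in\Xi,\,t(y)<t(x)}(1-e_{k-1}(y)C(x,y))$ for $x\in\Xi$ (empty products equal $1$). The $k$-Mat\'ern model is $M^k(\Xi,C)=\{x\in\Xi:e_k(x)=1\}$. The binary word $\mathbf{e}^k(x)=e_1(x)e_2(x)\cdots e_k(x)$ always takes one of the $k+1$ values $E^k_0,\dots,E^k_k$, where $E^k_j=(01)^j0^{k-2j}$ for $0\le j\le\lfloor k/2\rfloor$ and $E^k_j=(01)^{k-j}1^{2j-k}$ for $\lfloor k/2\rfloor+1\le j\le k$ (powers denote repeated concatenation). Set $M^k_j(\Xi,C)=\{x\in\Xi:\mathbf{e}^k(x)=E^k_j\}$, $0\le j\le k$. Finally $$g_{k,\Lambda}(t,v_0,\dots,v_k)=\mathbf{E}\Bigl[\prod_{j=0}^k\ \prod_{x\in M^k_j(T_{[0,t)}(\Phi),C)}v_j(x)\Bigr].$$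 *)

theory Defs
  imports "HOL-Probability.Probability"
begin

section \<open>Products over possibly infinite index sets\<close>

text \<open>
  The constant \<^const>\<open>prod\<close> is \<open>1\<close> on every infinite index set. The products needed here range over
  possibly infinite sets of points, so they are taken as limits along the net of finite subsets,
  exactly as \<^const>\<open>infsum\<close> does for sums. For factors in \<open>[0,1]\<close> the limit always exists.
\<close>

definition infprod :: "('a \<Rightarrow> real) \<Rightarrow> 'a set \<Rightarrow> real" where
  "infprod f A = Lim (finite_subsets_at_top A) (prod f)"

lemma infprod_finite: "finite A \<Longrightarrow> infprod f A = prod f A"
  unfolding infprod_def
  by (auto intro!: tendsto_Lim tendsto_principal_singleton
      simp: finite_subsets_at_top_finite principal_eq_bot_iff)

lemma infprod_tendsto_INF:
  fixes f :: "'a \<Rightarrow> real"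
  assumes "\<And>x. x \<in> A \<Longrightarrow> 0 \<le> f x \<and> f x \<le> 1"
  shows "(prod f \<longlongrightarrow> (INF F\<in>{F. finite F \<and> F \<subseteq> A}. prod f F)) (finite_subsets_at_top A)"
    (is "(_ \<longlongrightarrow> ?L) _")
proof (rule decreasing_tendsto)
  let ?S = "{F. finite F \<and> F \<subseteq> A}"
  have bdd: "bdd_below (prod f ` ?S)"
    using assms by (intro bdd_belowI[of _ 0]) (auto intro!: prod_nonneg)
  show "\<forall>\<^sub>F F in finite_subsets_at_top A. ?L \<le> prod f F"
    using bdd by (intro eventually_finite_subsets_at_top_weakI cINF_lower) auto
next
  let ?S = "{F. finite F \<and> F \<subseteq> A}"
  fix x assume "?L < x"
  moreover have "?S \<noteq> {}" by blast
  moreover have "bdd_below (prod f ` ?S)"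
    using assms by (intro bdd_belowI[of _ 0]) (auto intro!: prod_nonneg)
  ultimately obtain F where F: "finite F" "F \<subseteq> A" "prod f F < x"
    by (auto simp: cINF_less_iff)
  have "prod f G \<le> prod f F" if "finite G" "F \<subseteq> G" "G \<subseteq> A" for G
  proof -
    have "prod f G = prod f F * prod f (G - F)"
      using that by (metis mult.commute prod.subset_diff)
    also have "\<dots> \<le> prod f F * 1"
    proof (rule mult_left_mono)
      show "prod f (G - F) \<le> 1" using that assms by (intro prod_le_1) auto
      show "0 \<le> prod f F" using F assms by (auto intro!: prod_nonneg)
    qed
    finally show ?thesis by simp
  qed
  with F show "\<forall>\<^sub>F G in finite_subsets_at_top A. prod f G < x"
    unfolding eventually_finite_subsets_at_top by (meson le_less_trans)
qed

lemma infprod_eq_INF: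
  assumes "\<And>x. x \<in> A \<Longrightarrow> 0 \<le> f x \<and> f x \<le> 1"
  shows "infprod f A = (INF F\<in>{F. finite F \<and> F \<subseteq> A}. prod f F)"
  unfolding infprod_def
  by (rule tendsto_Lim[OF finite_subsets_at_top_neq_bot infprod_tendsto_INF[OF assms]])

section \<open>Poisson point processes\<close>

definition locally_finite_measure :: "'a::metric_space measure \<Rightarrow> bool" where
  "locally_finite_measure \<mu> \<longleftrightarrow> (\<forall>B\<in>sets \<mu>. bounded B \<longrightarrow> emeasure \<mu> B < \<infinity>)"

text \<open>
  A point process is a random locally finite set, hence simple; for a locally finite intensity
  measure \<open>\<mu>\<close> this represents the Poisson process exactly when \<open>\<mu>\<close> has no atoms.
\<close>

definition poisson_process ::
  "'w measure \<Rightarrow> 'a::metric_space measure \<Rightarrow> ('w \<Rightarrow> 'a set) \<Rightarrow> bool" where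
  "poisson_process M \<mu> \<Phi> \<longleftrightarrow>
     (\<forall>\<omega>\<in>space M. \<Phi> \<omega> \<subseteq> space \<mu> \<and> (\<forall>B. bounded B \<longrightarrow> finite (\<Phi> \<omega> \<inter> B))) \<and>
     (\<forall>B\<in>sets \<mu>. bounded B \<longrightarrow>
        (\<lambda>\<omega>. card (\<Phi> \<omega> \<inter> B)) \<in> M \<rightarrow>\<^sub>M count_space UNIV \<and>
        (\<forall>n. measure M {\<omega>\<in>space M. card (\<Phi> \<omega> \<inter> B) = n} =
             exp (- measure \<mu> B) * measure \<mu> B ^ n / fact n)) \<and>
     (\<forall>n (B :: nat \<Rightarrow> 'a set).
        (\<forall>i<n. B i \<in> sets \<mu> \<and> bounded (B i)) \<and> disjoint_family_on B {..<n} \<longrightarrow>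
        prob_space.indep_vars M (\<lambda>_. count_space UNIV) (\<lambda>i \<omega>. card (\<Phi> \<omega> \<inter> B i)) {..<n})"

text \<open>The \<open>\<sigma>\<close>-algebra generated by \<open>\<Phi>\<close>.\<close>

definition process_algebra ::
  "'w measure \<Rightarrow> 'a::metric_space measure \<Rightarrow> ('w \<Rightarrow> 'a set) \<Rightarrow> 'w measure" where
  "process_algebra M \<mu> \<Phi> =
     sigma (space M) {{\<omega>\<in>space M. card (\<Phi> \<omega> \<inter> B) = n} | B n. B \<in> sets \<mu> \<and> bounded B}"

section \<open>Points with timers and contention variables\<close>

text \<open>
  A point is the pair of its position and its timer. Positions alone would not separate points
  when \<open>\<Lambda>\<close> has atoms, whereas \<open>\<Lambda>(dx) dt\<close> never has atoms.
\<close>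

type_synonym plane = "real ^ 2"
type_synonym tpoint = "plane \<times> real"

definition timed_intensity :: "plane measure \<Rightarrow> tpoint measure" where
  "timed_intensity \<Lambda> = \<Lambda> \<Otimes>\<^sub>M restrict_space lborel {0..}"

text \<open>
  Given the point process, the variables attached to distinct unordered pairs of distinct points
  are independent, the one of \<open>x, y\<close> being true with probability \<open>h(x,y)\<close>. The points of the pairs
  are addressed by random points \<open>X i\<close>, \<open>Y i\<close> that are functions of \<open>\<Phi>\<close>; since such points
  need not exist surely (\<open>\<Phi>\<close> may be empty), they are only constrained on an event \<open>A\<close> of the
  conditioning \<open>\<sigma>\<close>-algebra, and integration over all such \<open>A\<close> defines the conditional probability.
\<close>

definition contention_variables ::
  "'w measure \<Rightarrow> tpoint measure \<Rightarrow> ('w \<Rightarrow> tpoint set) \<Rightarrow> (plane \<Rightarrow> plane \<Rightarrow> real) \<Rightarrow>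
   ('w \<Rightarrow> tpoint \<Rightarrow> tpoint \<Rightarrow> bool) \<Rightarrow> bool" where
  "contention_variables M \<mu> \<Phi> h C \<longleftrightarrow>
     (\<forall>\<omega>\<in>space M. \<forall>z\<in>\<Phi> \<omega>. \<forall>w\<in>\<Phi> \<omega>. C \<omega> z w = C \<omega> w z) \<and>
     (\<forall>(n::nat) X Y (b :: nat \<Rightarrow> bool). \<forall>A\<in>sets (process_algebra M \<mu> \<Phi>).
        (\<forall>i<n. X i \<in> process_algebra M \<mu> \<Phi> \<rightarrow>\<^sub>M borel \<and> Y i \<in> process_algebra M \<mu> \<Phi> \<rightarrow>\<^sub>M borel) \<and>
        (\<forall>\<omega>\<in>A. (\<forall>i<n. X i \<omega> \<in> \<Phi> \<omega> \<and> Y i \<omega> \<in> \<Phi> \<omega> \<and> X i \<omega> \<noteq> Y i \<omega>) \<and>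
               inj_on (\<lambda>i. {X i \<omega>, Y i \<omega>}) {..<n}) \<longrightarrow>
        {\<omega>\<in>A. \<forall>i<n. C \<omega> (X i \<omega>) (Y i \<omega>) = b i} \<in> sets M \<and>
        measure M {\<omega>\<in>A. \<forall>i<n. C \<omega> (X i \<omega>) (Y i \<omega>) = b i} =
          (LINT \<omega>:A|M. (\<Prod>i<n. if b i then h (fst (X i \<omega>)) (fst (Y i \<omega>))
                              else 1 - h (fst (X i \<omega>)) (fst (Y i \<omega>)))))"

section \<open>The k-Matern models\<close>

definition timers_below :: "real \<Rightarrow> tpoint set \<Rightarrow> tpoint set" where
  "timers_below t \<Xi> = {z\<in>\<Xi>. snd z < t}"

primrec matern_e ::
  "tpoint set \<Rightarrow> (tpoint \<Rightarrow> tpoint \<Rightarrow> bool) \<Rightarrow> nat \<Rightarrow> tpoint \<Rightarrow> real" where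
  "matern_e \<Xi> c 0 = (\<lambda>z. 1)"
| "matern_e \<Xi> c (Suc k) =
     (\<lambda>z. infprod (\<lambda>w. 1 - matern_e \<Xi> c k w * of_bool (c z w)) {w\<in>\<Xi>. snd w < snd z})"

definition matern_word ::
  "tpoint set \<Rightarrow> (tpoint \<Rightarrow> tpoint \<Rightarrow> bool) \<Rightarrow> nat \<Rightarrow> tpoint \<Rightarrow> real list" where
  "matern_word \<Xi> c k z = map (\<lambda>i. matern_e \<Xi> c i z) [1..<Suc k]"

definition matern_code :: "nat \<Rightarrow> nat \<Rightarrow> real list" where
  "matern_code k j =
     (if j \<le> k div 2 then concat (replicate j [0, 1]) @ replicate (k - 2 * j) 0
      else concat (replicate (k - j) [0, 1]) @ replicate (2 * j - k) 1)"

definition matern_class ::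
  "nat \<Rightarrow> nat \<Rightarrow> tpoint set \<Rightarrow> (tpoint \<Rightarrow> tpoint \<Rightarrow> bool) \<Rightarrow> tpoint set" where
  "matern_class k j \<Xi> c = {z\<in>\<Xi>. matern_word \<Xi> c k z = matern_code k j}"

text \<open>The tuple \<open>v\<^sub>0, \<dots>, v\<^sub>k\<close> is a function on \<open>nat\<close>, of which only the indices up to \<open>k\<close> matter.\<close>

definition matern_gf ::
  "'w measure \<Rightarrow> ('w \<Rightarrow> tpoint set) \<Rightarrow> ('w \<Rightarrow> tpoint \<Rightarrow> tpoint \<Rightarrow> bool) \<Rightarrow> nat \<Rightarrow> real \<Rightarrow>
   (nat \<Rightarrow> plane \<Rightarrow> real) \<Rightarrow> real" where
  "matern_gf M \<Phi> C k t v =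
     (\<integral>\<omega>. (\<Prod>j\<le>k. infprod (\<lambda>z. v j (fst z)) (matern_class k j (timers_below t (\<Phi> \<omega>)) (C \<omega>))) \<partial>M)"

definition thin :: "(plane \<Rightarrow> plane \<Rightarrow> real) \<Rightarrow> (plane \<Rightarrow> real) \<Rightarrow> plane \<Rightarrow> plane \<Rightarrow> real" where
  "thin h v x = (\<lambda>y. v y * (1 - h x y))"

definition thin_from ::
  "(plane \<Rightarrow> plane \<Rightarrow> real) \<Rightarrow> nat \<Rightarrow> (nat \<Rightarrow> plane \<Rightarrow> real) \<Rightarrow> plane \<Rightarrow> nat \<Rightarrow> plane \<Rightarrow> real" where
  "thin_from h m v x = (\<lambda>j. if m \<le> j then thin h (v j) x else v j)"

end

theory Submission
  imports Defs
begin

text \<open>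
  The points with timer in \<open>[t, t + s)\<close> do not change the classes of the points with timer below \<open>t\<close>.
  Hence the product defining \<open>g\<close> at time \<open>t + s\<close> is the product at time \<open>t\<close> times a product over
  the new points. The probability that two new points matter is \<open>O(s\<^sup>2)\<close>: this is where the second
  factorial moment of the Poisson process and the bound on \<open>\<integral> h(x, y) \<Lambda>(dy)\<close> enter. So, up to
  \<open>O(s\<^sup>2)\<close>, each new point may be treated as if it were the only one.

  The words \<open>E\<^sub>0, \<dots>, E\<^sub>k\<close> are totally ordered, and a single new point \<open>x\<close> has class above \<open>i\<close> if and only
  if it does not contend with any past point of class at least \<open>k - i\<close> (respectively \<open>k - i - 1\<close>).
  Given the past, this has the probability obtained by replacing the indicators of no contention by
  \<open>1 - h(x, \<cdot>)\<close>, which produces \<open>H(v\<^sub>j, x)\<close>; Campbell's formula turns the sum over the new points into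
  \<open>s\<close> times an integral with respect to \<open>\<Lambda>\<close>. The resulting right-hand side is Lipschitz in \<open>t\<close>, so
  the expansion to the right of each \<open>t\<close> yields the two-sided derivative.
\<close>

section \<open>Infinite products and the classes of a configuration\<close>

text \<open>The assumptions on \<open>C\<close> only give conditional probabilities given the point
  process, for random points measurable in the process and on events where these points exist. Every
  probabilistic step therefore passes through a measurable labelling of the points, and two algebras
  are kept apart: \<open>\<P>\<close> knows the past points and their links and is independent of
  the new points; \<open>\<H>\<close> knows all points and the links between past points, but no
  link of a new point. Campbell's formula rests on the first, the replacement of an absent link by
  \<open>1 - h\<close> on the second; both are checked on cylinders and extended by a generator
  argument. Since \<open>\<Lambda>\<close> may be infinite, past and slab may hold infinitely many
  points. Products are limits over labels, and errors are bounded by the integrable sum of all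
  deficits 1 - v_j, which does not involve the links. The coefficients v_i - v_{i+1} come from 1 -
  v_l = 1 - v_0 + sum over i < l of (v_i - v_{i+1}), where l is the class of the new point and each
  event i < l is an absence of links.\<close>

lemma infprod_tendsto:
  fixes f :: "'a \<Rightarrow> real"
  assumes "\<And>x. x \<in> A \<Longrightarrow> 0 \<le> f x \<and> f x \<le> 1"
  shows "(prod f \<longlongrightarrow> infprod f A) (finite_subsets_at_top A)"
  using infprod_tendsto_INF[of A f] infprod_eq_INF[of A f] assms by simp

lemma infprod_eqI:
  fixes f :: "'a \<Rightarrow> real"
  assumes "(prod f \<longlongrightarrow> l) (finite_subsets_at_top A)"
  shows "infprod f A = l"
  unfolding infprod_def by (rule tendsto_Lim[OF finite_subsets_at_top_neq_bot assms])

lemma infprod_cong: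
  assumes "\<And>x. x \<in> A \<Longrightarrow> f x = g x"
  shows "infprod f A = infprod g A"
proof -
  have "\<forall>\<^sub>F F in finite_subsets_at_top A. prod f F = prod g F"
    by (rule eventually_finite_subsets_at_top_weakI) (auto intro!: prod.cong assms)
  then have "(prod f \<longlongrightarrow> l) (finite_subsets_at_top A) \<longleftrightarrow>
      (prod g \<longlongrightarrow> l) (finite_subsets_at_top A)" for l
    by (rule tendsto_cong)
  then show ?thesis unfolding infprod_def t2_space_class.Lim_def by simp
qed

lemma infprod_bounds:
  fixes f :: "'a \<Rightarrow> real"
  assumes "\<And>x. x \<in> A \<Longrightarrow> 0 \<le> f x \<and> f x \<le> 1"
  shows "0 \<le> infprod f A" "infprod f A \<le> 1"
proof -
  have *: "\<forall>\<^sub>F F in finite_subsets_at_top A. 0 \<le> prod f F"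
          "\<forall>\<^sub>F F in finite_subsets_at_top A. prod f F \<le> 1"
    using assms
    by (auto intro!: eventually_finite_subsets_at_top_weakI prod_nonneg prod_le_1)
  show "0 \<le> infprod f A" "infprod f A \<le> 1"
    using tendsto_lowerbound[OF infprod_tendsto[OF assms] *(1) finite_subsets_at_top_neq_bot]
      tendsto_upperbound[OF infprod_tendsto[OF assms] *(2) finite_subsets_at_top_neq_bot] by auto
qed

lemma filterlim_Int_finite_subsets_at_top:
  assumes "A \<subseteq> B"
  shows "filterlim (\<lambda>F. F \<inter> A) (finite_subsets_at_top A) (finite_subsets_at_top B)"
  unfolding filterlim_finite_subsets_at_top
proof (intro allI impI)
  fix X assume X: "finite X \<and> X \<subseteq> A"
  show "\<forall>\<^sub>F F in finite_subsets_at_top B. finite (F \<inter> A) \<and> X \<subseteq> F \<inter> A \<and> F \<inter> A \<subseteq> A"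
    unfolding eventually_finite_subsets_at_top using X assms by (intro exI[of _ X]) auto
qed

lemma infprod_Un_disjoint:
  fixes f :: "'a \<Rightarrow> real"
  assumes "A \<inter> B = {}" "\<And>x. x \<in> A \<union> B \<Longrightarrow> 0 \<le> f x \<and> f x \<le> 1"
  shows "infprod f (A \<union> B) = infprod f A * infprod f B"
proof (rule infprod_eqI)
  let ?F = "finite_subsets_at_top (A \<union> B)"
  have "((\<lambda>F. prod f (F \<inter> A) * prod f (F \<inter> B)) \<longlongrightarrow> infprod f A * infprod f B) ?F"
    using assms
    by (intro tendsto_mult filterlim_compose[OF infprod_tendsto]
          filterlim_Int_finite_subsets_at_top) auto
  moreover have "\<forall>\<^sub>F F in ?F. prod f (F \<inter> A) * prod f (F \<inter> B) = prod f F"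
  proof (rule eventually_finite_subsets_at_top_weakI)
    fix F assume F: "finite F" "F \<subseteq> A \<union> B"
    then have "F = (F \<inter> A) \<union> (F \<inter> B)" by auto
    then show "prod f (F \<inter> A) * prod f (F \<inter> B) = prod f F"
      using prod.union_disjoint[of "F \<inter> A" "F \<inter> B" f] F assms(1)
      by (metis Int_Un_eq(3) Int_assoc Int_left_commute finite_Int inf_bot_right)
  qed
  ultimately show "(prod f \<longlongrightarrow> infprod f A * infprod f B) ?F"
    by (rule Lim_transform_eventually)
qed

lemma infprod_UN_disjoint:
  fixes f :: "'a \<Rightarrow> real"
  assumes "finite J" "disjoint_family_on A J" "\<And>j x. j \<in> J \<Longrightarrow> x \<in> A j \<Longrightarrow> 0 \<le> f x \<and> f x \<le> 1"
  shows "infprod f (\<Union>j\<in>J. A j) = (\<Prod>j\<in>J. infprod f (A j))"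
  using assms
proof (induction J)
  case empty
  then show ?case by (simp add: infprod_finite)
next
  case (insert i J)
  have "A i \<inter> (\<Union>j\<in>J. A j) = {}"
    using insert.prems(1) insert.hyps by (auto simp: disjoint_family_on_def)
  then have "infprod f (A i \<union> (\<Union>j\<in>J. A j)) = infprod f (A i) * infprod f (\<Union>j\<in>J. A j)"
    using insert.prems by (intro infprod_Un_disjoint) auto
  moreover have "disjoint_family_on A J"
    using insert.prems(1) by (auto simp: disjoint_family_on_def)
  moreover have "infprod f (\<Union>j\<in>J. A j) = (\<Prod>j\<in>J. infprod f (A j))"
    using insert.prems \<open>disjoint_family_on A J\<close> by (intro insert.IH) auto
  ultimately show ?case using insert.hyps by simp
qed

lemma infprod_LIMSEQ:
  fixes f :: "'a \<Rightarrow> real"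
  assumes A: "A = y ` I" and inj: "inj_on y I"
    and f: "\<And>x. x \<in> A \<Longrightarrow> 0 \<le> f x \<and> f x \<le> 1"
  shows "(\<lambda>N. \<Prod>n<N. if n \<in> I then f (y n) else 1) \<longlonglongrightarrow> infprod f A"
proof -
  have "filterlim (\<lambda>N::nat. y ` (I \<inter> {..<N})) (finite_subsets_at_top A) sequentially"
    unfolding filterlim_finite_subsets_at_top
  proof (intro allI impI)
    fix X assume X: "finite X \<and> X \<subseteq> A"
    then obtain J where J: "J \<subseteq> I" "finite J" "X = y ` J"
      unfolding A by (meson finite_subset_image)
    from \<open>finite J\<close> obtain m where "J \<subseteq> {..<m}"
      by (meson finite_nat_iff_bounded)
    then show "\<forall>\<^sub>F N in sequentially. finite (y ` (I \<inter> {..<N})) \<and> X \<subseteq> y ` (I \<inter> {..<N}) \<and> y ` (I \<inter> {..<N}) \<subseteq> A"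
      unfolding eventually_sequentially using J A
      by (intro exI[of _ m]) force
  qed
  from filterlim_compose[OF infprod_tendsto[OF f] this]
  have "(\<lambda>N. prod f (y ` (I \<inter> {..<N}))) \<longlonglongrightarrow> infprod f A" .
  moreover have "prod f (y ` (I \<inter> {..<N})) = (\<Prod>n<N. if n \<in> I then f (y n) else 1)" for N
  proof -
    have "prod f (y ` (I \<inter> {..<N})) = prod (f \<circ> y) ({..<N} \<inter> I)"
      by (subst prod.reindex) (auto intro: inj_on_subset[OF inj] simp: Int_commute)
    then show ?thesis by (simp add: prod.inter_restrict)
  qed
  ultimately show ?thesis by simp
qed

text \<open>The net is eventually constant: as soon as a finite subset contains a point where
  \<open>Q\<close> fails, its product is 0.\<close>

lemma infprod_of_bool: "infprod (\<lambda>w. of_bool (Q w)) A = (of_bool (\<forall>w\<in>A. Q w) :: real)"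
proof (rule infprod_eqI, rule tendsto_eventually)
  show "\<forall>\<^sub>F F in finite_subsets_at_top A. prod (\<lambda>w. of_bool (Q w)) F = (of_bool (\<forall>w\<in>A. Q w) :: real)"
  proof (cases "\<forall>w\<in>A. Q w")
    case True
    then show ?thesis by (intro eventually_finite_subsets_at_top_weakI) (auto intro!: prod.neutral)
  next
    case False
    then obtain w where "w \<in> A" "\<not> Q w" by auto
    then show ?thesis
      unfolding eventually_finite_subsets_at_top by (intro exI[of _ "{w}"]) auto
  qed
qed

section \<open>Retention as a truth value, and the level of a point\<close>

primrec retained :: "tpoint set \<Rightarrow> (tpoint \<Rightarrow> tpoint \<Rightarrow> bool) \<Rightarrow> nat \<Rightarrow> tpoint \<Rightarrow> bool" where
  "retained \<Xi> c 0 = (\<lambda>z. True)"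
| "retained \<Xi> c (Suc k) = (\<lambda>z. \<forall>w\<in>\<Xi>. snd w < snd z \<and> retained \<Xi> c k w \<longrightarrow> \<not> c z w)"

text \<open>Every e_k is a product of factors 0 and 1, hence itself 0 or 1, also when infinitely
  many points have smaller timers. From here on the recursion runs on truth values.\<close>

lemma matern_e_eq_retained: "matern_e \<Xi> c k z = of_bool (retained \<Xi> c k z)"
proof (induction k arbitrary: z)
  case (Suc k)
  have "(\<lambda>w. 1 - matern_e \<Xi> c k w * of_bool (c z w)) =
      (\<lambda>w. of_bool (\<not> (retained \<Xi> c k w \<and> c z w)))"
    by (auto simp: Suc.IH)
  then have "matern_e \<Xi> c (Suc k) z = of_bool (\<forall>w\<in>{w\<in>\<Xi>. snd w < snd z}. \<not> (retained \<Xi> c k w \<and> c z w))"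
    by (simp only: matern_e.simps infprod_of_bool)
  also have "\<dots> = of_bool (retained \<Xi> c (Suc k) z)"
    by (rule arg_cong[where f = of_bool]) auto
  finally show ?case .
qed simp

text \<open>The recursion only follows strictly decreasing timers, so deleting the points from time
  \<open>t\<close> on is invisible to a point with timer at most \<open>t\<close>. This is why new
  points leave the past classes unchanged.\<close>

lemma retained_timers_below:
  "snd z \<le> t \<Longrightarrow> retained (timers_below t \<Xi>) c k z = retained \<Xi> c k z"
proof (induction k arbitrary: z)
  case (Suc k)
  then show ?case by (auto simp: timers_below_def)
qed simp

text \<open>The operator \<open>e\<^sub>k \<mapsto> e\<^sub>k\<^sub>+\<^sub>1\<close> is antitone and \<open>e\<^sub>0\<close> is maximal.\<close>

lemma retained_alternating:
  assumes "m \<le> n"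
  shows "(odd m \<longrightarrow> retained \<Xi> c m z \<longrightarrow> retained \<Xi> c n z) \<and>
    (even m \<longrightarrow> retained \<Xi> c n z \<longrightarrow> retained \<Xi> c m z)"
  using assms
proof (induction m arbitrary: n z)
  case (Suc m)
  then obtain n' where n: "n = Suc n'" "m \<le> n'" by (metis Suc_le_D Suc_le_mono)
  show ?case using Suc.IH[OF n(2)] unfolding n by auto
qed simp

text \<open>\<open>level_index k i\<close> is the position of the word at which the codes with index at most \<open>i\<close>
  differ from those with index above \<open>i\<close>.\<close>

definition level_index :: "nat \<Rightarrow> nat \<Rightarrow> nat" where
  "level_index k i = (if i < k div 2 then 2 * i + 2 else 2 * (k - i) - 1)"

text \<open>By \<open>retained_level_index_antimono\<close> the counted indices form an initial
  segment of \<open>{..<k}\<close>, so their number is the index of the class of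
  \<open>z\<close>.\<close>

definition level :: "nat \<Rightarrow> tpoint set \<Rightarrow> (tpoint \<Rightarrow> tpoint \<Rightarrow> bool) \<Rightarrow> tpoint \<Rightarrow> nat" where
  "level k \<Xi> c z = card {i. i < k \<and> retained \<Xi> c (level_index k i) z}"

text \<open>An earlier point in contention keeps a point at level \<open>i\<close> or below exactly
  when its own level reaches this value; see \<open>less_level_iff_neighbours\<close>.\<close>

definition level_threshold :: "nat \<Rightarrow> nat \<Rightarrow> nat" where
  "level_threshold k i = (if i < k div 2 then k - i else k - i - 1)"

lemma level_le: "level k \<Xi> c z \<le> k"
proof -
  have "card {i. i < k \<and> retained \<Xi> c (level_index k i) z} \<le> card {..<k}"
    by (rule card_mono) auto
  then show ?thesis by (simp add: level_def)
qed

text \<open>The relevant positions are the even numbers in increasing order, followed by the odd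
  numbers in decreasing order. Along each of the two runs retention at a later position implies
  retention at an earlier one, and retention at an odd position implies it at every even position,
  whichever of the two is larger.\<close>

lemma retained_level_index_antimono:
  assumes "i \<le> j" "j < k" "retained \<Xi> c (level_index k j) z"
  shows "retained \<Xi> c (level_index k i) z"
proof -
  note alt = retained_alternating[of _ _ \<Xi> c z]
  consider "j < k div 2" | "i < k div 2" "\<not> j < k div 2" | "\<not> i < k div 2" using assms(1) by linarith
  then show ?thesis
  proof cases
    case 1
    then show ?thesis using alt[of "2*i+2" "2*j+2"] assms by (auto simp: level_index_def)
  next
    case 2
    then show ?thesis
      using alt[of "2*i+2" "2*(k-j)-1"] alt[of "2*(k-j)-1" "2*i+2"] assms
      by (cases "2*i+2 \<le> 2*(k-j)-1") (auto simp: level_index_def)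
  next
    case 3
    then show ?thesis using alt[of "2*(k-j)-1" "2*(k-i)-1"] assms by (auto simp: level_index_def)
  qed
qed

lemma less_level_iff:
  assumes "i < k"
  shows "i < level k \<Xi> c z \<longleftrightarrow> retained \<Xi> c (level_index k i) z"
proof -
  let ?S = "{i. i < k \<and> retained \<Xi> c (level_index k i) z}"
  have fin: "finite ?S" by simp
  show ?thesis
  proof
    assume r: "retained \<Xi> c (level_index k i) z"
    have "{..i} \<subseteq> ?S" using retained_level_index_antimono[OF _ assms r] assms by auto
    from card_mono[OF fin this] show "i < level k \<Xi> c z" by (simp add: level_def)
  next
    assume l: "i < level k \<Xi> c z"
    show "retained \<Xi> c (level_index k i) z"
    proof (rule ccontr)
      assume n: "\<not> retained \<Xi> c (level_index k i) z"
      have "?S \<subseteq> {..<i}"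
        using retained_level_index_antimono[of i _ k \<Xi> c z] n by (auto simp: not_less[symmetric])
      from card_mono[OF _ this] l show False by (simp add: level_def)
    qed
  qed
qed

text \<open>This inverts \<open>level_index\<close>: a positive even position \<open>2 * r\<close>
  belongs to the index \<open>r - 1\<close>, an odd position \<open>2 * r + 1\<close> to
  \<open>k - r - 1\<close>. At position 0 both sides are true.\<close>

lemma retained_iff_level:
  assumes "m \<le> k"
  shows "retained \<Xi> c m z \<longleftrightarrow> (if even m then m div 2 else k - m div 2) \<le> level k \<Xi> c z"
proof (cases "even m")
  case True
  then obtain r where r: "m = 2 * r" by blast
  show ?thesis
  proof (cases r)
    case (Suc i)
    then have "i < k div 2" "i < k" "level_index k i = m" using r assms by (auto simp: level_index_def)
    then show ?thesis using less_level_iff[of i k \<Xi> c z] Suc r by (simp add: Suc_le_eq)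
  qed (use r in auto)
next
  case False
  then obtain r where r: "m = 2 * r + 1" by (auto elim: oddE)
  define i where "i = k - r - 1"
  have "i < k" "\<not> i < k div 2" "2 * (k - i) - 1 = m"
    using r assms by (auto simp: i_def)
  then have "i < k" "level_index k i = m" by (auto simp: level_index_def)
  moreover have "i < l \<longleftrightarrow> k - r \<le> l" for l using r assms unfolding i_def by auto
  ultimately show ?thesis using less_level_iff[of i k \<Xi> c z] r False by simp
qed

text \<open>One step of the recursion, expressed by levels alone: retention at a position means no
  contention with an earlier point retained at the preceding position, and that retention is again a
  lower bound on the level.\<close>

lemma less_level_iff_neighbours:
  assumes "i < k"
  shows "i < level k \<Xi> c z \<longleftrightarrow>
    (\<forall>w\<in>\<Xi>. snd w < snd z \<and> level_threshold k i \<le> level k \<Xi> c w \<longrightarrow> \<not> c z w)"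
proof -
  define m where "m = level_index k i - 1"
  have m: "level_index k i = Suc m" "m \<le> k"
    "(if even m then m div 2 else k - m div 2) = level_threshold k i"
    using assms by (auto simp: m_def level_index_def level_threshold_def)
  show ?thesis
    unfolding less_level_iff[OF assms] m(1) retained.simps retained_iff_level[OF m(2)] m(3) ..
qed

text \<open>A single formula serves both shapes of the code: for small \<open>j\<close> the
  condition on odd letters is empty, for large \<open>j\<close> the condition on even letters is
  always satisfied.\<close>

lemma matern_code_eq:
  assumes "j \<le> k"
  shows "matern_code k j =
    map (\<lambda>i. of_bool ((even i \<and> i \<le> 2 * j) \<or> (odd i \<and> 2 * (k - j) + 1 \<le> i))) [1..<Suc k]"
proof -
  have pairs: "concat (replicate r [0, 1]) = map (\<lambda>i. of_bool (even i) :: real) [1..<Suc (2 * r)]" for r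
  proof (induction r)
    case (Suc r)
    have "concat (replicate (Suc r) [0, 1::real]) = concat (replicate r [0, 1]) @ [0, 1]"
      by (simp only: replicate_Suc concat.simps) (induction r, auto)
    then show ?case using Suc by simp
  qed simp
  have const: "replicate n b = map (\<lambda>i. b) [a..<a+n]" for n a :: nat and b :: real
    by (simp add: map_replicate_const)
  have split: "[1..<Suc k] = [1..<Suc l] @ [Suc l..<Suc l + (k - l)]" if "l \<le> k" for l
    using that upt_add_eq_append[of 1 "Suc l" "k - l"] by simp
  show ?thesis
  proof (cases "j \<le> k div 2")
    case True
    then have "2 * j \<le> k" by simp
    then show ?thesis using True
      unfolding matern_code_def pairs const[of "k - 2*j" 0 "Suc (2*j)"] split[OF \<open>2 * j \<le> k\<close>]
      by (auto simp del: upt_Suc)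
  next
    case False
    then have k: "2 * (k - j) \<le> k" "2 * j - k = k - 2 * (k - j)" using assms by auto
    have "2 * (k - j) < i \<Longrightarrow> i \<le> k \<Longrightarrow> even i \<Longrightarrow> i \<le> 2 * j" for i using False by linarith
    then show ?thesis using False assms
      unfolding matern_code_def pairs k(2) const[of "k - 2*(k-j)" 1 "Suc (2*(k-j))"] split[OF k(1)]
      by (auto simp del: upt_Suc)
  qed
qed

text \<open>The step \<open>w\<close> contains the fact that every word is a code, namely the one
  indexed by the level. What remains is that different indices have different codes.\<close>

lemma matern_class_eq:
  assumes "j \<le> k"
  shows "matern_class k j \<Xi> c = {z\<in>\<Xi>. level k \<Xi> c z = j}"
proof -
  have "matern_word \<Xi> c k z = matern_code k j \<longleftrightarrow> level k \<Xi> c z = j" for z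
  proof -
    define l where "l = level k \<Xi> c z"
    have l: "l \<le> k" by (simp add: l_def level_le)
    have w: "matern_word \<Xi> c k z = matern_code k l"
    proof -
      have "retained \<Xi> c i z \<longleftrightarrow> (even i \<and> i \<le> 2 * l) \<or> (odd i \<and> 2 * (k - l) + 1 \<le> i)"
        if i: "i \<in> set [1..<Suc k]" for i
      proof -
        have "i \<le> k" using i by auto
        then show ?thesis
          unfolding retained_iff_level[OF \<open>i \<le> k\<close>] l_def[symmetric] using l
          by (cases "even i") (auto elim!: evenE oddE)
      qed
      then show ?thesis
        unfolding matern_word_def matern_code_eq[OF l] matern_e_eq_retained
        by (intro map_cong refl) (simp del: upt_Suc)
    qed
    show ?thesis unfolding w l_def[symmetric]
    proof
      assume eq: "matern_code k l = matern_code k j"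
      have eq': "((even i \<and> i \<le> 2 * l) \<or> (odd i \<and> 2 * (k - l) + 1 \<le> i)) \<longleftrightarrow>
          ((even i \<and> i \<le> 2 * j) \<or> (odd i \<and> 2 * (k - j) + 1 \<le> i))" if "1 \<le> i" "i \<le> k" for i
      proof -
        have "i \<in> set [1..<Suc k]" using that by auto
        then show ?thesis
          using eq unfolding matern_code_eq[OF l] matern_code_eq[OF assms] map_eq_conv of_bool_eq_iff
          by blast
      qed
      \<comment> \<open>The letter at position \<open>level_index k i\<close> of the code with index
        l is 1 exactly when i < l, so equal codes have the same indices below l and below j.\<close>
      have *: "i < l \<longleftrightarrow> i < j" if "i < k" for i
      proof (cases "i < k div 2")
        case True
        then have "2 * i + 2 \<le> k" by linarith
        then show ?thesis using eq'[of "2*i+2"] by auto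
      next
        case False
        have "1 \<le> 2*(k-i)-1" "2*(k-i)-1 \<le> k" "odd (2*(k-i)-1)" using False that by auto
        moreover have "2*(k-l)+1 \<le> 2*(k-i)-1 \<longleftrightarrow> i < l" "2*(k-j)+1 \<le> 2*(k-i)-1 \<longleftrightarrow> i < j"
          using that l assms by auto
        ultimately show ?thesis using eq'[of "2*(k-i)-1"] by simp
      qed
      show "l = j" using *[of l] *[of j] l assms by (metis linorder_neqE_nat less_le_trans less_irrefl)
    qed simp
  qed
  then show ?thesis by (auto simp: matern_class_def)
qed

lemma level_timers_below:
  "snd z \<le> t \<Longrightarrow> level k (timers_below t \<Xi>) c z = level k \<Xi> c z"
  by (simp add: level_def retained_timers_below)

text \<open>The classes partition the points, so the k + 1 products merge into one whose weight is
  chosen by the level. Levels are taken in the whole configuration; \<open>t\<close> enters only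
  through the range of the product, which makes different times comparable.\<close>

lemma prod_infprod_matern_class:
  assumes u: "\<And>j x. j \<le> k \<Longrightarrow> 0 \<le> u j x \<and> u j x \<le> 1"
  shows "(\<Prod>j\<le>k. infprod (\<lambda>z. u j (fst z)) (matern_class k j (timers_below t \<Xi>) c)) =
    infprod (\<lambda>z. u (level k \<Xi> c z) (fst z)) (timers_below t \<Xi>)"
proof -
  let ?A = "\<lambda>j. {z\<in>timers_below t \<Xi>. level k \<Xi> c z = j}"
  have cl: "matern_class k j (timers_below t \<Xi>) c = ?A j" if "j \<le> k" for j
  proof -
    have "z \<in> timers_below t \<Xi> \<Longrightarrow> level k (timers_below t \<Xi>) c z = level k \<Xi> c z" for z
      by (rule level_timers_below) (simp add: timers_below_def)
    then show ?thesis unfolding matern_class_eq[OF that] by auto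
  qed
  have "(\<Prod>j\<le>k. infprod (\<lambda>z. u j (fst z)) (matern_class k j (timers_below t \<Xi>) c)) =
      (\<Prod>j\<in>{..k}. infprod (\<lambda>z. u (level k \<Xi> c z) (fst z)) (?A j))"
    by (intro prod.cong refl) (auto simp: cl intro!: infprod_cong)
  also have "\<dots> = infprod (\<lambda>z. u (level k \<Xi> c z) (fst z)) (\<Union>j\<in>{..k}. ?A j)"
    by (rule infprod_UN_disjoint[symmetric]) (auto simp: disjoint_family_on_def u)
  also have "(\<Union>j\<in>{..k}. ?A j) = timers_below t \<Xi>" by (auto simp: level_le)
  finally show ?thesis .
qed

section \<open>Enumerating the points of a process\<close>

text \<open>Equality of conditional expectations given the algebra generated by \<open>E\<close>:
  the measures with densities \<open>f\<close> and \<open>g\<close>, restricted to this algebra, are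
  finite and agree on the pi-system \<open>E\<close>. The functions \<open>f\<close> and
  \<open>g\<close> themselves are measurable only for the larger algebra.\<close>

lemma nn_integral_eq_generator:
  fixes f g U :: "'a \<Rightarrow> ennreal"
  assumes E: "E \<subseteq> sets M" "Int_stable E" "space M \<in> E"
    and f: "f \<in> borel_measurable M" and g: "g \<in> borel_measurable M"
    and fin: "(\<integral>\<^sup>+x. f x \<partial>M) \<noteq> \<infinity>"
    and eq: "\<And>D. D \<in> E \<Longrightarrow>
      (\<integral>\<^sup>+x. f x * indicator D x \<partial>M) = (\<integral>\<^sup>+x. g x * indicator D x \<partial>M)"
    and U: "U \<in> borel_measurable (sigma (space M) E)"
  shows "(\<integral>\<^sup>+x. U x * f x \<partial>M) = (\<integral>\<^sup>+x. U x * g x \<partial>M)"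
proof -
  let ?F = "sigma (space M) E"
  have E': "E \<subseteq> Pow (space M)" using E(1) sets.space_closed by blast
  have sets_F: "sets ?F = sigma_sets (space M) E" and space_F: "space ?F = space M"
    using E' by (auto simp: space_measure_of)
  have sub: "subalgebra M ?F"
    unfolding subalgebra_def sets_F using E(1) space_F by (auto dest: sets.sigma_sets_subset)
  have sub': "subalgebra (density M u) ?F" for u
    using sub by (simp add: subalgebra_def)
  have em: "emeasure (restr_to_subalg (density M u) ?F) D = (\<integral>\<^sup>+x. u x * indicator D x \<partial>M)"
    if "u \<in> borel_measurable M" "D \<in> sets ?F" for u D
    using that emeasure_restr_to_subalg[OF sub'[of u] that(2)] sub
    by (auto simp: subalgebra_def emeasure_density)
  have EF: "D \<in> sets ?F" if "D \<in> E" for D using that sets_F by auto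
  have "restr_to_subalg (density M f) ?F = restr_to_subalg (density M g) ?F"
  proof (rule measure_eqI_generator_eq[where E = E and \<Omega> = "space M" and A = "\<lambda>_. space M"])
    show "emeasure (restr_to_subalg (density M f) ?F) X = emeasure (restr_to_subalg (density M g) ?F) X"
      if "X \<in> E" for X
      using that eq EF by (simp add: em f g)
    have "(\<integral>\<^sup>+x. f x * indicator (space M) x \<partial>M) = (\<integral>\<^sup>+x. f x \<partial>M)"
      by (rule nn_integral_cong) simp
    then show "emeasure (restr_to_subalg (density M f) ?F) (space M) \<noteq> \<infinity>"
      using fin E(3) EF by (simp add: em f)
  qed (use E E' sets_F sub' in \<open>auto simp: sets_restr_to_subalg\<close>)
  then have "(\<integral>\<^sup>+x. U x \<partial>restr_to_subalg (density M f) ?F) =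
      (\<integral>\<^sup>+x. U x \<partial>restr_to_subalg (density M g) ?F)" by simp
  moreover have "(\<integral>\<^sup>+x. U x \<partial>restr_to_subalg (density M u) ?F) = (\<integral>\<^sup>+x. U x * u x \<partial>M)"
    if "u \<in> borel_measurable M" for u
    using nn_integral_subalgebra2[OF sub'[of u] U] measurable_from_subalg[OF sub U] that
    by (simp add: nn_integral_density mult.commute)
  ultimately show ?thesis using f g by simp
qed

text \<open>Only rectangles inside members of the two exhaustions are tested, because counts of
  points are controlled on bounded sets only. Continuity from below recovers the other
  rectangles.\<close>

lemma pair_measure_eqI_exhaust:
  assumes "sigma_finite_measure M1" "sigma_finite_measure M2"
    and sets: "sets (M1 \<Otimes>\<^sub>M M2) = sets N"
    and P: "range P \<subseteq> sets M1" "incseq P" "(\<Union>n::nat. P n) = space M1"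
    and Q: "range Q \<subseteq> sets M2" "incseq Q" "(\<Union>n. Q n) = space M2"
    and eq: "\<And>n A B. A \<in> sets M1 \<Longrightarrow> A \<subseteq> P n \<Longrightarrow> B \<in> sets M2 \<Longrightarrow> B \<subseteq> Q n \<Longrightarrow>
      emeasure M1 A * emeasure M2 B = emeasure N (A \<times> B)"
  shows "M1 \<Otimes>\<^sub>M M2 = N"
proof -
  interpret M1: sigma_finite_measure M1 by fact
  interpret M2: sigma_finite_measure M2 by fact
  interpret pair_sigma_finite M1 M2 ..
  show ?thesis
  proof (rule pair_measure_eqI[OF assms(1,2) sets])
    fix A B assume A: "A \<in> sets M1" and B: "B \<in> sets M2"
    let ?R = "\<lambda>n. (A \<inter> P n) \<times> (B \<inter> Q n)"
    have Pn: "P n \<in> sets M1" and Qn: "Q n \<in> sets M2" for n using P(1) Q(1) by auto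
    have R: "?R n \<in> sets (M1 \<Otimes>\<^sub>M M2)" for n using A B Pn Qn by auto
    have inc: "incseq ?R" using P(2) Q(2) unfolding incseq_def by fast
    have "(\<Union>n. ?R n) = A \<times> B"
    proof (intro equalityI subsetI)
      fix z assume z: "z \<in> A \<times> B"
      then have "fst z \<in> space M1" "snd z \<in> space M2"
        using A B sets.sets_into_space by fastforce+
      then obtain i j where "fst z \<in> P i" "snd z \<in> Q j" using P(3) Q(3) by blast
      then have "fst z \<in> P (max i j)" "snd z \<in> Q (max i j)"
        using P(2) Q(2) unfolding incseq_def by (meson max.cobounded1 max.cobounded2 subsetD)+
      then show "z \<in> (\<Union>n. ?R n)" using z by (cases z) auto
    qed auto
    then have "emeasure N (A \<times> B) = (SUP n. emeasure N (?R n))"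
      "emeasure (M1 \<Otimes>\<^sub>M M2) (A \<times> B) = (SUP n. emeasure (M1 \<Otimes>\<^sub>M M2) (?R n))"
      using SUP_emeasure_incseq[of ?R N] SUP_emeasure_incseq[of ?R "M1 \<Otimes>\<^sub>M M2"] R inc sets
      by (simp_all add: image_subset_iff)
    moreover have "emeasure N (?R n) = emeasure (M1 \<Otimes>\<^sub>M M2) (?R n)" for n
      using eq[of "A \<inter> P n" n "B \<inter> Q n"] A B Pn Qn
      by (simp add: M2.emeasure_pair_measure_Times)
    ultimately show "emeasure M1 A * emeasure M2 B = emeasure N (A \<times> B)"
      using A B by (simp add: M2.emeasure_pair_measure_Times)
  qed
qed

text \<open>The number of points is random, so label \<open>n\<close> carries a point only on the
  event \<open>V n\<close>; elsewhere \<open>Y n\<close> is arbitrary. Measurability with respect to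
  \<open>F\<close> is what admits these points to \<open>contention_variables\<close>.\<close>

definition enumerates ::
  "'w measure \<Rightarrow> ('w \<Rightarrow> 'a::topological_space set) \<Rightarrow> (nat \<Rightarrow> 'w \<Rightarrow> 'a) \<Rightarrow> (nat \<Rightarrow> 'w set) \<Rightarrow> bool" where
  "enumerates F \<Psi> Y V \<longleftrightarrow> (\<forall>n. Y n \<in> F \<rightarrow>\<^sub>M borel) \<and> (\<forall>n. V n \<in> sets F) \<and>
     (\<forall>\<omega>\<in>space F. \<Psi> \<omega> = (\<lambda>n. Y n \<omega>) ` {n. \<omega> \<in> V n} \<and> inj_on (\<lambda>n. Y n \<omega>) {n. \<omega> \<in> V n})"

lemma space_process_algebra [simp]: "space (process_algebra N \<nu> \<Psi>) = space N"
  unfolding process_algebra_def by (auto simp: space_measure_of_conv)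

lemma card_measurable_process_algebra:
  assumes B: "B \<in> sets \<nu>" "bounded B"
  shows "(\<lambda>\<omega>. card (\<Psi> \<omega> \<inter> B)) \<in> process_algebra N \<nu> \<Psi> \<rightarrow>\<^sub>M count_space UNIV"
proof (rule measurable_count_space_eq2_countable[THEN iffD2])
  have "{\<omega>\<in>space N. card (\<Psi> \<omega> \<inter> B) = n} \<in> sets (process_algebra N \<nu> \<Psi>)" for n
    unfolding process_algebra_def using B by (subst sets_measure_of) auto
  then show "(\<lambda>\<omega>. card (\<Psi> \<omega> \<inter> B)) \<in> space (process_algebra N \<nu> \<Psi>) \<rightarrow> UNIV \<and>
    (\<forall>a\<in>UNIV. (\<lambda>\<omega>. card (\<Psi> \<omega> \<inter> B)) -` {a} \<inter> space (process_algebra N \<nu> \<Psi>)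
       \<in> sets (process_algebra N \<nu> \<Psi>))"
    by (auto simp: vimage_def Int_def conj_commute)
qed

lemma sets_process_algebra_least:
  assumes "space F = space N"
    and "\<And>B. B \<in> sets \<nu> \<Longrightarrow> bounded B \<Longrightarrow> (\<lambda>\<omega>. card (\<Psi> \<omega> \<inter> B)) \<in> F \<rightarrow>\<^sub>M count_space UNIV"
  shows "sets (process_algebra N \<nu> \<Psi>) \<subseteq> sets F"
proof -
  have "{\<omega>\<in>space N. card (\<Psi> \<omega> \<inter> B) = n} \<in> sets F" if "B \<in> sets \<nu>" "bounded B" for B n
    using measurable_sets[OF assms(2)[OF that], of "{n}"] assms(1)
    by (simp add: vimage_def Int_def conj_commute)
  then have "{{\<omega>\<in>space N. card (\<Psi> \<omega> \<inter> B) = n} |B n. B \<in> sets \<nu> \<and> bounded B} \<subseteq> sets F"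
    by blast
  from sets.sigma_sets_subset[OF this] show ?thesis
    unfolding process_algebra_def assms(1) by (subst sets_measure_of) auto
qed

text \<open>Label \<open>n\<close> stands for the point of the process in the n-th bounded basic
  open set whenever there is exactly one. Local finiteness gives every point such a set, and counts
  of bounded sets suffice to describe the resulting random points.\<close>

lemma point_enumeration:
  fixes \<Psi> :: "'w \<Rightarrow> 'a::{metric_space, second_countable_topology} set"
  assumes space: "\<And>\<omega>. \<omega> \<in> space N \<Longrightarrow> \<Psi> \<omega> \<subseteq> space \<nu>"
    and fin: "\<And>\<omega> B. \<omega> \<in> space N \<Longrightarrow> bounded B \<Longrightarrow> finite (\<Psi> \<omega> \<inter> B)"
    and borel: "\<And>B. B \<in> sets borel \<Longrightarrow> B \<inter> space \<nu> \<in> sets \<nu>"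
  obtains Y V where "enumerates (process_algebra N \<nu> \<Psi>) \<Psi> Y V"
proof -
  let ?G = "process_algebra N \<nu> \<Psi>"
  have card_meas: "{\<omega>\<in>space N. card (\<Psi> \<omega> \<inter> B) = n} \<in> sets ?G" if "B \<in> sets borel" "bounded B" for B n
  proof -
    have "\<Psi> \<omega> \<inter> B = \<Psi> \<omega> \<inter> (B \<inter> space \<nu>)" if "\<omega> \<in> space N" for \<omega> using space[OF that] by auto
    then have "{\<omega>\<in>space N. card (\<Psi> \<omega> \<inter> B) = n} =
        (\<lambda>\<omega>. card (\<Psi> \<omega> \<inter> (B \<inter> space \<nu>))) -` {n} \<inter> space ?G" by auto
    moreover have "bounded (B \<inter> space \<nu>)" using that(2) by (rule bounded_subset) auto
    ultimately show ?thesis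
      using measurable_sets[OF card_measurable_process_algebra[OF borel[OF that(1)]], of "{n}"] by simp
  qed
  obtain \<B> :: "'a set set" where \<B>: "countable \<B>" "topological_basis \<B>" using ex_countable_basis by blast
  define \<C> where "\<C> = insert {} {b\<in>\<B>. bounded b}"
  have \<C>: "countable \<C>" "\<C> \<noteq> {}" using \<B>(1) by (auto simp: \<C>_def)
  define c where "c = from_nat_into \<C>"
  have range_c: "range c = \<C>" unfolding c_def by (rule range_from_nat_into[OF \<C>(2,1)])
  have c: "c n \<in> sets borel" "bounded (c n)" for n
  proof -
    have "c n \<in> \<C>" using range_c by blast
    then show "c n \<in> sets borel" "bounded (c n)"
      using topological_basis_open[OF \<B>(2)] by (auto simp: \<C>_def)
  qed
  define W where "W n = {\<omega>\<in>space N. card (\<Psi> \<omega> \<inter> c n) = 1}" for n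
  have W: "W n \<in> sets ?G" for n unfolding W_def by (rule card_meas[OF c])
  \<comment> \<open>The default is one fixed value, so outside \<open>W n\<close> the preimage of a
    Borel set is everything or nothing.\<close>
  define Y where "Y n \<omega> = (if \<omega> \<in> W n then THE z. \<Psi> \<omega> \<inter> c n = {z} else undefined)" for n \<omega>
  have Y: "\<Psi> \<omega> \<inter> c n = {Y n \<omega>}" if "\<omega> \<in> W n" for n \<omega>
  proof -
    from that obtain z where z: "\<Psi> \<omega> \<inter> c n = {z}" unfolding W_def by (auto simp: card_1_singleton_iff)
    then have "(THE z. \<Psi> \<omega> \<inter> c n = {z}) = z" by auto
    then show ?thesis using z that by (simp add: Y_def)
  qed
  have Y_meas: "Y n \<in> ?G \<rightarrow>\<^sub>M borel" for n
  proof (rule measurableI)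
    fix B :: "'a set" assume B: "B \<in> sets borel"
    have b: "bounded (c n \<inter> B)" using c(2) by (rule bounded_subset) auto
    have key: "\<omega> \<in> W n \<Longrightarrow> card (\<Psi> \<omega> \<inter> (c n \<inter> B)) = 1 \<longleftrightarrow> Y n \<omega> \<in> B" for \<omega>
    proof -
      assume "\<omega> \<in> W n"
      then have "\<Psi> \<omega> \<inter> (c n \<inter> B) = {Y n \<omega>} \<inter> B" using Y by (auto simp flip: Int_assoc)
      then show ?thesis by (auto simp: Int_insert_left)
    qed
    have "W n \<subseteq> space N" "\<omega> \<notin> W n \<Longrightarrow> Y n \<omega> = undefined" for \<omega> by (auto simp: W_def Y_def)
    then have "Y n -` B \<inter> space ?G =
        (W n \<inter> {\<omega>\<in>space N. card (\<Psi> \<omega> \<inter> (c n \<inter> B)) = 1}) \<union> (if undefined \<in> B then space ?G - W n else {})"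
      using key by (cases "undefined \<in> B") (force simp del: One_nat_def)+
    also have "\<dots> \<in> sets ?G" using W sets.compl_sets[OF W[of n]] card_meas[OF _ b, of 1] B c by auto
    finally show "Y n -` B \<inter> space ?G \<in> sets ?G" .
  qed simp
  \<comment> \<open>Of all labels of the same point only the least is kept. Equality of two random
    points is written as distance 0 to obtain a measurable event.\<close>
  define V where "V n = W n - (\<Union>i\<in>{..<n}. {\<omega>\<in>space ?G. dist (Y i \<omega>) (Y n \<omega>) = 0} \<inter> W i)" for n
  have V_iff: "\<omega> \<in> V n \<longleftrightarrow> \<omega> \<in> W n \<and> (\<forall>i<n. \<omega> \<in> W i \<longrightarrow> Y i \<omega> \<noteq> Y n \<omega>)" for \<omega> n
    by (auto simp: V_def W_def)
  have "{\<omega>\<in>space ?G. dist (Y i \<omega>) (Y n \<omega>) = 0} \<in> sets ?G" for i n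
  proof -
    have "(\<lambda>\<omega>. dist (Y i \<omega>) (Y n \<omega>)) \<in> borel_measurable ?G"
      by (intro borel_measurable_dist Y_meas)
    then show ?thesis by measurable
  qed
  then have V_meas: "V n \<in> sets ?G" for n unfolding V_def using W by (intro sets.Diff sets.finite_UN sets.Int) auto
  have "\<Psi> \<omega> = (\<lambda>n. Y n \<omega>) ` {n. \<omega> \<in> V n}" if \<omega>: "\<omega> \<in> space N" for \<omega>
  proof (intro equalityI subsetI)
    fix z assume z: "z \<in> \<Psi> \<omega>"
    \<comment> \<open>Only finitely many other points lie in the unit ball, so removing them leaves
      an open set, and a basic set around \<open>z\<close> inside it contains no other
      point.\<close>
    let ?F = "\<Psi> \<omega> \<inter> ball z 1 - {z}"
    have "open (ball z 1 - ?F)" using fin[OF \<omega>, of "ball z 1"] by (intro open_Diff finite_imp_closed) auto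
    then obtain b where b: "b \<in> \<B>" "z \<in> b" "b \<subseteq> ball z 1 - ?F"
      using topological_basisE[OF \<B>(2), of "ball z 1 - ?F" z] by auto
    have "bounded b" using b(3) by (meson bounded_ball bounded_subset Diff_subset order_trans)
    then have "b \<in> range c" using b(1) unfolding range_c \<C>_def by auto
    then obtain n where n: "b = c n" by auto
    have "\<Psi> \<omega> \<inter> c n = {z}" using b z unfolding n by auto
    then have "\<omega> \<in> W n" using \<omega> by (simp add: W_def)
    then have "\<omega> \<in> W n \<and> Y n \<omega> = z" using Y[of \<omega> n] \<open>\<Psi> \<omega> \<inter> c n = {z}\<close> by simp
    then have ex: "\<exists>n. \<omega> \<in> W n \<and> Y n \<omega> = z" by blast
    define m where "m = (LEAST n. \<omega> \<in> W n \<and> Y n \<omega> = z)"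
    have "\<omega> \<in> W m \<and> Y m \<omega> = z" unfolding m_def by (rule LeastI_ex[OF ex])
    moreover have "\<not> (\<omega> \<in> W i \<and> Y i \<omega> = z)" if "i < m" for i using not_less_Least that unfolding m_def by blast
    ultimately show "z \<in> (\<lambda>n. Y n \<omega>) ` {n. \<omega> \<in> V n}" unfolding V_iff by force
  next
    fix z assume "z \<in> (\<lambda>n. Y n \<omega>) ` {n. \<omega> \<in> V n}"
    then show "z \<in> \<Psi> \<omega>" using Y unfolding V_iff by blast
  qed
  moreover have "inj_on (\<lambda>n. Y n \<omega>) {n. \<omega> \<in> V n}" for \<omega>
  proof (rule inj_onI)
    fix m n assume "m \<in> {n. \<omega> \<in> V n}" "n \<in> {n. \<omega> \<in> V n}" "Y m \<omega> = Y n \<omega>"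
    then have mn: "\<omega> \<in> V m" "\<omega> \<in> V n" "Y m \<omega> = Y n \<omega>" by simp_all
    have "\<not> m < n" "\<not> n < m" using mn unfolding V_iff[of \<omega> m] V_iff[of \<omega> n] by metis+
    then show "m = n" by simp
  qed
  ultimately show ?thesis using that[of Y V] Y_meas V_meas unfolding enumerates_def by simp
qed

lemma poisson_moments:
  fixes m :: real
  assumes "0 \<le> m"
  shows "(\<Sum>n. of_nat n * ennreal (exp (- m) * m ^ n / fact n)) = ennreal m"
    and "(\<Sum>n. of_nat (n * (n - 1)) * ennreal (exp (- m) * m ^ n / fact n)) = ennreal (m ^ 2)"
proof -
  let ?p = "\<lambda>n. exp (- m) * m ^ n / fact n"
  have p: "?p sums 1"
  proof -
    have "(\<lambda>n. exp (- m) * (m ^ n /\<^sub>R fact n)) sums (exp (- m) * exp m)"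
      by (intro sums_mult exp_converges)
    then show ?thesis by (simp add: exp_minus divide_inverse mult_ac)
  qed
  \<comment> \<open>Size biasing: multiplication by the index turns the Poisson weights into
    \<open>m\<close> times the shifted weights. Used once it gives the mean, used twice the second
    factorial moment.\<close>
  have shift: "real (Suc n) * ?p (Suc n) = m * ?p n" for n
    by (simp add: field_simps del: of_nat_Suc)
  have "(\<lambda>n. real (Suc n) * ?p (Suc n)) sums (m * 1)"
    using sums_mult[OF p, of m] by (simp only: shift)
  then have s1: "(\<lambda>n. real n * ?p n) sums m" by (subst (asm) sums_Suc_iff) simp
  have "real (Suc n * n) * ?p (Suc n) = m * (real n * ?p n)" for n
    using shift[of n] by (simp only: of_nat_mult mult_ac)
  then have "(\<lambda>n. real (Suc n * n) * ?p (Suc n)) sums (m * m)"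
    using sums_mult[OF s1, of m] by (simp only:)
  then have "(\<lambda>n. real (Suc n * (Suc n - 1)) * ?p (Suc n)) sums (m * m)" by simp
  then have s2: "(\<lambda>n. real (n * (n - 1)) * ?p n) sums (m ^ 2)"
    by (subst (asm) sums_Suc_iff) (simp add: power2_eq_square)
  have *: "(\<Sum>n. of_nat (c n) * ennreal (?p n)) = ennreal r" if "(\<lambda>n. real (c n) * ?p n) sums r" for c r
  proof -
    have "(\<Sum>n. of_nat (c n) * ennreal (?p n)) = (\<Sum>n. ennreal (real (c n) * ?p n))"
      using assms by (intro suminf_cong) (simp add: ennreal_mult'[symmetric] ennreal_of_nat_eq_real_of_nat)
    also have "\<dots> = ennreal r"
      using that assms by (intro suminf_ennreal_eq) auto
    finally show ?thesis .
  qed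
  show "(\<Sum>n. of_nat n * ennreal (?p n)) = ennreal m" by (rule *[OF s1])
  show "(\<Sum>n. of_nat (n * (n - 1)) * ennreal (?p n)) = ennreal (m ^ 2)" by (rule *[OF s2])
qed

lemma (in prob_space) nn_integral_nat_valued:
  fixes X :: "'a \<Rightarrow> nat" and g :: "nat \<Rightarrow> ennreal"
  assumes "X \<in> M \<rightarrow>\<^sub>M count_space UNIV"
  shows "(\<integral>\<^sup>+\<omega>. g (X \<omega>) \<partial>M) = (\<Sum>n. g n * ennreal (prob {\<omega>\<in>space M. X \<omega> = n}))"
proof -
  have A: "{\<omega>\<in>space M. X \<omega> = n} \<in> sets M" for n using assms by measurable
  have "(\<integral>\<^sup>+\<omega>. g (X \<omega>) \<partial>M) = (\<integral>\<^sup>+\<omega>. (\<Sum>n. g n * indicator {\<omega>\<in>space M. X \<omega> = n} \<omega>) \<partial>M)"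
  proof (rule nn_integral_cong)
    fix \<omega> assume \<omega>: "\<omega> \<in> space M"
    have "(\<Sum>n. g n * indicator {\<omega>\<in>space M. X \<omega> = n} \<omega>) =
        (\<Sum>n\<in>{X \<omega>}. g n * indicator {\<omega>\<in>space M. X \<omega> = n} \<omega>)"
      by (rule suminf_finite) auto
    then show "g (X \<omega>) = (\<Sum>n. g n * indicator {\<omega>\<in>space M. X \<omega> = n} \<omega>)" using \<omega> by simp
  qed
  also have "\<dots> = (\<Sum>n. g n * emeasure M {\<omega>\<in>space M. X \<omega> = n})"
    using A by (simp add: nn_integral_suminf nn_integral_cmult)
  finally show ?thesis by (simp add: emeasure_eq_measure)
qed

section \<open>The Poisson process\<close>

locale contention_process = prob_space M for M :: "'w measure" +
  fixes h :: "plane \<Rightarrow> plane \<Rightarrow> real" and \<Lambda> :: "plane measure"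
    and \<Phi> :: "'w \<Rightarrow> tpoint set" and C :: "'w \<Rightarrow> tpoint \<Rightarrow> tpoint \<Rightarrow> bool"
  assumes h_measurable: "case_prod h \<in> borel_measurable (borel \<Otimes>\<^sub>M borel)"
    and h_range: "\<And>x y. 0 \<le> h x y \<and> h x y \<le> 1"
    and sets_\<Lambda>: "sets \<Lambda> = sets borel"
    and \<Lambda>_locally_finite: "locally_finite_measure \<Lambda>"
    and \<Lambda>_h: "(SUP x. \<integral>\<^sup>+ y. ennreal (h x y) \<partial>\<Lambda>) < \<infinity>"
    and \<Phi>_poisson: "poisson_process M (timed_intensity \<Lambda>) \<Phi>"
    and C_contention: "contention_variables M (timed_intensity \<Lambda>) \<Phi> h C"
begin

abbreviation "\<mu> \<equiv> timed_intensity \<Lambda>"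

lemma space_\<Lambda>: "space \<Lambda> = UNIV"
  using sets_eq_imp_space_eq[OF sets_\<Lambda>] by simp

lemma space_\<mu>: "space \<mu> = UNIV \<times> {0..}"
  by (simp add: timed_intensity_def space_pair_measure space_\<Lambda> space_restrict_space)

lemma measurable_\<mu>_borel: "(\<lambda>z. z) \<in> \<mu> \<rightarrow>\<^sub>M borel"
proof -
  have "fst \<in> \<mu> \<rightarrow>\<^sub>M \<Lambda>" unfolding timed_intensity_def by (rule measurable_fst)
  then have 1: "fst \<in> \<mu> \<rightarrow>\<^sub>M borel" using measurable_cong_sets[OF refl sets_\<Lambda>] by blast
  have "(\<lambda>x. x) \<in> restrict_space lborel {0::real..} \<rightarrow>\<^sub>M borel"
    by (intro measurable_restrict_space1) simp
  then have 2: "snd \<in> \<mu> \<rightarrow>\<^sub>M borel" unfolding timed_intensity_def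
    by (rule measurable_compose[OF measurable_snd])
  from borel_measurable_Pair[OF 1 2] show ?thesis by simp
qed

lemma borel_Int_space_\<mu>: "B \<in> sets borel \<Longrightarrow> B \<inter> space \<mu> \<in> sets \<mu>"
  using measurable_sets[OF measurable_\<mu>_borel, of B] by simp

lemma sigma_finite_timers: "sigma_finite_measure (restrict_space lborel {0::real..})"
  by (rule sigma_finite_measure_restrict_space) (auto intro: lborel.sigma_finite_measure_axioms)

lemma emeasure_\<mu>_bounded:
  assumes "bounded B"
  shows "emeasure \<mu> (B \<inter> space \<mu>) < \<infinity>"
proof -
  interpret T: sigma_finite_measure "restrict_space lborel {0::real..}" by (rule sigma_finite_timers)
  obtain r where r: "\<And>z. z \<in> B \<Longrightarrow> norm z \<le> r" using assms by (auto simp: bounded_iff)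
  have "B \<inter> space \<mu> \<subseteq> cball 0 r \<times> {0..r}"
  proof
    fix z assume z: "z \<in> B \<inter> space \<mu>"
    then have "norm (fst z) \<le> r" "\<bar>snd z\<bar> \<le> r"
      using r[of z] norm_fst_le[of "fst z" "snd z"] norm_snd_le[of "snd z" "fst z"] by auto
    then show "z \<in> cball 0 r \<times> {0..r}" using z by (auto simp: space_\<mu> mem_Times_iff)
  qed
  moreover have "{0..r} \<in> sets (restrict_space lborel {0::real..})"
    by (auto simp: sets_restrict_space image_iff intro!: bexI[of _ "{0..r}"])
  ultimately have "emeasure \<mu> (B \<inter> space \<mu>) \<le> emeasure \<mu> (cball 0 r \<times> {0..r})"
    by (intro emeasure_mono) (auto simp: timed_intensity_def sets_\<Lambda>)
  also have "\<dots> = emeasure \<Lambda> (cball 0 r) * emeasure (restrict_space lborel {0..}) {0..r}"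
    unfolding timed_intensity_def using \<open>{0..r} \<in> _\<close>
    by (subst T.emeasure_pair_measure_Times) (auto simp: sets_\<Lambda>)
  also have "\<dots> < \<infinity>"
  proof -
    have "emeasure \<Lambda> (cball 0 r) < \<infinity>"
      using \<Lambda>_locally_finite unfolding locally_finite_measure_def sets_\<Lambda> by auto
    moreover have "emeasure (restrict_space lborel {0..}) {0..r} < \<infinity>"
      by (subst emeasure_restrict_space) (auto simp: emeasure_lborel_Icc_eq)
    ultimately show ?thesis by (simp add: ennreal_mult_less_top)
  qed
  finally show ?thesis .
qed

text \<open>The space of \<open>\<mu>\<close> contains only nonnegative timers, whereas the labelled
  random points take values in the whole Borel space. The push-forward removes this mismatch and the
  density restricts to the window \<open>W\<close>.\<close>

definition intensity :: "tpoint set \<Rightarrow> tpoint measure" where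
  "intensity W = density (distr \<mu> borel (\<lambda>z. z)) (indicator W)"

lemma sets_intensity [measurable_cong, simp]: "sets (intensity W) = sets borel"
  and space_intensity [simp]: "space (intensity W) = UNIV"
  by (simp_all add: intensity_def)

lemma nn_integral_intensity:
  assumes "W \<in> sets borel" "f \<in> borel_measurable borel"
  shows "(\<integral>\<^sup>+z. f z \<partial>intensity W) = (\<integral>\<^sup>+z. indicator W z * f z \<partial>\<mu>)"
  unfolding intensity_def using assms measurable_\<mu>_borel
  by (simp add: nn_integral_density nn_integral_distr)

lemma emeasure_intensity:
  assumes "W \<in> sets borel" "B \<in> sets borel"
  shows "emeasure (intensity W) B = emeasure \<mu> (W \<inter> B \<inter> space \<mu>)"
proof -
  have "emeasure (intensity W) B = (\<integral>\<^sup>+z. indicator B z \<partial>intensity W)"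
    using assms(2) by simp
  also have "\<dots> = (\<integral>\<^sup>+z. indicator W z * indicator B z \<partial>\<mu>)"
    using assms by (intro nn_integral_intensity) auto
  also have "\<dots> = (\<integral>\<^sup>+z. indicator (W \<inter> B \<inter> space \<mu>) z \<partial>\<mu>)"
    by (intro nn_integral_cong) (auto simp: indicator_def)
  also have "\<dots> = emeasure \<mu> (W \<inter> B \<inter> space \<mu>)"
    using assms by (intro nn_integral_indicator borel_Int_space_\<mu>) auto
  finally show ?thesis .
qed

lemma emeasure_intensity_bounded:
  assumes "W \<in> sets borel" "B \<in> sets borel" "bounded B"
  shows "emeasure (intensity W) B < \<infinity>"
  using assms emeasure_\<mu>_bounded[of "W \<inter> B"] by (simp add: emeasure_intensity bounded_subset[of B])

lemma sigma_finite_intensity: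
  assumes "W \<in> sets borel"
  shows "sigma_finite_measure (intensity W)"
proof
  let ?A = "range (\<lambda>n::nat. cball (0::tpoint) (real n))"
  have "\<Union>?A = (UNIV :: tpoint set)"
    by (auto simp: mem_cball dist_norm intro: real_arch_simple)
  moreover have "emeasure (intensity W) (cball 0 (real n)) \<noteq> \<infinity>" for n
    using emeasure_intensity_bounded[OF assms, of "cball 0 (real n)"] by simp
  ultimately show "\<exists>A. countable A \<and> A \<subseteq> sets (intensity W) \<and> \<Union>A = space (intensity W) \<and>
      (\<forall>a\<in>A. emeasure (intensity W) a \<noteq> \<infinity>)"
    by (intro exI[of _ ?A]) auto
qed

text \<open>The factor \<open>s\<close> of the first-order expansion arises here, as the length of
  the time interval. The condition \<open>0 \<le> t\<close> keeps the slab inside the nonnegative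
  timers.\<close>

lemma nn_integral_intensity_slab:
  assumes "0 \<le> t" "0 \<le> s" and f: "f \<in> borel_measurable borel"
  shows "(\<integral>\<^sup>+z. f (fst z) \<partial>intensity (UNIV \<times> {t..<t + s})) = ennreal s * (\<integral>\<^sup>+x. f x \<partial>\<Lambda>)"
proof -
  let ?T = "restrict_space lborel {0::real..}"
  interpret T: sigma_finite_measure ?T by (rule sigma_finite_timers)
  have W: "UNIV \<times> {t..<t + s} \<in> sets (borel :: tpoint measure)"
    by (auto simp: borel_prod[symmetric])
  have f1: "(\<lambda>z. f (fst z)) \<in> borel_measurable (borel :: tpoint measure)"
    using f by (intro measurable_compose[OF _ f]) (auto simp: borel_prod[symmetric])
  have f2: "f \<in> borel_measurable \<Lambda>" using f measurable_cong_sets[OF sets_\<Lambda> refl] by blast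
  have [measurable]: "{t..<t + s} \<in> sets ?T"
    using assms(1) by (auto simp: sets_restrict_space image_iff intro!: bexI[of _ "{t..<t + s}"])
  have "(\<integral>\<^sup>+z. f (fst z) \<partial>intensity (UNIV \<times> {t..<t + s})) =
      (\<integral>\<^sup>+z. indicator (UNIV \<times> {t..<t + s}) z * f (fst z) \<partial>(\<Lambda> \<Otimes>\<^sub>M ?T))"
    using nn_integral_intensity[OF W f1] by (simp add: timed_intensity_def)
  also have "\<dots> = (\<integral>\<^sup>+z. indicator {t..<t + s} (snd z) * f (fst z) \<partial>(\<Lambda> \<Otimes>\<^sub>M ?T))"
    by (intro nn_integral_cong) (auto simp: indicator_def)
  also have "\<dots> = (\<integral>\<^sup>+x. (\<integral>\<^sup>+u. indicator {t..<t + s} u * f x \<partial>?T) \<partial>\<Lambda>)"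
    using f2 by (subst T.nn_integral_fst[symmetric]) (auto)
  also have "\<dots> = (\<integral>\<^sup>+x. ennreal s * f x \<partial>\<Lambda>)"
  proof (rule nn_integral_cong)
    fix x
    have "(\<integral>\<^sup>+u. indicator {t..<t + s} u * f x \<partial>?T) = emeasure ?T {t..<t + s} * f x"
      by (subst nn_integral_multc) auto
    also have "emeasure ?T {t..<t + s} = ennreal s"
      using assms by (subst emeasure_restrict_space) auto
    finally show "(\<integral>\<^sup>+u. indicator {t..<t + s} u * f x \<partial>?T) = ennreal s * f x" .
  qed
  also have "\<dots> = ennreal s * (\<integral>\<^sup>+x. f x \<partial>\<Lambda>)" using f2 by (rule nn_integral_cmult)
  finally show ?thesis .
qed

section \<open>Counts of the process and the algebras of windows\<close>

lemma \<Phi>_subset: "\<omega> \<in> space M \<Longrightarrow> \<Phi> \<omega> \<subseteq> space \<mu>"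
  and \<Phi>_finite: "\<omega> \<in> space M \<Longrightarrow> bounded B \<Longrightarrow> finite (\<Phi> \<omega> \<inter> B)"
  using \<Phi>_poisson unfolding poisson_process_def by auto

lemma \<Phi>_Int_space: "\<omega> \<in> space M \<Longrightarrow> \<Phi> \<omega> \<inter> (B \<inter> space \<mu>) = \<Phi> \<omega> \<inter> B"
  using \<Phi>_subset by auto

abbreviation "\<G> \<equiv> process_algebra M \<mu> \<Phi>"

definition window_algebra :: "tpoint set \<Rightarrow> 'w measure" where
  "window_algebra W = process_algebra M \<mu> (\<lambda>\<omega>. \<Phi> \<omega> \<inter> W)"

lemma space_window_algebra [simp]: "space (window_algebra W) = space M"
  by (simp add: window_algebra_def)

lemma card_measurable_\<G>:
  assumes "B \<in> sets borel" "bounded B"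
  shows "(\<lambda>\<omega>. card (\<Phi> \<omega> \<inter> B)) \<in> \<G> \<rightarrow>\<^sub>M count_space UNIV"
proof -
  have "(\<lambda>\<omega>. card (\<Phi> \<omega> \<inter> (B \<inter> space \<mu>))) \<in> \<G> \<rightarrow>\<^sub>M count_space UNIV"
    using assms by (intro card_measurable_process_algebra borel_Int_space_\<mu>) (auto intro: bounded_subset)
  then show ?thesis by (rule measurable_cong[THEN iffD1, rotated]) (simp add: \<Phi>_Int_space)
qed

lemma subalgebra_\<G>: "subalgebra M \<G>"
proof -
  have "sets \<G> \<subseteq> events"
    using \<Phi>_poisson by (intro sets_process_algebra_least) (auto simp: poisson_process_def)
  then show ?thesis by (simp add: subalgebra_def)
qed

lemma borel_of_sets_\<mu>:
  assumes "B \<in> sets \<mu>"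
  shows "B \<in> sets borel"
proof -
  let ?T = "restrict_space lborel {0::real..}"
  have "sets \<mu> \<subseteq> sets ((borel :: plane measure) \<Otimes>\<^sub>M (borel :: real measure))"
    unfolding timed_intensity_def sets_pair_measure[of \<Lambda>]
  proof (rule sets.sigma_sets_subset')
    have "a \<times> b \<in> sets ((borel :: plane measure) \<Otimes>\<^sub>M (borel :: real measure))"
      if "a \<in> sets \<Lambda>" "b \<in> sets ?T" for a b
      using that by (intro pair_measureI) (auto simp: sets_\<Lambda> sets_restrict_space)
    then show "{a \<times> b |a b. a \<in> sets \<Lambda> \<and> b \<in> sets ?T} \<subseteq> sets (borel \<Otimes>\<^sub>M borel)" by blast
    show "space \<Lambda> \<times> space ?T \<in> sets (borel \<Otimes>\<^sub>M borel)"
      by (intro pair_measureI) (simp_all add: space_\<Lambda> space_restrict_space)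
  qed
  then have "sets \<mu> \<subseteq> sets (borel :: tpoint measure)" unfolding borel_prod .
  then show ?thesis using assms by blast
qed

lemma subalgebra_window:
  assumes "W \<in> sets borel"
  shows "subalgebra \<G> (window_algebra W)"
proof -
  have "(\<lambda>\<omega>. card (\<Phi> \<omega> \<inter> W \<inter> B)) \<in> \<G> \<rightarrow>\<^sub>M count_space UNIV" if "B \<in> sets \<mu>" "bounded B" for B
    using card_measurable_\<G>[of "W \<inter> B"] borel_of_sets_\<mu>[OF that(1)] assms that(2)
    by (auto simp: Int_assoc intro: bounded_subset)
  then have "sets (process_algebra M \<mu> (\<lambda>\<omega>. \<Phi> \<omega> \<inter> W)) \<subseteq> sets \<G>"
    by (intro sets_process_algebra_least) simp_all
  then show ?thesis by (simp add: subalgebra_def window_algebra_def)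
qed

lemma window_enumeration:
  obtains Y V where "enumerates (window_algebra W) (\<lambda>\<omega>. \<Phi> \<omega> \<inter> W) Y V"
  unfolding window_algebra_def
proof (rule point_enumeration[of M "\<lambda>\<omega>. \<Phi> \<omega> \<inter> W" \<mu>])
  show "finite (\<Phi> \<omega> \<inter> W \<inter> B)" if "\<omega> \<in> space M" "bounded B" for \<omega> B
    using \<Phi>_finite[OF that] by (rule finite_subset[rotated]) auto
qed (use \<Phi>_subset borel_Int_space_\<mu> in blast)+

lemma prob_card:
  assumes "B \<in> sets borel" "bounded B"
  shows "prob {\<omega>\<in>space M. card (\<Phi> \<omega> \<inter> B) = n} =
    exp (- measure (intensity UNIV) B) * measure (intensity UNIV) B ^ n / fact n"
proof -
  have "{\<omega>\<in>space M. card (\<Phi> \<omega> \<inter> B) = n} = {\<omega>\<in>space M. card (\<Phi> \<omega> \<inter> (B \<inter> space \<mu>)) = n}"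
    by (auto simp: \<Phi>_Int_space)
  moreover have "measure \<mu> (B \<inter> space \<mu>) = measure (intensity UNIV) B"
    using emeasure_intensity[of UNIV B] assms by (simp add: measure_def)
  moreover have "bounded (B \<inter> space \<mu>)" using assms(2) by (rule bounded_subset) auto
  ultimately show ?thesis
    using \<Phi>_poisson borel_Int_space_\<mu>[OF assms(1)] unfolding poisson_process_def by auto
qed

lemma card_measurable: 
  assumes "B \<in> sets borel" "bounded B"
  shows "(\<lambda>\<omega>. card (\<Phi> \<omega> \<inter> B)) \<in> M \<rightarrow>\<^sub>M count_space UNIV"
  using measurable_from_subalg[OF subalgebra_\<G> card_measurable_\<G>[OF assms]] .

lemma nn_integral_card:
  assumes "B \<in> sets borel" "bounded B"
  shows "(\<integral>\<^sup>+\<omega>. of_nat (card (\<Phi> \<omega> \<inter> B)) \<partial>M) = emeasure (intensity UNIV) B"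
    and "(\<integral>\<^sup>+\<omega>. of_nat (card (\<Phi> \<omega> \<inter> B) * (card (\<Phi> \<omega> \<inter> B) - 1)) \<partial>M) =
      emeasure (intensity UNIV) B * emeasure (intensity UNIV) B"
proof -
  note nat = nn_integral_nat_valued[OF card_measurable[OF assms]]
  have m: "emeasure (intensity UNIV) B = ennreal (measure (intensity UNIV) B)"
    using emeasure_intensity_bounded[OF _ assms, of UNIV] by (simp add: emeasure_eq_ennreal_measure)
  show "(\<integral>\<^sup>+\<omega>. of_nat (card (\<Phi> \<omega> \<inter> B)) \<partial>M) = emeasure (intensity UNIV) B"
    using nat[of of_nat] unfolding m prob_card[OF assms] poisson_moments(1)[OF measure_nonneg] .
  show "(\<integral>\<^sup>+\<omega>. of_nat (card (\<Phi> \<omega> \<inter> B) * (card (\<Phi> \<omega> \<inter> B) - 1)) \<partial>M) =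
      emeasure (intensity UNIV) B * emeasure (intensity UNIV) B"
    using nat[of "\<lambda>n. of_nat (n * (n - 1))"]
    unfolding m prob_card[OF assms] poisson_moments(2)[OF measure_nonneg]
    by (simp add: power2_eq_square ennreal_mult)
qed

end

section \<open>Independence of disjoint windows\<close>

lemma (in prob_space) indep_var_nn_integral:
  fixes X Y :: "'a \<Rightarrow> ennreal"
  assumes "indep_var borel X borel Y"
  shows "(\<integral>\<^sup>+\<omega>. X \<omega> * Y \<omega> \<partial>M) = (\<integral>\<^sup>+\<omega>. X \<omega> \<partial>M) * (\<integral>\<^sup>+\<omega>. Y \<omega> \<partial>M)"
proof -
  have "case_bool borel borel = (\<lambda>_. borel :: ennreal measure)" by (auto split: bool.split)
  then have "indep_vars (\<lambda>_. borel) (case_bool X Y) UNIV"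
    using assms unfolding indep_var_def by simp
  from indep_vars_nn_integral[OF _ this] show ?thesis
    by (simp add: UNIV_bool mult.commute)
qed

context contention_process
begin

text \<open>Mutual independence of the counts separates the block of the first \<open>r\<close> from
  the last one. The sets are first cut down to the space of \<open>\<mu>\<close>, where the Poisson
  property is formulated; this leaves the counts unchanged.\<close>

lemma card_indep_disjoint:
  fixes A :: "nat \<Rightarrow> tpoint set" and f :: "(nat \<Rightarrow> nat) \<Rightarrow> ennreal" and g :: "nat \<Rightarrow> ennreal"
  assumes A: "\<And>i. i < Suc r \<Longrightarrow> A i \<in> sets borel \<and> bounded (A i)"
    and disj: "disjoint_family_on A {..<Suc r}"
  shows "(\<integral>\<^sup>+\<omega>. f (\<lambda>j\<in>{..<r}. card (\<Phi> \<omega> \<inter> A j)) * g (card (\<Phi> \<omega> \<inter> A r)) \<partial>M) =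
    (\<integral>\<^sup>+\<omega>. f (\<lambda>j\<in>{..<r}. card (\<Phi> \<omega> \<inter> A j)) \<partial>M) * (\<integral>\<^sup>+\<omega>. g (card (\<Phi> \<omega> \<inter> A r)) \<partial>M)"
proof -
  define X where "X i \<omega> = card (\<Phi> \<omega> \<inter> (A i \<inter> space \<mu>))" for i \<omega>
  have X: "X i \<omega> = card (\<Phi> \<omega> \<inter> A i)" if "\<omega> \<in> space M" for i \<omega>
    using that by (simp add: X_def \<Phi>_Int_space)
  have "disjoint_family_on (\<lambda>i. A i \<inter> space \<mu>) {..<Suc r}"
    using disj by (auto simp: disjoint_family_on_def)
  moreover have "\<forall>i<Suc r. A i \<inter> space \<mu> \<in> sets \<mu> \<and> bounded (A i \<inter> space \<mu>)"
    using A borel_Int_space_\<mu> bounded_subset by (metis inf_le1)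
  moreover have "indep_vars (\<lambda>_. count_space UNIV) (\<lambda>i \<omega>. card (\<Phi> \<omega> \<inter> B i)) {..<n}"
    if "(\<forall>i<n. B i \<in> sets \<mu> \<and> bounded (B i)) \<and> disjoint_family_on B {..<n}" for n and B :: "nat \<Rightarrow> tpoint set"
    using \<Phi>_poisson that unfolding poisson_process_def by simp
  ultimately have "indep_vars (\<lambda>_. count_space UNIV) X {..<Suc r}"
    unfolding X_def[abs_def] by simp
  then have "indep_var (PiM {..<r} (\<lambda>_. count_space UNIV)) (\<lambda>\<omega>. \<lambda>i\<in>{..<r}. X i \<omega>)
      (PiM {r} (\<lambda>_. count_space UNIV)) (\<lambda>\<omega>. \<lambda>i\<in>{r}. X i \<omega>)"
    by (rule indep_var_restrict) auto
  then have "indep_var borel (f \<circ> (\<lambda>\<omega>. \<lambda>i\<in>{..<r}. X i \<omega>)) borel ((\<lambda>x. g (x r)) \<circ> (\<lambda>\<omega>. \<lambda>i\<in>{r}. X i \<omega>))"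
    by (rule indep_var_compose) (simp_all add: count_space_PiM_finite)
  from indep_var_nn_integral[OF this]
  have "(\<integral>\<^sup>+\<omega>. f (\<lambda>j\<in>{..<r}. X j \<omega>) * g (X r \<omega>) \<partial>M) =
      (\<integral>\<^sup>+\<omega>. f (\<lambda>j\<in>{..<r}. X j \<omega>) \<partial>M) * (\<integral>\<^sup>+\<omega>. g (X r \<omega>) \<partial>M)"
    by (simp add: o_def)
  then show ?thesis by (simp add: X cong: nn_integral_cong)
qed

text \<open>The counts of arbitrary sets are sums of counts of the atoms of the algebra they generate.\<close>

lemma card_indep:
  fixes B :: "nat \<Rightarrow> tpoint set"
  assumes B: "\<And>i. i < q \<Longrightarrow> B i \<in> sets borel \<and> bounded (B i)"
    and B': "B' \<in> sets borel" "bounded B'" "\<And>i. i < q \<Longrightarrow> B i \<inter> B' = {}"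
  shows "(\<integral>\<^sup>+\<omega>. indicator {\<omega>\<in>space M. \<forall>i<q. card (\<Phi> \<omega> \<inter> B i) = n i} \<omega> *
        of_nat (card (\<Phi> \<omega> \<inter> B')) \<partial>M) =
      emeasure M {\<omega>\<in>space M. \<forall>i<q. card (\<Phi> \<omega> \<inter> B i) = n i} * emeasure (intensity UNIV) B'"
proof -
  let ?E = "{\<omega>\<in>space M. \<forall>i<q. card (\<Phi> \<omega> \<inter> B i) = n i}"
  \<comment> \<open>\<open>atom \<sigma>\<close> collects the points lying in exactly those
    \<open>B i\<close> with \<open>i \<in> \<sigma>\<close>. Points in none of the sets are
    excluded, which keeps the atoms bounded.\<close>
  define atom :: "nat set \<Rightarrow> tpoint set" where "atom \<sigma> = {z. (\<exists>i<q. z \<in> B i) \<and> (\<forall>i<q. z \<in> B i \<longleftrightarrow> i \<in> \<sigma>)}" for \<sigma>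
  obtain e where e: "bij_betw e {0..<card (Pow {..<q})} (Pow {..<q})"
    using ex_bij_betw_nat_finite[of "Pow {..<q}"] by auto
  define r where "r = card (Pow {..<q})"
  have e: "bij_betw e {..<r} (Pow {..<q})" using e by (simp add: r_def atLeast0LessThan)
  define A where "A j = (if j < r then atom (e j) else B')" for j
  have atom_sub: "atom \<sigma> \<subseteq> (\<Union>i\<in>{..<q}. B i)" for \<sigma> by (auto simp: atom_def)
  have bdd: "bounded (\<Union>i\<in>{..<q}. B i)" using B by (intro bounded_UN) auto
  have atom_sets: "atom \<sigma> \<in> sets borel" for \<sigma>
  proof -
    have "atom \<sigma> = (\<Union>i\<in>{..<q}. B i) - (\<Union>i\<in>{..<q}. if i \<in> \<sigma> then UNIV - B i else B i)"
      by (auto simp: atom_def split: if_splits)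
    also have "\<dots> \<in> sets borel" using B by (intro sets.Diff sets.finite_UN) auto
    finally show ?thesis .
  qed
  have A: "A i \<in> sets borel \<and> bounded (A i)" if "i < Suc r" for i
    using atom_sets atom_sub bounded_subset[OF bdd] B' by (auto simp: A_def)
  have disj: "disjoint_family_on A {..<Suc r}"
  proof (unfold disjoint_family_on_def, intro ballI impI)
    fix i j assume ij: "i \<in> {..<Suc r}" "j \<in> {..<Suc r}" "i \<noteq> j"
    have 1: "atom (e i) \<inter> atom (e j) = {}" if "i < r" "j < r"
    proof -
      have "e i \<noteq> e j" "e i \<subseteq> {..<q}" "e j \<subseteq> {..<q}"
        using e that ij by (auto simp: bij_betw_def inj_on_def)
      then show ?thesis by (fastforce simp: atom_def)
    qed
    have 2: "atom \<sigma> \<inter> B' = {}" for \<sigma> using B'(3) by (auto simp: atom_def)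
    show "A i \<inter> A j = {}" using 1 2 ij by (auto simp: A_def less_Suc_eq)
  qed
  have card_B: "card (\<Phi> \<omega> \<inter> B i) = (\<Sum>j\<in>{j. j < r \<and> i \<in> e j}. card (\<Phi> \<omega> \<inter> A j))"
    if \<omega>: "\<omega> \<in> space M" and i: "i < q" for i \<omega>
  proof -
    have "B i = (\<Union>j\<in>{j. j < r \<and> i \<in> e j}. A j)"
    proof (intro equalityI subsetI)
      fix z assume z: "z \<in> B i"
      define \<sigma> where "\<sigma> = {i. i < q \<and> z \<in> B i}"
      have "\<sigma> \<in> Pow {..<q}" by (auto simp: \<sigma>_def)
      then have "\<sigma> \<in> e ` {..<r}" using bij_betw_imp_surj_on[OF e] by simp
      then obtain j where j: "j < r" "e j = \<sigma>" by blast
      have "z \<in> atom \<sigma>" "i \<in> \<sigma>" using z i by (auto simp: atom_def \<sigma>_def)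
      then show "z \<in> (\<Union>j\<in>{j. j < r \<and> i \<in> e j}. A j)" using j by (auto simp: A_def)
    next
      fix z assume "z \<in> (\<Union>j\<in>{j. j < r \<and> i \<in> e j}. A j)"
      then show "z \<in> B i" using i by (auto simp: A_def atom_def)
    qed
    then have "\<Phi> \<omega> \<inter> B i = (\<Union>j\<in>{j. j < r \<and> i \<in> e j}. \<Phi> \<omega> \<inter> A j)" by auto
    moreover have "finite (\<Phi> \<omega> \<inter> A j)" if "j < r" for j using \<Phi>_finite[OF \<omega>] A that by simp
    moreover have "(\<Phi> \<omega> \<inter> A j) \<inter> (\<Phi> \<omega> \<inter> A l) = {}" if "j < r" "l < r" "j \<noteq> l" for j l
      using disjoint_family_onD[OF disj, of j l] that by auto
    ultimately show ?thesis
      using card_UN_disjoint[of "{j. j < r \<and> i \<in> e j}" "\<lambda>j. \<Phi> \<omega> \<inter> A j"] by simp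
  qed
  \<comment> \<open>By \<open>card_B\<close> the prescribed counts are a condition on the vector of
    atom counts, so the event is a function of the first block.\<close>
  define f :: "(nat \<Rightarrow> nat) \<Rightarrow> ennreal" where
    "f x = indicator {x. \<forall>i<q. (\<Sum>j\<in>{j. j < r \<and> i \<in> e j}. x j) = n i} x" for x
  have f: "f (\<lambda>j\<in>{..<r}. card (\<Phi> \<omega> \<inter> A j)) = indicator ?E \<omega>" if "\<omega> \<in> space M" for \<omega>
  proof -
    have "(\<Sum>j\<in>{j. j < r \<and> i \<in> e j}. (\<lambda>j\<in>{..<r}. card (\<Phi> \<omega> \<inter> A j)) j) = card (\<Phi> \<omega> \<inter> B i)"
      if "i < q" for i
      unfolding card_B[OF \<open>\<omega> \<in> space M\<close> that] by (intro sum.cong) auto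
    then show ?thesis using that by (simp add: f_def indicator_def)
  qed
  have Ar: "A r = B'" by (simp add: A_def)
  have "?E = (\<Inter>i\<in>{..<q}. {\<omega>\<in>space M. card (\<Phi> \<omega> \<inter> B i) = n i}) \<inter> space M" by auto
  also have "\<dots> \<in> events"
  proof (cases "q = 0")
    case False
    have "{\<omega>\<in>space M. card (\<Phi> \<omega> \<inter> B i) = n i} \<in> events" if "i < q" for i
    proof -
      have "(\<lambda>\<omega>. card (\<Phi> \<omega> \<inter> B i)) \<in> M \<rightarrow>\<^sub>M count_space UNIV"
        using B[OF that] by (intro card_measurable) auto
      then show ?thesis by measurable
    qed
    then show ?thesis using False by (intro sets.Int sets.finite_INT) auto
  qed simp
  finally have E: "?E \<in> events" .
  have "(\<integral>\<^sup>+\<omega>. indicator ?E \<omega> * of_nat (card (\<Phi> \<omega> \<inter> B')) \<partial>M) =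
      (\<integral>\<^sup>+\<omega>. f (\<lambda>j\<in>{..<r}. card (\<Phi> \<omega> \<inter> A j)) * of_nat (card (\<Phi> \<omega> \<inter> A r)) \<partial>M)"
    by (intro nn_integral_cong) (simp only: f Ar)
  also have "\<dots> = (\<integral>\<^sup>+\<omega>. f (\<lambda>j\<in>{..<r}. card (\<Phi> \<omega> \<inter> A j)) \<partial>M) *
      (\<integral>\<^sup>+\<omega>. of_nat (card (\<Phi> \<omega> \<inter> A r)) \<partial>M)"
    by (rule card_indep_disjoint[OF A disj])
  also have "(\<integral>\<^sup>+\<omega>. f (\<lambda>j\<in>{..<r}. card (\<Phi> \<omega> \<inter> A j)) \<partial>M) = (\<integral>\<^sup>+\<omega>. indicator ?E \<omega> \<partial>M)"
    by (intro nn_integral_cong) (simp only: f)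
  also have "(\<integral>\<^sup>+\<omega>. indicator ?E \<omega> \<partial>M) = emeasure M ?E" by (rule nn_integral_indicator[OF E])
  also have "(\<integral>\<^sup>+\<omega>. of_nat (card (\<Phi> \<omega> \<inter> A r)) \<partial>M) = emeasure (intensity UNIV) B'"
    unfolding Ar by (rule nn_integral_card(1)[OF B'(1,2)])
  finally show ?thesis .
qed

text \<open>Finite conjunctions of count conditions on bounded subsets of \<open>W\<close> form a
  pi-system generating \<open>window_algebra W\<close>. On these events \<open>card_indep\<close>
  applies, since all sets involved miss \<open>B\<close>.\<close>

lemma window_algebra_indep:
  assumes W: "W \<in> sets borel" and B: "B \<in> sets borel" "bounded B" "W \<inter> B = {}"
    and U: "U \<in> borel_measurable (window_algebra W)"
  shows "(\<integral>\<^sup>+\<omega>. U \<omega> * of_nat (card (\<Phi> \<omega> \<inter> B)) \<partial>M) =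
    (\<integral>\<^sup>+\<omega>. U \<omega> \<partial>M) * emeasure (intensity UNIV) B"
proof -
  define cy where "cy q A n = {\<omega>\<in>space M. \<forall>i<q. card (\<Phi> \<omega> \<inter> (W \<inter> A i)) = n i}"
    for q :: nat and A :: "nat \<Rightarrow> tpoint set" and n
  define ok where "ok q A \<longleftrightarrow> (\<forall>i<q. A i \<in> sets \<mu> \<and> bounded (A i))"
    for q :: nat and A :: "nat \<Rightarrow> tpoint set"
  define E where "E = {cy q A n |q A n. ok q A}"
  have E_events: "E \<subseteq> events"
  proof
    fix D assume "D \<in> E"
    then obtain q A n where D: "D = cy q A n" and A: "ok q A" unfolding E_def by blast
    have "{\<omega>\<in>space M. card (\<Phi> \<omega> \<inter> (W \<inter> A i)) = n i} \<in> events" if "i < q" for i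
    proof -
      have "W \<inter> A i \<in> sets borel" "bounded (W \<inter> A i)"
        using A that W borel_of_sets_\<mu>[of "A i"] by (simp_all add: ok_def bounded_Int)
      from card_measurable[OF this] show ?thesis by measurable
    qed
    moreover have "D = space M \<inter> (\<Inter>i\<in>{..<q}. if i < q then {\<omega>\<in>space M. card (\<Phi> \<omega> \<inter> (W \<inter> A i)) = n i} else space M)"
      by (auto simp: D cy_def)
    ultimately show "D \<in> events" by (cases "q = 0") (auto intro!: sets.Int sets.finite_INT)
  qed
  have "Int_stable E"
  proof (rule Int_stableI)
    fix D D' assume "D \<in> E" "D' \<in> E"
    then obtain q A n q' A' n' where
      D: "D = cy q A n" "ok q A" and D': "D' = cy q' A' n'" "ok q' A'" unfolding E_def by blast
    define A'' where "A'' i = (if i < q then A i else A' (i - q))" for i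
    define n'' where "n'' i = (if i < q then n i else n' (i - q))" for i
    have all: "(\<forall>i<q+q'. P i) \<longleftrightarrow> (\<forall>i<q. P i) \<and> (\<forall>i<q'. P (q + i))" for P
      by (metis add_less_cancel_left le_add_diff_inverse linorder_not_less trans_less_add1)
    have "D \<inter> D' = cy (q + q') A'' n''"
      unfolding all D D' cy_def by (auto simp: A''_def n''_def)
    moreover have "ok (q + q') A''"
      using D(2) D'(2) unfolding all ok_def by (auto simp: A''_def)
    ultimately show "D \<inter> D' \<in> E" unfolding E_def by blast
  qed
  moreover have "space M \<in> E"
  proof -
    have "space M = cy 0 A n" "ok 0 A" for A n by (auto simp: cy_def ok_def)
    then show ?thesis unfolding E_def by blast
  qed
  moreover have "U \<in> borel_measurable (sigma (space M) E)"
  proof (rule measurable_mono[THEN subsetD, OF order_refl refl _ _ U])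
    have E': "E \<subseteq> Pow (space M)" unfolding E_def cy_def by auto
    show "sets (window_algebra W) \<subseteq> sets (sigma (space M) E)"
      unfolding window_algebra_def
    proof (rule sets_process_algebra_least)
      show "space (sigma (space M) E) = space M" by (simp add: space_measure_of_conv)
      fix A assume A: "A \<in> sets \<mu>" "bounded A"
      have "(\<lambda>\<omega>. card (\<Phi> \<omega> \<inter> W \<inter> A)) -` {m} \<inter> space (sigma (space M) E) = cy 1 (\<lambda>_. A) (\<lambda>_. m)" for m
        by (auto simp: cy_def space_measure_of_conv Int_assoc)
      moreover have "cy 1 (\<lambda>_. A) (\<lambda>_. m) \<in> E" for m
        unfolding E_def using A by (auto simp: ok_def)
      moreover have "E \<subseteq> sets (sigma (space M) E)" using E' by (auto simp: sets_measure_of)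
      ultimately show "(\<lambda>\<omega>. card (\<Phi> \<omega> \<inter> W \<inter> A)) \<in> sigma (space M) E \<rightarrow>\<^sub>M count_space UNIV"
        by (subst measurable_count_space_eq2_countable) auto
    qed
    show "space (window_algebra W) = space (sigma (space M) E)"
      by (simp add: space_measure_of_conv)
  qed
  moreover have "(\<integral>\<^sup>+\<omega>. of_nat (card (\<Phi> \<omega> \<inter> B)) * indicator D \<omega> \<partial>M) =
      (\<integral>\<^sup>+\<omega>. emeasure (intensity UNIV) B * indicator D \<omega> \<partial>M)" if "D \<in> E" for D
  proof -
    from that obtain q A n where D: "D = cy q A n" and A: "ok q A" unfolding E_def by blast
    have "W \<inter> A i \<in> sets borel \<and> bounded (W \<inter> A i) \<and> W \<inter> A i \<inter> B = {}" if "i < q" for i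
      using A that W B(3) borel_of_sets_\<mu>[of "A i"] by (auto simp: ok_def bounded_Int)
    then have "(\<integral>\<^sup>+\<omega>. indicator D \<omega> * of_nat (card (\<Phi> \<omega> \<inter> B)) \<partial>M) =
        emeasure M D * emeasure (intensity UNIV) B"
      unfolding D cy_def using B by (intro card_indep) auto
    moreover have "(\<integral>\<^sup>+\<omega>. emeasure (intensity UNIV) B * indicator D \<omega> \<partial>M) =
        emeasure (intensity UNIV) B * emeasure M D"
      using E_events that by (intro nn_integral_cmult_indicator) auto
    ultimately show ?thesis by (simp only: mult.commute)
  qed
  ultimately have "(\<integral>\<^sup>+\<omega>. U \<omega> * of_nat (card (\<Phi> \<omega> \<inter> B)) \<partial>M) =
      (\<integral>\<^sup>+\<omega>. U \<omega> * emeasure (intensity UNIV) B \<partial>M)"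
    using E_events card_measurable[OF B(1,2)] nn_integral_card(1)[OF B(1,2)]
      emeasure_intensity_bounded[OF _ B(1,2), of UNIV]
    by (intro nn_integral_eq_generator[of E M]) (auto intro: measurable_compose)
  also have "\<dots> = (\<integral>\<^sup>+\<omega>. U \<omega> \<partial>M) * emeasure (intensity UNIV) B"
    using measurable_from_subalg[OF subalgebra_\<G> measurable_from_subalg[OF subalgebra_window[OF W] U]]
    by (rule nn_integral_multc)
  finally show ?thesis .
qed

end

section \<open>Moments and contention variables\<close>

text \<open>The common part of the Campbell formulas of first and second order. Summing over the
  labels \<open>i\<close> the law of the mark \<open>T i\<close> on the event \<open>V i\<close>
  gives a measure, and it equals the product measure as soon as small rectangles have the right
  mass.\<close>

lemma point_measure_eq:
  fixes T :: "'i::countable \<Rightarrow> 'a \<Rightarrow> 'b \<times> 'c" and f :: "'b \<times> 'c \<Rightarrow> ennreal"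
  assumes M: "sigma_finite_measure M"
    and T: "\<And>i. T i \<in> M \<rightarrow>\<^sub>M N1 \<Otimes>\<^sub>M N2" and V: "\<And>i. V i \<in> sets M"
    and N: "sigma_finite_measure N1" "sigma_finite_measure N2"
    and P: "range P \<subseteq> sets N1" "incseq P" "(\<Union>n::nat. P n) = space N1"
    and Q: "range Q \<subseteq> sets N2" "incseq Q" "(\<Union>n. Q n) = space N2"
    and rect: "\<And>n A B. A \<in> sets N1 \<Longrightarrow> A \<subseteq> P n \<Longrightarrow> B \<in> sets N2 \<Longrightarrow> B \<subseteq> Q n \<Longrightarrow>
      (\<integral>\<^sup>+i. (\<integral>\<^sup>+\<omega>. indicator (V i) \<omega> * indicator (A \<times> B) (T i \<omega>) \<partial>M) \<partial>count_space UNIV) =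
      emeasure N1 A * emeasure N2 B"
    and f: "f \<in> borel_measurable (N1 \<Otimes>\<^sub>M N2)"
  shows "(\<integral>\<^sup>+i. (\<integral>\<^sup>+\<omega>. indicator (V i) \<omega> * f (T i \<omega>) \<partial>M) \<partial>count_space UNIV) = (\<integral>\<^sup>+z. f z \<partial>(N1 \<Otimes>\<^sub>M N2))"
proof -
  interpret M: sigma_finite_measure M by fact
  let ?CM = "count_space (UNIV :: 'i set) \<Otimes>\<^sub>M M"
  let ?d = "\<lambda>x. indicator (V (fst x)) (snd x) :: ennreal"
  let ?T = "\<lambda>x. T (fst x) (snd x)"
  have d: "?d \<in> borel_measurable ?CM"
    by (rule measurable_pair_measure_countable1) (use V in auto)
  have T': "?T \<in> ?CM \<rightarrow>\<^sub>M N1 \<Otimes>\<^sub>M N2"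
    by (rule measurable_pair_measure_countable1) (use T in auto)
  define K where "K = distr (density ?CM ?d) (N1 \<Otimes>\<^sub>M N2) ?T"
  have int: "(\<integral>\<^sup>+z. g z \<partial>K) =
      (\<integral>\<^sup>+i. (\<integral>\<^sup>+\<omega>. indicator (V i) \<omega> * g (T i \<omega>) \<partial>M) \<partial>count_space UNIV)"
    if g: "g \<in> borel_measurable (N1 \<Otimes>\<^sub>M N2)" for g :: "'b \<times> 'c \<Rightarrow> ennreal"
  proof -
    have gT: "(\<lambda>x. g (?T x)) \<in> borel_measurable ?CM" by (rule measurable_compose[OF T' g])
    have dg: "(\<lambda>x. ?d x * g (?T x)) \<in> borel_measurable ?CM"
      using d gT by (rule borel_measurable_times_ennreal)
    have "(\<integral>\<^sup>+z. g z \<partial>K) = (\<integral>\<^sup>+x. g (?T x) \<partial>density ?CM ?d)"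
      unfolding K_def using T' g by (intro nn_integral_distr) auto
    also have "\<dots> = (\<integral>\<^sup>+x. ?d x * g (?T x) \<partial>?CM)"
      by (rule nn_integral_density[OF d gT])
    also have "\<dots> = (\<integral>\<^sup>+i. (\<integral>\<^sup>+\<omega>. ?d (i, \<omega>) * g (?T (i, \<omega>)) \<partial>M) \<partial>count_space UNIV)"
      by (rule M.nn_integral_fst[OF dg, symmetric])
    finally show ?thesis by simp
  qed
  have "N1 \<Otimes>\<^sub>M N2 = K"
  proof (rule pair_measure_eqI_exhaust[OF N _ P Q])
    show "sets (N1 \<Otimes>\<^sub>M N2) = sets K" by (simp add: K_def)
    fix n A B assume AB: "A \<in> sets N1" "A \<subseteq> P n" "B \<in> sets N2" "B \<subseteq> Q n"
    then have R: "A \<times> B \<in> sets (N1 \<Otimes>\<^sub>M N2)" by auto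
    then have "emeasure K (A \<times> B) = (\<integral>\<^sup>+z. indicator (A \<times> B) z \<partial>K)"
      by (simp add: K_def)
    also have "\<dots> = emeasure N1 A * emeasure N2 B"
      by (subst int) (use R rect[OF AB] in auto)
    finally show "emeasure N1 A * emeasure N2 B = emeasure K (A \<times> B)" ..
  qed
  then show ?thesis using int[OF f] by simp
qed

lemma nn_integral_count_space_swap:
  fixes g :: "'i::countable \<Rightarrow> 'a \<Rightarrow> ennreal"
  assumes "sigma_finite_measure M" "\<And>i. g i \<in> borel_measurable M"
  shows "(\<integral>\<^sup>+i. (\<integral>\<^sup>+\<omega>. g i \<omega> \<partial>M) \<partial>count_space UNIV) = (\<integral>\<^sup>+\<omega>. (\<integral>\<^sup>+i. g i \<omega> \<partial>count_space UNIV) \<partial>M)"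
proof -
  interpret M: sigma_finite_measure M by fact
  interpret I: sigma_finite_measure "count_space (UNIV :: 'i set)"
    by (rule sigma_finite_measure_count_space_countable) auto
  interpret pair_sigma_finite "count_space (UNIV :: 'i set)" M ..
  have "(\<lambda>x. g (fst x) (snd x)) \<in> borel_measurable (count_space UNIV \<Otimes>\<^sub>M M)"
    by (rule measurable_pair_measure_countable1) (use assms(2) in auto)
  then have "case_prod g \<in> borel_measurable (count_space UNIV \<Otimes>\<^sub>M M)" by (simp add: split_beta')
  from Fubini'[OF this] show ?thesis by simp
qed

lemma enumerates_bij_betw:
  assumes "enumerates F \<Psi> Y V" "\<omega> \<in> space F"
  shows "bij_betw (\<lambda>n. Y n \<omega>) {n. \<omega> \<in> V n \<and> Y n \<omega> \<in> B} (\<Psi> \<omega> \<inter> B)"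
proof -
  have "\<Psi> \<omega> = (\<lambda>n. Y n \<omega>) ` {n. \<omega> \<in> V n}" "inj_on (\<lambda>n. Y n \<omega>) {n. \<omega> \<in> V n}"
    using assms unfolding enumerates_def by blast+
  then show ?thesis by (auto simp: bij_betw_def inj_on_def)
qed

context contention_process
begin

section \<open>Conditional independence of the links and the second-order Campbell formula\<close>

definition link_prob :: "bool \<Rightarrow> tpoint \<Rightarrow> tpoint \<Rightarrow> real" where
  "link_prob b z w = (if b then h (fst z) (fst w) else 1 - h (fst z) (fst w))"

lemma link_prob_range: "0 \<le> link_prob b z w" "link_prob b z w \<le> 1"
  using h_range by (auto simp: link_prob_def)

lemma h_compose_measurable:
  assumes "X \<in> borel_measurable N" "Y \<in> borel_measurable N"
  shows "(\<lambda>\<omega>. h (X \<omega>) (Y \<omega>)) \<in> borel_measurable N"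
  using measurable_compose[OF measurable_Pair[OF assms] h_measurable] by simp

lemma measurable_fst_tpoint: "X \<in> borel_measurable N \<Longrightarrow> (\<lambda>\<omega>. fst (X \<omega> :: tpoint)) \<in> borel_measurable N"
  and measurable_snd_tpoint: "X \<in> borel_measurable N \<Longrightarrow> (\<lambda>\<omega>. snd (X \<omega> :: tpoint)) \<in> borel_measurable N"
  by (auto simp: borel_prod[symmetric] intro: measurable_compose)

lemma link_prob_measurable:
  assumes "X \<in> borel_measurable N" "Y \<in> borel_measurable N"
  shows "(\<lambda>\<omega>. link_prob b (X \<omega>) (Y \<omega>)) \<in> borel_measurable N"
  unfolding link_prob_def
  using h_compose_measurable[OF measurable_fst_tpoint[OF assms(1)] measurable_fst_tpoint[OF assms(2)]]
  by (cases b) auto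

text \<open>The defining property of the links holds on every event of \<open>\<G>\<close> inside
  \<open>A\<close>, so it determines the conditional expectation given \<open>\<G>\<close>, and any
  \<open>\<G>\<close>-measurable weight may be inserted. The bijection \<open>e\<close> passes from
  initial segments of the naturals to arbitrary finite index sets, such as the disjoint sums used
  below.\<close>

lemma contention_nn_integral:
  fixes J :: "'i set"
  assumes J: "finite J" and A: "A \<in> sets \<G>"
    and X: "\<And>i. i \<in> J \<Longrightarrow> X i \<in> \<G> \<rightarrow>\<^sub>M borel" and Y: "\<And>i. i \<in> J \<Longrightarrow> Y i \<in> \<G> \<rightarrow>\<^sub>M borel"
    and pts: "\<And>\<omega> i. \<omega> \<in> A \<Longrightarrow> i \<in> J \<Longrightarrow> X i \<omega> \<in> \<Phi> \<omega> \<and> Y i \<omega> \<in> \<Phi> \<omega> \<and> X i \<omega> \<noteq> Y i \<omega>"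
    and inj: "\<And>\<omega>. \<omega> \<in> A \<Longrightarrow> inj_on (\<lambda>i. {X i \<omega>, Y i \<omega>}) J"
    and U: "U \<in> borel_measurable \<G>"
  shows "{\<omega>\<in>A. \<forall>i\<in>J. C \<omega> (X i \<omega>) (Y i \<omega>) = b i} \<in> events" (is "?E A \<in> _")
    and "(\<integral>\<^sup>+\<omega>. U \<omega> * indicator {\<omega>\<in>A. \<forall>i\<in>J. C \<omega> (X i \<omega>) (Y i \<omega>) = b i} \<omega> \<partial>M) =
      (\<integral>\<^sup>+\<omega>. U \<omega> * (indicator A \<omega> * ennreal (\<Prod>i\<in>J. link_prob (b i) (X i \<omega>) (Y i \<omega>))) \<partial>M)"
proof -
  let ?p = "\<lambda>\<omega>. \<Prod>i\<in>J. link_prob (b i) (X i \<omega>) (Y i \<omega>)"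
  obtain e where e: "bij_betw e {..<card J} J"
    using ex_bij_betw_nat_finite[OF J] by (auto simp: atLeast0LessThan)
  have eJ: "e i \<in> J" if "i < card J" for i using e that by (auto simp: bij_betw_def)
  have all: "(\<forall>i<card J. Q (e i)) \<longleftrightarrow> (\<forall>j\<in>J. Q j)" for Q
    using bij_betw_imp_surj_on[OF e] by (metis imageE image_eqI lessThan_iff)
  have contention: "{\<omega>\<in>A. \<forall>i<n. C \<omega> (X i \<omega>) (Y i \<omega>) = b i} \<in> sets M \<and>
        measure M {\<omega>\<in>A. \<forall>i<n. C \<omega> (X i \<omega>) (Y i \<omega>) = b i} =
          (LINT \<omega>:A|M. (\<Prod>i<n. link_prob (b i) (X i \<omega>) (Y i \<omega>)))"
    if "A \<in> sets \<G>" "\<forall>i<n. X i \<in> \<G> \<rightarrow>\<^sub>M borel \<and> Y i \<in> \<G> \<rightarrow>\<^sub>M borel"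
      "\<forall>\<omega>\<in>A. (\<forall>i<n. X i \<omega> \<in> \<Phi> \<omega> \<and> Y i \<omega> \<in> \<Phi> \<omega> \<and> X i \<omega> \<noteq> Y i \<omega>) \<and>
               inj_on (\<lambda>i. {X i \<omega>, Y i \<omega>}) {..<n}"
    for n :: nat and X Y and b :: "nat \<Rightarrow> bool" and A
    using C_contention[unfolded contention_variables_def, THEN conjunct2, THEN spec[of _ n], THEN spec[of _ X],
        THEN spec[of _ Y], THEN spec[of _ b], THEN bspec[OF _ that(1)], THEN mp[OF _ conjI[OF that(2,3)]]]
    unfolding link_prob_def .
  have key: "?E D \<in> events \<and> prob (?E D) = (LINT \<omega>:D|M. ?p \<omega>)" if D: "D \<in> sets \<G>" "D \<subseteq> A" for D
  proof -
    have "inj_on (\<lambda>i. {X (e i) \<omega>, Y (e i) \<omega>}) {..<card J}" if "\<omega> \<in> D" for \<omega>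
    proof -
      have "inj_on ((\<lambda>i. {X i \<omega>, Y i \<omega>}) \<circ> e) {..<card J}"
        using e inj[of \<omega>] that D(2) by (intro comp_inj_on) (auto simp: bij_betw_def)
      then show ?thesis by (simp add: o_def)
    qed
    then have "{\<omega>\<in>D. \<forall>i<card J. C \<omega> (X (e i) \<omega>) (Y (e i) \<omega>) = b (e i)} \<in> events \<and>
        prob {\<omega>\<in>D. \<forall>i<card J. C \<omega> (X (e i) \<omega>) (Y (e i) \<omega>) = b (e i)} =
        (LINT \<omega>:D|M. (\<Prod>i<card J. link_prob (b (e i)) (X (e i) \<omega>) (Y (e i) \<omega>)))"
      using X Y eJ pts D by (intro contention) (simp_all add: subset_iff)
    moreover have "(\<Prod>i<card J. link_prob (b (e i)) (X (e i) \<omega>) (Y (e i) \<omega>)) = ?p \<omega>" for \<omega>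
      by (rule prod.reindex_bij_betw[OF e])
    ultimately show ?thesis
      unfolding all[of "\<lambda>i. C _ (X i _) (Y i _) = b i"] by simp
  qed
  show E: "?E A \<in> events" using key[OF A] by simp
  have p: "?p \<in> borel_measurable \<G>" using X Y by (intro borel_measurable_prod link_prob_measurable)
  have pM: "?p \<in> borel_measurable M" by (rule measurable_from_subalg[OF subalgebra_\<G> p])
  have sub: "D \<in> events" if "D \<in> sets \<G>" for D using that subalgebra_\<G> by (auto simp: subalgebra_def)
  have p01: "0 \<le> ?p \<omega>" "?p \<omega> \<le> 1" for \<omega>
    by (auto intro!: prod_nonneg prod_le_1 link_prob_range)
  have eq: "(\<integral>\<^sup>+\<omega>. indicator (?E A) \<omega> * indicator D \<omega> \<partial>M) =
      (\<integral>\<^sup>+\<omega>. (indicator A \<omega> * ennreal (?p \<omega>)) * indicator D \<omega> \<partial>M)" if D: "D \<in> sets \<G>" for D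
  proof -
    have AD: "A \<inter> D \<in> sets \<G>" using A D by auto
    have int: "integrable M (\<lambda>\<omega>. indicator (A \<inter> D) \<omega> * ?p \<omega>)"
    proof (rule integrable_const_bound[of _ 1])
      show "(\<lambda>\<omega>. indicator (A \<inter> D) \<omega> * ?p \<omega>) \<in> borel_measurable M"
        using pM sub[OF AD] by (intro borel_measurable_times borel_measurable_indicator)
    qed (use p01 in \<open>auto simp: indicator_def intro!: AE_I2\<close>)
    have "(\<integral>\<^sup>+\<omega>. indicator (?E A) \<omega> * indicator D \<omega> \<partial>M) = (\<integral>\<^sup>+\<omega>. indicator (?E (A \<inter> D)) \<omega> \<partial>M)"
      by (intro nn_integral_cong) (auto simp: indicator_def)
    also have "\<dots> = ennreal (prob (?E (A \<inter> D)))"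
      using key[OF AD] by (simp add: emeasure_eq_measure)
    also have "prob (?E (A \<inter> D)) = (\<integral>\<omega>. indicator (A \<inter> D) \<omega> * ?p \<omega> \<partial>M)"
      using key[OF AD] by (simp add: set_lebesgue_integral_def)
    also have "ennreal \<dots> = (\<integral>\<^sup>+\<omega>. ennreal (indicator (A \<inter> D) \<omega> * ?p \<omega>) \<partial>M)"
      using p01 by (intro nn_integral_eq_integral[symmetric] int) (auto intro!: AE_I2)
    also have "\<dots> = (\<integral>\<^sup>+\<omega>. (indicator A \<omega> * ennreal (?p \<omega>)) * indicator D \<omega> \<partial>M)"
      by (intro nn_integral_cong) (auto simp: indicator_def)
    finally show ?thesis .
  qed
  have "(\<integral>\<^sup>+\<omega>. indicator (?E A) \<omega> \<partial>M) = emeasure M (?E A)" by (rule nn_integral_indicator[OF E])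
  then have fin: "(\<integral>\<^sup>+\<omega>. indicator (?E A) \<omega> \<partial>M) \<noteq> \<infinity>" by simp
  show "(\<integral>\<^sup>+\<omega>. U \<omega> * indicator (?E A) \<omega> \<partial>M) = (\<integral>\<^sup>+\<omega>. U \<omega> * (indicator A \<omega> * ennreal (?p \<omega>)) \<partial>M)"
  proof (rule nn_integral_eq_generator[where E = "sets \<G>"])
    show "sets \<G> \<subseteq> events" using sub by blast
    show "space M \<in> sets \<G>" using sets.top[of \<G>] by simp
    have "sets (sigma (space M) (sets \<G>)) = sets \<G>"
      using sets.sigma_sets_eq[of \<G>] sets.space_closed[of \<G>] by (simp add: sets_measure_of)
    then show "U \<in> borel_measurable (sigma (space M) (sets \<G>))"
      using U measurable_cong_sets by blast
    show "(\<lambda>\<omega>. indicator A \<omega> * ennreal (?p \<omega>)) \<in> borel_measurable M"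
      using pM sub[OF A] by (intro borel_measurable_times_ennreal) auto
  qed (use E fin eq in \<open>auto intro: sets.Int_stable\<close>)
qed

text \<open>The integrand counts ordered pairs of distinct points, the first in \<open>A\<close> and
  the second in \<open>B\<close>. Splitting into the common part and the two differences leaves
  products of independent counts and one second factorial moment, which for a Poisson count is the
  square of the mean; hence no diagonal term survives.\<close>

lemma card_product_moment:
  assumes W: "W \<in> sets borel" and A: "A \<in> sets borel" "bounded A" and B: "B \<in> sets borel" "bounded B"
  shows "(\<integral>\<^sup>+\<omega>. of_nat (card (\<Phi> \<omega> \<inter> W \<inter> A) * card (\<Phi> \<omega> \<inter> W \<inter> B) - card (\<Phi> \<omega> \<inter> W \<inter> (A \<inter> B))) \<partial>M) =
    emeasure (intensity W) A * emeasure (intensity W) B"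
proof -
  define I A' B' where "I = W \<inter> (A \<inter> B)" and "A' = W \<inter> A - B" and "B' = W \<inter> B - A"
  let ?n = "\<lambda>S \<omega>. of_nat (card (\<Phi> \<omega> \<inter> S)) :: ennreal"
  let ?\<nu> = "emeasure (intensity UNIV)"
  have S: "I \<in> sets borel" "A' \<in> sets borel" "B' \<in> sets borel"
    using W A B by (auto simp: I_def A'_def B'_def)
  have bd: "bounded I" "bounded A'" "bounded B'"
    using A B by (auto simp: I_def A'_def B'_def Diff_eq bounded_Int)
  have meas: "?n S \<in> borel_measurable M" if "S \<in> sets borel" "bounded S" for S
    using card_measurable[OF that] by (rule measurable_compose) simp
  have indep: "(\<integral>\<^sup>+\<omega>. ?n S \<omega> * ?n S' \<omega> \<partial>M) = ?\<nu> S * ?\<nu> S'"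
    if "S \<in> sets borel" "bounded S" "S' \<in> sets borel" "bounded S'" "S \<inter> S' = {}" for S S'
  proof -
    have "disjoint_family_on (\<lambda>i. if i = 0 then S else S') {..<Suc 1}"
      using that(5) by (auto simp: disjoint_family_on_def)
    from card_indep_disjoint[of 1 "\<lambda>i. if i = 0 then S else S'" "\<lambda>x. of_nat (x 0)" of_nat, OF _ this]
    show ?thesis using that nn_integral_card(1) by simp
  qed
  have card_split: "card (\<Phi> \<omega> \<inter> W \<inter> A) * card (\<Phi> \<omega> \<inter> W \<inter> B) - card (\<Phi> \<omega> \<inter> W \<inter> (A \<inter> B)) =
      card (\<Phi> \<omega> \<inter> I) * (card (\<Phi> \<omega> \<inter> I) - 1) + card (\<Phi> \<omega> \<inter> I) * card (\<Phi> \<omega> \<inter> B') +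
      (card (\<Phi> \<omega> \<inter> A') * card (\<Phi> \<omega> \<inter> I) + card (\<Phi> \<omega> \<inter> A') * card (\<Phi> \<omega> \<inter> B'))"
    if \<omega>: "\<omega> \<in> space M" for \<omega>
  proof -
    have fin: "finite (\<Phi> \<omega> \<inter> I)" "finite (\<Phi> \<omega> \<inter> A')" "finite (\<Phi> \<omega> \<inter> B')" using \<Phi>_finite[OF \<omega>] bd by auto
    have "\<Phi> \<omega> \<inter> W \<inter> A = (\<Phi> \<omega> \<inter> I) \<union> (\<Phi> \<omega> \<inter> A')" "\<Phi> \<omega> \<inter> W \<inter> B = (\<Phi> \<omega> \<inter> I) \<union> (\<Phi> \<omega> \<inter> B')"
      "\<Phi> \<omega> \<inter> W \<inter> (A \<inter> B) = \<Phi> \<omega> \<inter> I" by (auto simp: I_def A'_def B'_def)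
    moreover have "(\<Phi> \<omega> \<inter> I) \<inter> (\<Phi> \<omega> \<inter> A') = {}" "(\<Phi> \<omega> \<inter> I) \<inter> (\<Phi> \<omega> \<inter> B') = {}"
      by (auto simp: I_def A'_def B'_def)
    ultimately have "card (\<Phi> \<omega> \<inter> W \<inter> A) = card (\<Phi> \<omega> \<inter> I) + card (\<Phi> \<omega> \<inter> A')"
      "card (\<Phi> \<omega> \<inter> W \<inter> B) = card (\<Phi> \<omega> \<inter> I) + card (\<Phi> \<omega> \<inter> B')"
      "card (\<Phi> \<omega> \<inter> W \<inter> (A \<inter> B)) = card (\<Phi> \<omega> \<inter> I)"
      using fin by (simp_all add: card_Un_disjoint)
    then show ?thesis by (cases "card (\<Phi> \<omega> \<inter> I)") (simp_all add: algebra_simps)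
  qed
  have "(\<integral>\<^sup>+\<omega>. of_nat (card (\<Phi> \<omega> \<inter> W \<inter> A) * card (\<Phi> \<omega> \<inter> W \<inter> B) - card (\<Phi> \<omega> \<inter> W \<inter> (A \<inter> B))) \<partial>M) =
      (\<integral>\<^sup>+\<omega>. (of_nat (card (\<Phi> \<omega> \<inter> I) * (card (\<Phi> \<omega> \<inter> I) - 1)) + ?n I \<omega> * ?n B' \<omega>) +
        (?n A' \<omega> * ?n I \<omega> + ?n A' \<omega> * ?n B' \<omega>) \<partial>M)"
    by (intro nn_integral_cong) (simp only: card_split of_nat_add of_nat_mult)
  also have "\<dots> = (\<integral>\<^sup>+\<omega>. of_nat (card (\<Phi> \<omega> \<inter> I) * (card (\<Phi> \<omega> \<inter> I) - 1)) \<partial>M) + (\<integral>\<^sup>+\<omega>. ?n I \<omega> * ?n B' \<omega> \<partial>M) +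
        ((\<integral>\<^sup>+\<omega>. ?n A' \<omega> * ?n I \<omega> \<partial>M) + (\<integral>\<^sup>+\<omega>. ?n A' \<omega> * ?n B' \<omega> \<partial>M))"
  proof -
    have q: "(\<lambda>\<omega>. of_nat (card (\<Phi> \<omega> \<inter> I) * (card (\<Phi> \<omega> \<inter> I) - 1)) :: ennreal) \<in> borel_measurable M"
      by (rule measurable_compose[OF card_measurable[OF S(1) bd(1)]]) simp
    have m: "(\<lambda>\<omega>. ?n S1 \<omega> * ?n S2 \<omega>) \<in> borel_measurable M"
      if "S1 \<in> sets borel" "bounded S1" "S2 \<in> sets borel" "bounded S2" for S1 S2
      using meas[OF that(1,2)] meas[OF that(3,4)] by (rule borel_measurable_times_ennreal)
    note m1 = m[OF S(1) bd(1) S(3) bd(3)] and m2 = m[OF S(2) bd(2) S(1) bd(1)]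
      and m3 = m[OF S(2) bd(2) S(3) bd(3)]
    show ?thesis
      unfolding nn_integral_add[OF borel_measurable_add[OF q m1] borel_measurable_add[OF m2 m3]]
        nn_integral_add[OF q m1] nn_integral_add[OF m2 m3] ..
  qed
  also have "\<dots> = ?\<nu> I * ?\<nu> I + ?\<nu> I * ?\<nu> B' + (?\<nu> A' * ?\<nu> I + ?\<nu> A' * ?\<nu> B')"
    unfolding nn_integral_card(2)[OF S(1) bd(1)]
    by (subst (1 2 3) indep) (use S bd in \<open>auto simp: I_def A'_def B'_def\<close>)
  also have "\<dots> = (?\<nu> I + ?\<nu> A') * (?\<nu> I + ?\<nu> B')"
    by (simp add: algebra_simps)
  also have "?\<nu> I + ?\<nu> A' = ?\<nu> (W \<inter> A)"
    by (subst plus_emeasure) (use S in \<open>auto simp: I_def A'_def intro!: arg_cong[where f = ?\<nu>]\<close>)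
  also have "?\<nu> I + ?\<nu> B' = ?\<nu> (W \<inter> B)"
    by (subst plus_emeasure) (use S in \<open>auto simp: I_def B'_def intro!: arg_cong[where f = ?\<nu>]\<close>)
  also have "?\<nu> (W \<inter> A) = emeasure (intensity W) A"
    using W A by (simp add: emeasure_intensity)
  also have "?\<nu> (W \<inter> B) = emeasure (intensity W) B"
    using W B by (simp add: emeasure_intensity)
  finally show ?thesis .
qed

lemma window_enumerates:
  assumes W: "W \<in> sets borel" and en: "enumerates (window_algebra W) \<Psi> Y V"
  shows "Y n \<in> window_algebra W \<rightarrow>\<^sub>M borel" "V n \<in> sets (window_algebra W)"
    "Y n \<in> \<G> \<rightarrow>\<^sub>M borel" "V n \<in> sets \<G>" "Y n \<in> M \<rightarrow>\<^sub>M borel" "V n \<in> events"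
proof -
  show 1: "Y n \<in> window_algebra W \<rightarrow>\<^sub>M borel" and 2: "V n \<in> sets (window_algebra W)"
    using en by (simp_all add: enumerates_def)
  show 3: "Y n \<in> \<G> \<rightarrow>\<^sub>M borel" by (rule measurable_from_subalg[OF subalgebra_window[OF W] 1])
  show "Y n \<in> M \<rightarrow>\<^sub>M borel" by (rule measurable_from_subalg[OF subalgebra_\<G> 3])
  show 4: "V n \<in> sets \<G>"
    using subalgebra_window[OF W] 2 unfolding subalgebra_def by (elim conjE) (erule subsetD)
  then show "V n \<in> events"
    using subalgebra_\<G> unfolding subalgebra_def by (elim conjE) (erule subsetD)
qed

text \<open>The second factorial moment measure of a Poisson process is the square of its intensity.
  Distinct points appear as distinct labels, and rectangles are handled by
  \<open>card_product_moment\<close>.\<close>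

lemma pair_campbell:
  fixes f :: "tpoint \<times> tpoint \<Rightarrow> ennreal"
  assumes W: "W \<in> sets borel" and en: "enumerates (window_algebra W) (\<lambda>\<omega>. \<Phi> \<omega> \<inter> W) Y V"
    and f: "f \<in> borel_measurable (borel \<Otimes>\<^sub>M borel)"
  shows "(\<integral>\<^sup>+pq. (\<integral>\<^sup>+\<omega>. indicator (if fst pq = snd pq then {} else V (fst pq) \<inter> V (snd pq)) \<omega> *
        f (Y (fst pq) \<omega>, Y (snd pq) \<omega>) \<partial>M) \<partial>count_space UNIV) =
    (\<integral>\<^sup>+z. (\<integral>\<^sup>+w. f (z, w) \<partial>intensity W) \<partial>intensity W)"
proof -
  interpret I: sigma_finite_measure "intensity W" by (rule sigma_finite_intensity[OF W])
  let ?V = "\<lambda>pq. if fst pq = snd pq then {} else V (fst pq) \<inter> V (snd pq)"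
  let ?T = "\<lambda>pq \<omega>. (Y (fst pq) \<omega>, Y (snd pq) \<omega>)"
  have YM: "Y n \<in> M \<rightarrow>\<^sub>M borel" and VM: "V n \<in> events" for n
    using window_enumerates(5,6)[OF W en] by blast+
  have sets_eq: "sets (intensity W \<Otimes>\<^sub>M intensity W) = sets (borel \<Otimes>\<^sub>M borel)"
    by (intro sets_pair_measure_cong) simp_all
  have "(\<integral>\<^sup>+pq. (\<integral>\<^sup>+\<omega>. indicator (?V pq) \<omega> * f (?T pq \<omega>) \<partial>M) \<partial>count_space UNIV) =
      (\<integral>\<^sup>+z. f z \<partial>(intensity W \<Otimes>\<^sub>M intensity W))"
  proof (rule point_measure_eq[where P = "\<lambda>n. cball 0 (real n)" and Q = "\<lambda>n. cball 0 (real n)"])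
    show "f \<in> borel_measurable (intensity W \<Otimes>\<^sub>M intensity W)"
      using f measurable_cong_sets[OF sets_eq refl] by blast
    have Y': "Y n \<in> M \<rightarrow>\<^sub>M intensity W" for n
      using YM measurable_cong_sets[OF refl sets_intensity] by blast
    show "?T pq \<in> M \<rightarrow>\<^sub>M intensity W \<Otimes>\<^sub>M intensity W" for pq
      by (intro measurable_Pair Y')
    show "?V pq \<in> events" for pq using VM by auto
    show "incseq (\<lambda>n. cball (0 :: tpoint) (real n))" by (auto simp: incseq_def)
    show "incseq (\<lambda>n. cball (0 :: tpoint) (real n))" by fact
    have "(\<Union>n. cball (0 :: tpoint) (real n)) = UNIV"
      by (auto simp: mem_cball dist_norm intro: real_arch_simple)
    then show "(\<Union>n. cball 0 (real n)) = space (intensity W)" "(\<Union>n. cball 0 (real n)) = space (intensity W)"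
      by simp_all
    fix n A B
    assume "A \<in> sets (intensity W)" "A \<subseteq> cball 0 (real n)" "B \<in> sets (intensity W)" "B \<subseteq> cball 0 (real n)"
    then have A: "A \<in> sets borel" "bounded A" and B: "B \<in> sets borel" "bounded B"
      by (auto intro: bounded_subset[OF bounded_cball])
    have R: "A \<times> B \<in> sets (borel \<Otimes>\<^sub>M borel)" using A B by auto
    have meas: "(\<lambda>\<omega>. indicator (?V pq) \<omega> * indicator (A \<times> B) (?T pq \<omega>) :: ennreal) \<in> borel_measurable M" for pq
    proof (rule borel_measurable_times_ennreal)
      show "indicator (?V pq) \<in> borel_measurable M" using VM by (intro borel_measurable_indicator) auto
      have "?T pq \<in> M \<rightarrow>\<^sub>M borel \<Otimes>\<^sub>M borel" by (intro measurable_Pair YM)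
      then show "(\<lambda>\<omega>. indicator (A \<times> B) (?T pq \<omega>) :: ennreal) \<in> borel_measurable M"
        by (rule measurable_compose) (use R in auto)
    qed
    have "(\<integral>\<^sup>+pq. (\<integral>\<^sup>+\<omega>. indicator (?V pq) \<omega> * indicator (A \<times> B) (?T pq \<omega>) \<partial>M) \<partial>count_space UNIV) =
        (\<integral>\<^sup>+\<omega>. (\<integral>\<^sup>+pq. indicator (?V pq) \<omega> * indicator (A \<times> B) (?T pq \<omega>) \<partial>count_space UNIV) \<partial>M)"
      by (rule nn_integral_count_space_swap[OF sigma_finite_measure_axioms meas])
    also have "\<dots> = (\<integral>\<^sup>+\<omega>. of_nat (card (\<Phi> \<omega> \<inter> W \<inter> A) * card (\<Phi> \<omega> \<inter> W \<inter> B) - card (\<Phi> \<omega> \<inter> W \<inter> (A \<inter> B))) \<partial>M)"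
    proof (rule nn_integral_cong)
      fix \<omega> assume \<omega>: "\<omega> \<in> space M"
      define I where "I S = {n. \<omega> \<in> V n \<and> Y n \<omega> \<in> S}" for S
      have bij: "bij_betw (\<lambda>n. Y n \<omega>) (I S) (\<Phi> \<omega> \<inter> W \<inter> S)" for S
        unfolding I_def by (rule enumerates_bij_betw[OF en]) (simp add: \<omega>)
      have fin: "finite (I S)" if "bounded S" for S
        unfolding bij_betw_finite[OF bij] using \<Phi>_finite[OF \<omega> that] by (rule finite_subset[rotated]) auto
      let ?D = "(\<lambda>n. (n, n)) ` I (A \<inter> B)"
      have "(\<integral>\<^sup>+pq. indicator (?V pq) \<omega> * indicator (A \<times> B) (?T pq \<omega>) \<partial>count_space UNIV) =
          (\<integral>\<^sup>+pq. indicator (I A \<times> I B - ?D) pq \<partial>count_space UNIV)"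
        by (intro nn_integral_cong) (auto simp: indicator_def I_def)
      also have "\<dots> = of_nat (card (I A \<times> I B - ?D))"
        using fin[OF A(2)] fin[OF B(2)] by simp
      also have "card (I A \<times> I B - ?D) = card (I A) * card (I B) - card (I (A \<inter> B))"
      proof -
        have "?D \<subseteq> I A \<times> I B" by (auto simp: I_def)
        moreover have "finite ?D" using fin[of "A \<inter> B"] A(2) by (simp add: bounded_Int)
        moreover have "card ?D = card (I (A \<inter> B))" by (rule card_image) (auto simp: inj_on_def)
        ultimately show ?thesis by (simp add: card_Diff_subset card_cartesian_product)
      qed
      finally show "(\<integral>\<^sup>+pq. indicator (?V pq) \<omega> * indicator (A \<times> B) (?T pq \<omega>) \<partial>count_space UNIV) =
          of_nat (card (\<Phi> \<omega> \<inter> W \<inter> A) * card (\<Phi> \<omega> \<inter> W \<inter> B) - card (\<Phi> \<omega> \<inter> W \<inter> (A \<inter> B)))"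
        unfolding bij_betw_same_card[OF bij] .
    qed
    also have "\<dots> = emeasure (intensity W) A * emeasure (intensity W) B"
      by (rule card_product_moment[OF W A B])
    finally show "(\<integral>\<^sup>+pq. (\<integral>\<^sup>+\<omega>. indicator (?V pq) \<omega> * indicator (A \<times> B) (?T pq \<omega>) \<partial>M) \<partial>count_space UNIV) =
        emeasure (intensity W) A * emeasure (intensity W) B" .
  qed (auto intro: sigma_finite_measure_axioms I.sigma_finite_measure_axioms)
  also have "\<dots> = (\<integral>\<^sup>+z. (\<integral>\<^sup>+w. f (z, w) \<partial>intensity W) \<partial>intensity W)"
    using f measurable_cong_sets[OF sets_eq refl] by (intro I.nn_integral_fst[symmetric]) blast
  finally show ?thesis .
qed


end

section \<open>Past and new points\<close>

text \<open>\<open>W\<close> will hold the past points and \<open>W'\<close> the new ones. The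
  labellings are fixed together with the windows because the algebras that record links are defined
  through labels.\<close>

locale two_windows = contention_process M h \<Lambda> \<Phi> C
  for M :: "'w measure" and h \<Lambda> \<Phi> C +
  fixes W W' :: "tpoint set" and Y Y' :: "nat \<Rightarrow> 'w \<Rightarrow> tpoint" and V V' :: "nat \<Rightarrow> 'w set"
  assumes W: "W \<in> sets borel" and W': "W' \<in> sets borel" and disjoint: "W \<inter> W' = {}"
    and enum: "enumerates (window_algebra W) (\<lambda>\<omega>. \<Phi> \<omega> \<inter> W) Y V"
    and enum': "enumerates (window_algebra W') (\<lambda>\<omega>. \<Phi> \<omega> \<inter> W') Y' V'"
begin

lemmas YV = window_enumerates[OF W enum] and YV' = window_enumerates[OF W' enum']

lemma points:
  assumes "\<omega> \<in> space M"
  shows "\<Phi> \<omega> \<inter> W = (\<lambda>n. Y n \<omega>) ` {n. \<omega> \<in> V n}" "inj_on (\<lambda>n. Y n \<omega>) {n. \<omega> \<in> V n}"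
    "\<Phi> \<omega> \<inter> W' = (\<lambda>n. Y' n \<omega>) ` {n. \<omega> \<in> V' n}" "inj_on (\<lambda>n. Y' n \<omega>) {n. \<omega> \<in> V' n}"
  using enum enum' assms unfolding enumerates_def by simp_all

lemma V_space: "\<omega> \<in> V n \<Longrightarrow> \<omega> \<in> space M" and V'_space: "\<omega> \<in> V' n \<Longrightarrow> \<omega> \<in> space M"
  using sets.sets_into_space[OF YV(6)[of n]] sets.sets_into_space[OF YV'(6)[of n]] by auto

lemma Y_mem: assumes "\<omega> \<in> V n" shows "Y n \<omega> \<in> \<Phi> \<omega>" "Y n \<omega> \<in> W"
  using points(1)[OF V_space[OF assms]] assms by auto

lemma Y'_mem: assumes "\<omega> \<in> V' n" shows "Y' n \<omega> \<in> \<Phi> \<omega>" "Y' n \<omega> \<in> W'"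
  using points(3)[OF V'_space[OF assms]] assms by auto

lemma Y_eq_iff: "\<omega> \<in> V m \<Longrightarrow> \<omega> \<in> V n \<Longrightarrow> Y m \<omega> = Y n \<omega> \<longleftrightarrow> m = n"
  using inj_onD[OF points(2)[OF V_space]] by auto

lemma Y'_eq_iff: "\<omega> \<in> V' m \<Longrightarrow> \<omega> \<in> V' n \<Longrightarrow> Y' m \<omega> = Y' n \<omega> \<longleftrightarrow> m = n"
  using inj_onD[OF points(4)[OF V'_space]] by auto

lemma Y'_neq_Y: "\<omega> \<in> V' m \<Longrightarrow> \<omega> \<in> V n \<Longrightarrow> Y' m \<omega> \<noteq> Y n \<omega>"
  using Y_mem(2)[of \<omega> n] Y'_mem(2)[of \<omega> m] disjoint by auto

section \<open>Algebras recording the links between past points\<close>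

definition links :: "(nat \<times> nat) set \<Rightarrow> 'w \<Rightarrow> bool" where
  "links J \<omega> \<longleftrightarrow> (\<forall>nm\<in>J. C \<omega> (Y (fst nm) \<omega>) (Y (snd nm) \<omega>))"

text \<open>The order condition lists each unordered pair of labels once, as the independence of the
  links requires. The inclusion of \<open>A\<close> ensures that both labels are in use wherever
  their link is evaluated.\<close>

definition past_pairs :: "'w set \<Rightarrow> (nat \<times> nat) set \<Rightarrow> bool" where
  "past_pairs A J \<longleftrightarrow> finite J \<and> (\<forall>nm\<in>J. fst nm < snd nm \<and> A \<subseteq> V (fst nm) \<inter> V (snd nm))"

text \<open>Only present links are prescribed. Such sets are already stable under intersection, and
  the algebra generated by them contains the absent links as well.\<close>

definition cylinder :: "'w set \<Rightarrow> (nat \<times> nat) set \<Rightarrow> 'w set" where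
  "cylinder A J = {\<omega>\<in>A. links J \<omega>}"

definition cylinders :: "'w measure \<Rightarrow> 'w set set" where
  "cylinders F = {cylinder A J |A J. A \<in> sets F \<and> past_pairs A J}"

definition pair_algebra :: "'w measure \<Rightarrow> 'w measure" where
  "pair_algebra F = sigma (space M) (cylinders F)"

text \<open>The past pairs and the pairs joining the new point \<open>p\<close> to past points are
  all different as unordered pairs, because the windows are disjoint. So the links over the disjoint
  sum of \<open>J\<close> and \<open>S\<close> are conditionally independent, those of
  \<open>J\<close> prescribed as present and those of \<open>S\<close> as absent.\<close>

lemma cylinder_fresh:
  assumes A: "A \<in> sets \<G>" "past_pairs A J" and S: "finite S" "\<And>i. i \<in> S \<Longrightarrow> A \<subseteq> V' p \<and> A \<subseteq> V i"
    and U: "U \<in> borel_measurable \<G>"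
  shows "{\<omega>\<in>A. links J \<omega> \<and> (\<forall>i\<in>S. \<not> C \<omega> (Y' p \<omega>) (Y i \<omega>))} \<in> events"
    and "(\<integral>\<^sup>+\<omega>. U \<omega> * indicator {\<omega>\<in>A. links J \<omega> \<and> (\<forall>i\<in>S. \<not> C \<omega> (Y' p \<omega>) (Y i \<omega>))} \<omega> \<partial>M) =
      (\<integral>\<^sup>+\<omega>. U \<omega> * (indicator A \<omega> *
        ennreal ((\<Prod>nm\<in>J. link_prob True (Y (fst nm) \<omega>) (Y (snd nm) \<omega>)) *
          (\<Prod>i\<in>S. link_prob False (Y' p \<omega>) (Y i \<omega>)))) \<partial>M)"
proof -
  let ?K = "J <+> S"
  let ?X = "case_sum (\<lambda>nm. Y (fst nm)) (\<lambda>i. Y' p)" and ?Z = "case_sum (\<lambda>nm. Y (snd nm)) (\<lambda>i. Y i)"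
  let ?b = "case_sum (\<lambda>nm. True) (\<lambda>i. False)"
  have J: "finite J" "\<And>nm. nm \<in> J \<Longrightarrow> fst nm < snd nm \<and> A \<subseteq> V (fst nm) \<inter> V (snd nm)"
    using A(2) by (auto simp: past_pairs_def)
  have fin: "finite ?K" using J S by simp
  have meas: "?X k \<in> \<G> \<rightarrow>\<^sub>M borel" "?Z k \<in> \<G> \<rightarrow>\<^sub>M borel" for k
    by (cases k; simp add: YV YV')+
  have VA: "nm \<in> J \<Longrightarrow> \<omega> \<in> A \<Longrightarrow> \<omega> \<in> V (fst nm) \<and> \<omega> \<in> V (snd nm)" for nm \<omega> using J(2) by blast
  have VS: "i \<in> S \<Longrightarrow> \<omega> \<in> A \<Longrightarrow> \<omega> \<in> V' p \<and> \<omega> \<in> V i" for i \<omega> using S(2) by blast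
  have pts: "?X k \<omega> \<in> \<Phi> \<omega> \<and> ?Z k \<omega> \<in> \<Phi> \<omega> \<and> ?X k \<omega> \<noteq> ?Z k \<omega>" if "\<omega> \<in> A" "k \<in> ?K" for \<omega> k
  proof (cases k)
    case (Inl nm)
    then have nm: "nm \<in> J" using that by auto
    show ?thesis using VA[OF nm that(1)] J(2)[OF nm] Y_mem(1) by (simp add: Inl Y_eq_iff)
  next
    case (Inr i)
    then have "i \<in> S" using that by auto
    from VS[OF this that(1)] show ?thesis using Y_mem(1) Y'_mem(1) Y'_neq_Y by (simp add: Inr)
  qed
  have inj: "inj_on (\<lambda>k. {?X k \<omega>, ?Z k \<omega>}) ?K" if \<omega>: "\<omega> \<in> A" for \<omega>
  proof (rule inj_onI)
    fix k l assume kl: "k \<in> ?K" "l \<in> ?K" "{?X k \<omega>, ?Z k \<omega>} = {?X l \<omega>, ?Z l \<omega>}"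
    show "k = l"
    proof (cases k; cases l)
      fix nm ij assume k: "k = Inl nm" and l: "l = Inl ij"
      then have J': "nm \<in> J" "ij \<in> J" using kl by auto
      have "{Y (fst nm) \<omega>, Y (snd nm) \<omega>} = {Y (fst ij) \<omega>, Y (snd ij) \<omega>}" using kl k l by simp
      then have "fst nm = fst ij \<and> snd nm = snd ij \<or> fst nm = snd ij \<and> snd nm = fst ij"
        using VA[OF J'(1) \<omega>] VA[OF J'(2) \<omega>] by (simp add: doubleton_eq_iff Y_eq_iff)
      then show ?thesis using J(2)[OF J'(1)] J(2)[OF J'(2)] k l by (auto simp: prod_eq_iff)
    next
      fix nm i assume k: "k = Inl nm" and l: "l = Inr i"
      then have J': "nm \<in> J" "i \<in> S" using kl by auto
      have "Y' p \<omega> \<in> {Y (fst nm) \<omega>, Y (snd nm) \<omega>}" using kl k l by simp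
      then show ?thesis using VA[OF J'(1) \<omega>] VS[OF J'(2) \<omega>] Y'_neq_Y by auto
    next
      fix i nm assume k: "k = Inr i" and l: "l = Inl nm"
      then have J': "nm \<in> J" "i \<in> S" using kl by auto
      have "Y' p \<omega> \<in> {Y (fst nm) \<omega>, Y (snd nm) \<omega>}" using kl k l by auto
      then show ?thesis using VA[OF J'(1) \<omega>] VS[OF J'(2) \<omega>] Y'_neq_Y by auto
    next
      fix i j assume k: "k = Inr i" and l: "l = Inr j"
      then have J': "i \<in> S" "j \<in> S" using kl by auto
      have "{Y' p \<omega>, Y i \<omega>} = {Y' p \<omega>, Y j \<omega>}" using kl k l by simp
      then have "Y i \<omega> = Y j \<omega>" by (auto simp: doubleton_eq_iff)
      then show ?thesis using VS[OF J'(1) \<omega>] VS[OF J'(2) \<omega>] k l by (simp add: Y_eq_iff)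
    qed
  qed
  have ball: "(\<forall>k\<in>?K. Q k) \<longleftrightarrow> (\<forall>nm\<in>J. Q (Inl nm)) \<and> (\<forall>i\<in>S. Q (Inr i))" for Q by auto
  have set_eq: "{\<omega>\<in>A. \<forall>k\<in>?K. C \<omega> (?X k \<omega>) (?Z k \<omega>) = ?b k} =
      {\<omega>\<in>A. links J \<omega> \<and> (\<forall>i\<in>S. \<not> C \<omega> (Y' p \<omega>) (Y i \<omega>))}"
    unfolding ball links_def by simp
  have prod_eq: "(\<Prod>k\<in>?K. link_prob (?b k) (?X k \<omega>) (?Z k \<omega>)) =
      (\<Prod>nm\<in>J. link_prob True (Y (fst nm) \<omega>) (Y (snd nm) \<omega>)) *
      (\<Prod>i\<in>S. link_prob False (Y' p \<omega>) (Y i \<omega>))" for \<omega>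
    using J(1) S(1) by (simp add: prod.Plus)
  note * = contention_nn_integral[where J = ?K and A = A and X = ?X and Y = ?Z and b = ?b, OF fin A(1) meas pts inj U]
  show "{\<omega>\<in>A. links J \<omega> \<and> (\<forall>i\<in>S. \<not> C \<omega> (Y' p \<omega>) (Y i \<omega>))} \<in> events"
    using *(1) unfolding set_eq .
  show "(\<integral>\<^sup>+\<omega>. U \<omega> * indicator {\<omega>\<in>A. links J \<omega> \<and> (\<forall>i\<in>S. \<not> C \<omega> (Y' p \<omega>) (Y i \<omega>))} \<omega> \<partial>M) =
      (\<integral>\<^sup>+\<omega>. U \<omega> * (indicator A \<omega> *
        ennreal ((\<Prod>nm\<in>J. link_prob True (Y (fst nm) \<omega>) (Y (snd nm) \<omega>)) *
          (\<Prod>i\<in>S. link_prob False (Y' p \<omega>) (Y i \<omega>)))) \<partial>M)"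
    using *(2) unfolding set_eq prod_eq .
qed

lemma cylinder_nn_integral:
  assumes A: "A \<in> sets \<G>" "past_pairs A J" and U: "U \<in> borel_measurable \<G>"
  shows "cylinder A J \<in> events"
    and "(\<integral>\<^sup>+\<omega>. U \<omega> * indicator (cylinder A J) \<omega> \<partial>M) =
      (\<integral>\<^sup>+\<omega>. U \<omega> * (indicator A \<omega> *
        ennreal (\<Prod>nm\<in>J. link_prob True (Y (fst nm) \<omega>) (Y (snd nm) \<omega>))) \<partial>M)"
  using cylinder_fresh[OF A, of "{}" 0 U] U unfolding cylinder_def by simp_all

lemma cylinders_events: "sets F \<subseteq> sets \<G> \<Longrightarrow> cylinders F \<subseteq> events"
  using cylinder_nn_integral(1)[OF _ _ borel_measurable_const[of 0]] unfolding cylinders_def by blast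

lemma cylinders_Pow: "sets F \<subseteq> sets \<G> \<Longrightarrow> cylinders F \<subseteq> Pow (space M)"
  using cylinders_events sets.space_closed by blast

lemma Int_stable_cylinders: "Int_stable (cylinders F)"
proof (rule Int_stableI)
  fix D D' assume "D \<in> cylinders F" "D' \<in> cylinders F"
  then obtain A J A' J' where *: "D = cylinder A J" "A \<in> sets F" "past_pairs A J"
    "D' = cylinder A' J'" "A' \<in> sets F" "past_pairs A' J'" unfolding cylinders_def by blast
  have "D \<inter> D' = cylinder (A \<inter> A') (J \<union> J')" by (auto simp: * cylinder_def links_def)
  moreover have "past_pairs (A \<inter> A') (J \<union> J')" using * by (auto simp: past_pairs_def)
  ultimately show "D \<inter> D' \<in> cylinders F" using * unfolding cylinders_def by blast
qed

lemma sets_cylinders: "A \<in> sets F \<Longrightarrow> A \<in> cylinders F"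
proof -
  assume A: "A \<in> sets F"
  have "A = cylinder A {}" "past_pairs A {}" by (auto simp: cylinder_def links_def past_pairs_def)
  then show ?thesis using A unfolding cylinders_def by blast
qed

lemma space_pair_algebra [simp]: "space (pair_algebra F) = space M"
  by (simp add: pair_algebra_def space_measure_of_conv)

lemma cylinders_sets: "sets F \<subseteq> sets \<G> \<Longrightarrow> cylinders F \<subseteq> sets (pair_algebra F)"
  unfolding pair_algebra_def using cylinders_Pow[of F] by (auto simp: sets_measure_of)

lemma pair_algebra_least:
  assumes F: "sets F \<subseteq> sets \<G>" and "cylinders F \<subseteq> sets N" "space N = space M"
  shows "sets (pair_algebra F) \<subseteq> sets N"
  using sets.sigma_sets_subset[OF assms(2)] cylinders_Pow[OF F] assms(3)
  by (simp add: pair_algebra_def sets_measure_of)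

text \<open>\<open>\<P>\<close> describes the past: points in \<open>W\<close> and links between
  them. \<open>\<H>\<close> adds the positions and timers of all other points, but no link of a new
  point, so those links remain to be integrated out given \<open>\<H>\<close>.\<close>

abbreviation "\<P> \<equiv> pair_algebra (window_algebra W)"
abbreviation "\<H> \<equiv> pair_algebra \<G>"

lemma window_\<G>: "sets (window_algebra W) \<subseteq> sets \<G>"
  using subalgebra_window[OF W] by (simp add: subalgebra_def)

lemma cylinders_mono: "sets F \<subseteq> sets F' \<Longrightarrow> cylinders F \<subseteq> cylinders F'"
  unfolding cylinders_def by blast

lemma subalgebra_\<H>: "subalgebra M \<H>" and subalgebra_\<P>: "subalgebra M \<P>" and subalgebra_\<H>_\<P>: "subalgebra \<H> \<P>"
  and subalgebra_\<H>_\<G>: "subalgebra \<H> \<G>"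
proof -
  have "sets \<H> \<subseteq> events" by (rule pair_algebra_least) (use cylinders_events[of \<G>] in auto)
  then show "subalgebra M \<H>" by (simp add: subalgebra_def)
  have "sets \<P> \<subseteq> events"
    by (rule pair_algebra_least[OF window_\<G> cylinders_events[OF window_\<G>]]) simp
  then show "subalgebra M \<P>" by (simp add: subalgebra_def)
  have "sets \<P> \<subseteq> sets \<H>"
    by (rule pair_algebra_least[OF window_\<G> order_trans[OF cylinders_mono[OF window_\<G>] cylinders_sets]]) simp_all
  then show "subalgebra \<H> \<P>" by (simp add: subalgebra_def)
  have "sets \<G> \<subseteq> sets \<H>" using sets_cylinders[of _ \<G>] cylinders_sets[of \<G>] by blast
  then show "subalgebra \<H> \<G>" by (simp add: subalgebra_def)
qed

lemma subalgebra_\<P>_window: "subalgebra \<P> (window_algebra W)"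
proof -
  have "sets (window_algebra W) \<subseteq> sets \<P>"
    using sets_cylinders[of _ "window_algebra W"] cylinders_sets[OF window_\<G>] by blast
  then show ?thesis by (simp add: subalgebra_def)
qed

lemma link_event:
  assumes "n \<noteq> m"
  shows "{\<omega>\<in>V n \<inter> V m. C \<omega> (Y n \<omega>) (Y m \<omega>)} \<in> sets \<P>"
proof -
  have *: "{\<omega>\<in>V n \<inter> V m. C \<omega> (Y n \<omega>) (Y m \<omega>)} \<in> sets \<P>" if "n < m" for n m
  proof -
    have "{\<omega>\<in>V n \<inter> V m. C \<omega> (Y n \<omega>) (Y m \<omega>)} = cylinder (V n \<inter> V m) {(n, m)}"
      by (auto simp: cylinder_def links_def)
    moreover have "past_pairs (V n \<inter> V m) {(n, m)}" using that by (auto simp: past_pairs_def)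
    moreover have "V n \<inter> V m \<in> sets (window_algebra W)" using YV(2) by auto
    ultimately show ?thesis using cylinders_sets[OF window_\<G>] unfolding cylinders_def by blast
  qed
  \<comment> \<open>Cylinders take labels in increasing order; the other order is covered by the
    symmetry of \<open>C\<close>, which holds on the points of \<open>\<Phi>\<close>.\<close>
  have "{\<omega>\<in>V n \<inter> V m. C \<omega> (Y n \<omega>) (Y m \<omega>)} = {\<omega>\<in>V m \<inter> V n. C \<omega> (Y m \<omega>) (Y n \<omega>)}"
    using C_contention Y_mem(1) V_space unfolding contention_variables_def by blast
  then show ?thesis using *[of n m] *[of m n] assms by (metis linorder_neqE_nat)
qed

text \<open>Given \<open>\<H>\<close> the links of the new point \<open>p\<close> are still
  undetermined. On a cylinder the past links contribute the same factor \<open>?r J\<close> on both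
  sides, and the factor belonging to \<open>S\<close> splits off.\<close>

lemma fresh_finite:
  assumes U: "U \<in> borel_measurable \<H>" and S: "finite S"
  shows "(\<integral>\<^sup>+\<omega>. U \<omega> * indicator {\<omega>\<in>V' p. \<forall>i\<in>S. \<omega> \<in> V i \<and> \<not> C \<omega> (Y' p \<omega>) (Y i \<omega>)} \<omega> \<partial>M) =
    (\<integral>\<^sup>+\<omega>. U \<omega> * (indicator {\<omega>\<in>V' p. \<forall>i\<in>S. \<omega> \<in> V i} \<omega> *
      ennreal (\<Prod>i\<in>S. link_prob False (Y' p \<omega>) (Y i \<omega>))) \<partial>M)"
    and "{\<omega>\<in>V' p. \<forall>i\<in>S. \<omega> \<in> V i \<and> \<not> C \<omega> (Y' p \<omega>) (Y i \<omega>)} \<in> events"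
proof -
  let ?A = "{\<omega>\<in>V' p. \<forall>i\<in>S. \<omega> \<in> V i}"
  let ?E = "{\<omega>\<in>V' p. \<forall>i\<in>S. \<omega> \<in> V i \<and> \<not> C \<omega> (Y' p \<omega>) (Y i \<omega>)}"
  let ?q = "\<lambda>\<omega>. \<Prod>i\<in>S. link_prob False (Y' p \<omega>) (Y i \<omega>)"
  let ?r = "\<lambda>J \<omega>. \<Prod>nm\<in>J. link_prob True (Y (fst nm) \<omega>) (Y (snd nm) \<omega>)"
  have A: "?A \<in> sets \<G>"
  proof -
    have "?A = V' p - (\<Union>i\<in>S. space \<G> - V i)" using V'_space by auto
    also have "\<dots> \<in> sets \<G>" using S YV(4) YV'(4) sets.top[of \<G>] by (intro sets.Diff sets.finite_UN) simp_all
    finally show ?thesis .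
  qed
  have q: "?q \<in> borel_measurable \<G>" by (intro borel_measurable_prod link_prob_measurable YV YV')
  have 1: "{\<omega>\<in>A \<inter> ?A. links J \<omega> \<and> (\<forall>i\<in>S. \<not> C \<omega> (Y' p \<omega>) (Y i \<omega>))} = cylinder A J \<inter> ?E" for A J
    by (auto simp: cylinder_def)
  have eq: "(\<integral>\<^sup>+\<omega>. indicator ?E \<omega> * indicator D \<omega> \<partial>M) =
      (\<integral>\<^sup>+\<omega>. (indicator ?A \<omega> * ennreal (?q \<omega>)) * indicator D \<omega> \<partial>M)" if "D \<in> cylinders \<G>" for D
  proof -
    from that obtain A J where D: "D = cylinder A J" "A \<in> sets \<G>" "past_pairs A J"
      unfolding cylinders_def by blast
    have A': "A \<inter> ?A \<in> sets \<G>" "past_pairs (A \<inter> ?A) J" using D A by (auto simp: past_pairs_def)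
    have "(\<integral>\<^sup>+\<omega>. indicator ?E \<omega> * indicator D \<omega> \<partial>M) =
        (\<integral>\<^sup>+\<omega>. 1 * indicator {\<omega>\<in>A \<inter> ?A. links J \<omega> \<and> (\<forall>i\<in>S. \<not> C \<omega> (Y' p \<omega>) (Y i \<omega>))} \<omega> \<partial>M)"
      unfolding 1 D(1) by (intro nn_integral_cong) (auto simp: indicator_def)
    also have "\<dots> = (\<integral>\<^sup>+\<omega>. 1 * (indicator (A \<inter> ?A) \<omega> * ennreal (?r J \<omega> * ?q \<omega>)) \<partial>M)"
      by (rule cylinder_fresh(2)[OF A' S]) auto
    also have "\<dots> = (\<integral>\<^sup>+\<omega>. ennreal (?q \<omega>) * (indicator (A \<inter> ?A) \<omega> * ennreal (?r J \<omega>)) \<partial>M)"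
      by (intro nn_integral_cong) (simp add: ennreal_mult' prod_nonneg link_prob_range mult_ac)
    also have "\<dots> = (\<integral>\<^sup>+\<omega>. ennreal (?q \<omega>) * indicator (cylinder (A \<inter> ?A) J) \<omega> \<partial>M)"
      using q by (intro cylinder_nn_integral(2)[OF A', symmetric]) simp
    also have "\<dots> = (\<integral>\<^sup>+\<omega>. (indicator ?A \<omega> * ennreal (?q \<omega>)) * indicator D \<omega> \<partial>M)"
      unfolding D(1) by (intro nn_integral_cong) (auto simp: indicator_def cylinder_def)
    finally show ?thesis .
  qed
  have "?E = {\<omega>\<in>?A. links {} \<omega> \<and> (\<forall>i\<in>S. \<not> C \<omega> (Y' p \<omega>) (Y i \<omega>))}" by (auto simp: links_def)
  also have "\<dots> \<in> events"
    by (rule cylinder_fresh(1)[OF A _ S, where J = "{}" and U = "\<lambda>_. 0"]) (auto simp: past_pairs_def)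
  finally show E: "?E \<in> events" .
  have fin: "(\<integral>\<^sup>+\<omega>. indicator ?E \<omega> \<partial>M) \<noteq> \<infinity>"
    unfolding nn_integral_indicator[OF E] by simp
  show "(\<integral>\<^sup>+\<omega>. U \<omega> * indicator ?E \<omega> \<partial>M) = (\<integral>\<^sup>+\<omega>. U \<omega> * (indicator ?A \<omega> * ennreal (?q \<omega>)) \<partial>M)"
  proof (rule nn_integral_eq_generator[OF cylinders_events[OF order_refl] Int_stable_cylinders])
    show "space M \<in> cylinders \<G>" using sets_cylinders[OF sets.top[of \<G>]] by simp
    show "indicator ?E \<in> borel_measurable M" using E by simp
    have "?q \<in> borel_measurable M" by (rule measurable_from_subalg[OF subalgebra_\<G> q])
    moreover have "?A \<in> events" using A subalgebra_\<G> by (auto simp: subalgebra_def)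
    ultimately show "(\<lambda>\<omega>. indicator ?A \<omega> * ennreal (?q \<omega>)) \<in> borel_measurable M"
      by (intro borel_measurable_times_ennreal) auto
    show "U \<in> borel_measurable (sigma (space M) (cylinders \<G>))"
      using U unfolding pair_algebra_def .
  qed (use fin eq in auto)
qed

text \<open>Summing over the possible values of the random finite set of selected past points.\<close>

lemma fresh:
  assumes U: "U \<in> borel_measurable \<H>" and Sel: "\<And>i. Sel i \<in> sets \<H>" "\<And>i. Sel i \<subseteq> V i"
  shows "(\<integral>\<^sup>+\<omega>. U \<omega> * indicator {\<omega>\<in>V' p. \<forall>i<N. \<omega> \<in> Sel i \<longrightarrow> \<not> C \<omega> (Y' p \<omega>) (Y i \<omega>)} \<omega> \<partial>M) =
    (\<integral>\<^sup>+\<omega>. U \<omega> * (indicator (V' p) \<omega> *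
      ennreal (\<Prod>i<N. if \<omega> \<in> Sel i then link_prob False (Y' p \<omega>) (Y i \<omega>) else 1)) \<partial>M)"
    and "{\<omega>\<in>V' p. \<forall>i<N. \<omega> \<in> Sel i \<longrightarrow> \<not> C \<omega> (Y' p \<omega>) (Y i \<omega>)} \<in> events"
proof -
  \<comment> \<open>\<open>?D \<sigma>\<close> is the event that the selected labels below
    \<open>N\<close> are exactly those in \<open>\<sigma>\<close>. It belongs to
    \<open>\<H>\<close>, so its indicator can be absorbed into the weight \<open>U\<close> before
    the finite version is applied.\<close>
  let ?D = "\<lambda>\<sigma>. {\<omega>\<in>space \<H>. \<forall>i<N. \<omega> \<in> Sel i \<longleftrightarrow> i \<in> \<sigma>}"
  let ?E = "\<lambda>\<sigma>. {\<omega>\<in>V' p. \<forall>i\<in>\<sigma>. \<omega> \<in> V i \<and> \<not> C \<omega> (Y' p \<omega>) (Y i \<omega>)}"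
  let ?A = "\<lambda>\<sigma>. {\<omega>\<in>V' p. \<forall>i\<in>\<sigma>. \<omega> \<in> V i}"
  let ?q = "\<lambda>\<sigma> \<omega>. \<Prod>i\<in>\<sigma>. link_prob False (Y' p \<omega>) (Y i \<omega>)"
  let ?S = "\<lambda>\<omega>. {i. i < N \<and> \<omega> \<in> Sel i}"
  let ?F = "{\<omega>\<in>V' p. \<forall>i<N. \<omega> \<in> Sel i \<longrightarrow> \<not> C \<omega> (Y' p \<omega>) (Y i \<omega>)}"
  have D: "?D \<sigma> \<in> sets \<H>" for \<sigma>
  proof -
    have "?D \<sigma> = space \<H> - (\<Union>i\<in>{..<N}. if i \<in> \<sigma> then space \<H> - Sel i else Sel i)"
      using sets.sets_into_space[OF Sel(1)] by (auto split: if_splits)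
    also have "\<dots> \<in> sets \<H>"
      using Sel(1) sets.top[of \<H>] by (intro sets.Diff sets.finite_UN) (simp_all add: sets.Diff)
    finally show ?thesis .
  qed
  have D_iff: "\<omega> \<in> ?D \<sigma> \<longleftrightarrow> \<sigma> = ?S \<omega>" if "\<sigma> \<in> Pow {..<N}" "\<omega> \<in> space M" for \<omega> \<sigma>
    using that by auto
  have split: "(\<Sum>\<sigma>\<in>Pow {..<N}. indicator (?D \<sigma>) \<omega> * g \<sigma>) = g (?S \<omega>)"
    if "\<omega> \<in> space M" for \<omega> and g :: "nat set \<Rightarrow> ennreal"
  proof -
    have "(\<Sum>\<sigma>\<in>Pow {..<N}. indicator (?D \<sigma>) \<omega> * g \<sigma>) = (\<Sum>\<sigma>\<in>Pow {..<N}. if \<sigma> = ?S \<omega> then g \<sigma> else 0)"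
      using D_iff that by (intro sum.cong refl) (simp add: indicator_def)
    also have "\<dots> = g (?S \<omega>)" by (subst sum.delta) auto
    finally show ?thesis .
  qed
  have E: "?E \<sigma> \<in> events" if "\<sigma> \<in> Pow {..<N}" for \<sigma>
    using that by (intro fresh_finite(2)[of "\<lambda>_. 0"]) (auto intro: finite_subset)
  have UD: "(\<lambda>\<omega>. U \<omega> * indicator (?D \<sigma>) \<omega>) \<in> borel_measurable \<H>" for \<sigma>
    using U D[of \<sigma>] by (intro borel_measurable_times_ennreal borel_measurable_indicator)
  have UDM: "(\<lambda>\<omega>. U \<omega> * indicator (?D \<sigma>) \<omega>) \<in> borel_measurable M" for \<sigma>
    by (rule measurable_from_subalg[OF subalgebra_\<H> UD])
  have inE: "indicator ?F \<omega> = indicator (?E (?S \<omega>)) \<omega>" if "\<omega> \<in> space M" for \<omega>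
    using Sel(2) by (auto simp: indicator_def)
  have inA: "indicator (V' p) \<omega> = indicator (?A (?S \<omega>)) \<omega>" if "\<omega> \<in> space M" for \<omega>
    using Sel(2) by (auto simp: indicator_def)
  have pr: "(\<Prod>i<N. if \<omega> \<in> Sel i then link_prob False (Y' p \<omega>) (Y i \<omega>) else 1) = ?q (?S \<omega>) \<omega>" for \<omega>
  proof -
    have "?q (?S \<omega>) \<omega> = ?q ({..<N} \<inter> {i. \<omega> \<in> Sel i}) \<omega>" by (intro prod.cong) auto
    then show ?thesis by (simp add: prod.inter_restrict)
  qed
  have qM: "(\<lambda>\<omega>. indicator (?A \<sigma>) \<omega> * ennreal (?q \<sigma> \<omega>)) \<in> borel_measurable M" if "\<sigma> \<in> Pow {..<N}" for \<sigma>
  proof -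
    have "?A \<sigma> = V' p - (\<Union>i\<in>\<sigma>. space M - V i)" using V'_space by auto
    also have "\<dots> \<in> events" using that YV(6) YV'(6) by (intro sets.Diff sets.finite_UN) (auto intro: finite_subset)
    finally have "?A \<sigma> \<in> events" .
    moreover have "?q \<sigma> \<in> borel_measurable M" by (intro borel_measurable_prod link_prob_measurable YV YV')
    ultimately show ?thesis by (intro borel_measurable_times_ennreal) auto
  qed
  have "?F = (\<Union>\<sigma>\<in>Pow {..<N}. ?D \<sigma> \<inter> ?E \<sigma>)"
  proof (intro equalityI subsetI)
    fix \<omega> assume \<omega>: "\<omega> \<in> ?F"
    then have "\<omega> \<in> space M" using V'_space by auto
    then have "\<omega> \<in> ?D (?S \<omega>) \<inter> ?E (?S \<omega>)" using \<omega> Sel(2) by auto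
    then show "\<omega> \<in> (\<Union>\<sigma>\<in>Pow {..<N}. ?D \<sigma> \<inter> ?E \<sigma>)" by (intro UN_I[of "?S \<omega>"]) auto
  qed auto
  also have "\<dots> \<in> events"
  proof (intro sets.finite_UN sets.Int E)
    show "?D \<sigma> \<in> events" for \<sigma> using subalgebra_\<H> D[of \<sigma>] unfolding subalgebra_def by (elim conjE) (erule subsetD)
  qed simp_all
  finally show "?F \<in> events" .
  have "(\<integral>\<^sup>+\<omega>. U \<omega> * indicator ?F \<omega> \<partial>M) =
      (\<integral>\<^sup>+\<omega>. (\<Sum>\<sigma>\<in>Pow {..<N}. (U \<omega> * indicator (?D \<sigma>) \<omega>) * indicator (?E \<sigma>) \<omega>) \<partial>M)"
  proof (rule nn_integral_cong)
    fix \<omega> assume \<omega>: "\<omega> \<in> space M"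
    show "U \<omega> * indicator ?F \<omega> = (\<Sum>\<sigma>\<in>Pow {..<N}. (U \<omega> * indicator (?D \<sigma>) \<omega>) * indicator (?E \<sigma>) \<omega>)"
      using split[OF \<omega>, of "\<lambda>\<sigma>. U \<omega> * indicator (?E \<sigma>) \<omega>"] unfolding inE[OF \<omega>] by (simp only: mult_ac)
  qed
  also have "\<dots> = (\<Sum>\<sigma>\<in>Pow {..<N}. \<integral>\<^sup>+\<omega>. (U \<omega> * indicator (?D \<sigma>) \<omega>) * indicator (?E \<sigma>) \<omega> \<partial>M)"
  proof (rule nn_integral_sum)
    fix \<sigma> assume "\<sigma> \<in> Pow {..<N}"
    from UDM borel_measurable_indicator[OF E[OF this]]
    show "(\<lambda>\<omega>. (U \<omega> * indicator (?D \<sigma>) \<omega>) * indicator (?E \<sigma>) \<omega>) \<in> borel_measurable M"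
      by (rule borel_measurable_times_ennreal)
  qed
  also have "\<dots> = (\<Sum>\<sigma>\<in>Pow {..<N}. \<integral>\<^sup>+\<omega>. (U \<omega> * indicator (?D \<sigma>) \<omega>) * (indicator (?A \<sigma>) \<omega> * ennreal (?q \<sigma> \<omega>)) \<partial>M)"
  proof (rule sum.cong[OF refl])
    fix \<sigma> assume "\<sigma> \<in> Pow {..<N}"
    then have "finite \<sigma>" by (auto intro: finite_subset)
    from fresh_finite(1)[OF UD this]
    show "(\<integral>\<^sup>+\<omega>. (U \<omega> * indicator (?D \<sigma>) \<omega>) * indicator (?E \<sigma>) \<omega> \<partial>M) =
      (\<integral>\<^sup>+\<omega>. (U \<omega> * indicator (?D \<sigma>) \<omega>) * (indicator (?A \<sigma>) \<omega> * ennreal (?q \<sigma> \<omega>)) \<partial>M)" .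
  qed
  also have "\<dots> = (\<integral>\<^sup>+\<omega>. (\<Sum>\<sigma>\<in>Pow {..<N}. (U \<omega> * indicator (?D \<sigma>) \<omega>) * (indicator (?A \<sigma>) \<omega> * ennreal (?q \<sigma> \<omega>))) \<partial>M)"
    by (rule nn_integral_sum[symmetric], rule borel_measurable_times_ennreal[OF UDM qM])
  also have "\<dots> = (\<integral>\<^sup>+\<omega>. U \<omega> * (indicator (V' p) \<omega> *
      ennreal (\<Prod>i<N. if \<omega> \<in> Sel i then link_prob False (Y' p \<omega>) (Y i \<omega>) else 1)) \<partial>M)"
  proof (rule nn_integral_cong)
    fix \<omega> assume \<omega>: "\<omega> \<in> space M"
    show "(\<Sum>\<sigma>\<in>Pow {..<N}. (U \<omega> * indicator (?D \<sigma>) \<omega>) * (indicator (?A \<sigma>) \<omega> * ennreal (?q \<sigma> \<omega>))) =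
      U \<omega> * (indicator (V' p) \<omega> *
      ennreal (\<Prod>i<N. if \<omega> \<in> Sel i then link_prob False (Y' p \<omega>) (Y i \<omega>) else 1))"
      using split[OF \<omega>, of "\<lambda>\<sigma>. U \<omega> * (indicator (?A \<sigma>) \<omega> * ennreal (?q \<sigma> \<omega>))"] unfolding inA[OF \<omega>] pr
      by (simp only: mult_ac)
  qed
  finally show "(\<integral>\<^sup>+\<omega>. U \<omega> * indicator ?F \<omega> \<partial>M) = (\<integral>\<^sup>+\<omega>. U \<omega> * (indicator (V' p) \<omega> *
      ennreal (\<Prod>i<N. if \<omega> \<in> Sel i then link_prob False (Y' p \<omega>) (Y i \<omega>) else 1)) \<partial>M)" .
qed

text \<open>Given the points, prescribing past links amounts to the factor \<open>?r J\<close>, a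
  function of the points in \<open>W\<close> alone. Thus the independence of disjoint windows
  extends from the past points to the past points together with their links.\<close>

lemma past_indep:
  assumes D: "D \<in> sets \<P>" and B: "B \<in> sets borel" "bounded B" "W \<inter> B = {}"
  shows "(\<integral>\<^sup>+\<omega>. indicator D \<omega> * of_nat (card (\<Phi> \<omega> \<inter> B)) \<partial>M) = emeasure M D * emeasure (intensity UNIV) B"
proof -
  let ?n = "\<lambda>\<omega>. of_nat (card (\<Phi> \<omega> \<inter> B)) :: ennreal"
  let ?r = "\<lambda>J \<omega>. \<Prod>nm\<in>J. link_prob True (Y (fst nm) \<omega>) (Y (snd nm) \<omega>)"
  have nG: "?n \<in> borel_measurable \<G>" by (rule measurable_compose[OF card_measurable_\<G>[OF B(1,2)]]) simp
  have eq: "(\<integral>\<^sup>+\<omega>. ?n \<omega> * indicator D \<omega> \<partial>M) = (\<integral>\<^sup>+\<omega>. emeasure (intensity UNIV) B * indicator D \<omega> \<partial>M)"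
    if "D \<in> cylinders (window_algebra W)" for D
  proof -
    from that obtain A J where DA: "D = cylinder A J" "A \<in> sets (window_algebra W)" "past_pairs A J"
      unfolding cylinders_def by blast
    have AG: "A \<in> sets \<G>" using DA(2) window_\<G> by blast
    have "?r J \<in> borel_measurable (window_algebra W)" by (intro borel_measurable_prod link_prob_measurable YV)
    then have rW: "(\<lambda>\<omega>. indicator A \<omega> * ennreal (?r J \<omega>)) \<in> borel_measurable (window_algebra W)"
      using DA(2) by (intro borel_measurable_times_ennreal) auto
    have D_ev: "D \<in> events" using cylinder_nn_integral(1)[OF AG DA(3) nG] DA(1) by simp
    have "(\<integral>\<^sup>+\<omega>. ?n \<omega> * indicator D \<omega> \<partial>M) = (\<integral>\<^sup>+\<omega>. ?n \<omega> * (indicator A \<omega> * ennreal (?r J \<omega>)) \<partial>M)"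
      unfolding DA(1) by (rule cylinder_nn_integral(2)[OF AG DA(3) nG])
    also have "\<dots> = (\<integral>\<^sup>+\<omega>. (indicator A \<omega> * ennreal (?r J \<omega>)) * ?n \<omega> \<partial>M)"
      by (simp only: mult_ac)
    also have "\<dots> = (\<integral>\<^sup>+\<omega>. indicator A \<omega> * ennreal (?r J \<omega>) \<partial>M) * emeasure (intensity UNIV) B"
      by (rule window_algebra_indep[OF W B rW])
    also have "(\<integral>\<^sup>+\<omega>. indicator A \<omega> * ennreal (?r J \<omega>) \<partial>M) = (\<integral>\<^sup>+\<omega>. 1 * indicator D \<omega> \<partial>M)"
      unfolding DA(1) using cylinder_nn_integral(2)[OF AG DA(3), of "\<lambda>_. 1"] by simp
    also have "\<dots> = emeasure M D" using D_ev by simp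
    finally show ?thesis
      using nn_integral_cmult_indicator[OF D_ev, of "emeasure (intensity UNIV) B"] by (simp only: mult.commute)
  qed
  have "(\<integral>\<^sup>+\<omega>. indicator D \<omega> * ?n \<omega> \<partial>M) = (\<integral>\<^sup>+\<omega>. indicator D \<omega> * emeasure (intensity UNIV) B \<partial>M)"
  proof (rule nn_integral_eq_generator[OF cylinders_events[OF window_\<G>] Int_stable_cylinders])
    show "space M \<in> cylinders (window_algebra W)" using sets_cylinders[OF sets.top[of "window_algebra W"]] by simp
    show "?n \<in> borel_measurable M" by (rule measurable_from_subalg[OF subalgebra_\<G> nG])
    show "(\<integral>\<^sup>+\<omega>. ?n \<omega> \<partial>M) \<noteq> \<infinity>"
      unfolding nn_integral_card(1)[OF B(1,2)] using emeasure_intensity_bounded[OF _ B(1,2), of UNIV] by simp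
    show "indicator D \<in> borel_measurable (sigma (space M) (cylinders (window_algebra W)))"
      using D unfolding pair_algebra_def by simp
  qed (use eq in auto)
  also have "\<dots> = emeasure M D * emeasure (intensity UNIV) B"
    using D subalgebra_\<P> by (subst nn_integral_multc) (auto simp: subalgebra_def)
  finally show ?thesis .
qed

text \<open>The integrand may depend on the past, which keeps its law under the integral over
  \<open>z\<close> because it is independent of the new points. On rectangles the formula is
  \<open>past_indep\<close>.\<close>

lemma campbell:
  fixes f :: "tpoint \<times> 'w \<Rightarrow> ennreal"
  assumes f: "f \<in> borel_measurable (borel \<Otimes>\<^sub>M \<P>)"
  shows "(\<integral>\<^sup>+p. (\<integral>\<^sup>+\<omega>. indicator (V' p) \<omega> * f (Y' p \<omega>, \<omega>) \<partial>M) \<partial>count_space UNIV) =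
    (\<integral>\<^sup>+z. (\<integral>\<^sup>+\<omega>. f (z, \<omega>) \<partial>M) \<partial>intensity W')"
proof -
  \<comment> \<open>The integrand is jointly measurable with respect to \<open>\<P>\<close>, so the
    product measure is formed with the restriction of \<open>M\<close> to that algebra.\<close>
  let ?P = "restr_to_subalg M \<P>"
  have sets_P: "sets ?P = sets \<P>" and space_P: "space ?P = space M"
    using sets_restr_to_subalg[OF subalgebra_\<P>] by (auto simp: space_restr_to_subalg)
  interpret P: prob_space ?P
    by (rule prob_spaceI) (simp add: space_P emeasure_restr_to_subalg[OF subalgebra_\<P> sets.top[of \<P>, simplified]] emeasure_space_1)
  have sets_eq: "sets (intensity W' \<Otimes>\<^sub>M ?P) = sets (borel \<Otimes>\<^sub>M \<P>)"
    by (intro sets_pair_measure_cong sets_P) simp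
  have f': "f \<in> borel_measurable (intensity W' \<Otimes>\<^sub>M ?P)"
    using f measurable_cong_sets[OF sets_eq refl] by blast
  have id_P: "(\<lambda>\<omega>. \<omega>) \<in> M \<rightarrow>\<^sub>M \<P>" by (rule measurable_from_subalg[OF subalgebra_\<P>]) simp
  have id: "(\<lambda>\<omega>. \<omega>) \<in> M \<rightarrow>\<^sub>M ?P"
    using id_P measurable_cong_sets[OF refl sets_P] by blast
  have Y': "Y' p \<in> M \<rightarrow>\<^sub>M intensity W'" for p
    using YV'(5) measurable_cong_sets[OF refl sets_intensity] by blast
  have "(\<integral>\<^sup>+p. (\<integral>\<^sup>+\<omega>. indicator (V' p) \<omega> * f (Y' p \<omega>, \<omega>) \<partial>M) \<partial>count_space UNIV) =
      (\<integral>\<^sup>+z. f z \<partial>(intensity W' \<Otimes>\<^sub>M ?P))"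
  proof (rule point_measure_eq[where P = "\<lambda>n. cball 0 (real n)" and Q = "\<lambda>_. space M"
        and T = "\<lambda>p \<omega>. (Y' p \<omega>, \<omega>)"])
    show "(\<lambda>\<omega>. (Y' p \<omega>, \<omega>)) \<in> M \<rightarrow>\<^sub>M intensity W' \<Otimes>\<^sub>M ?P" for p
      by (intro measurable_Pair Y' id)
    show "incseq (\<lambda>n. cball (0 :: tpoint) (real n))" by (auto simp: incseq_def)
    have "(\<Union>n. cball (0 :: tpoint) (real n)) = UNIV"
      by (auto simp: mem_cball dist_norm intro: real_arch_simple)
    then show "(\<Union>n. cball 0 (real n)) = space (intensity W')" by simp
    show "range (\<lambda>_. space M) \<subseteq> sets ?P" using sets.top[of ?P] by (simp add: space_P)
    fix n A D
    assume "A \<in> sets (intensity W')" "A \<subseteq> cball 0 (real n)" and "D \<in> sets ?P"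
    then have A: "A \<in> sets borel" "bounded A" and D: "D \<in> sets \<P>"
      by (auto simp: sets_P intro: bounded_subset[OF bounded_cball])
    have DM: "D \<in> events" using D subalgebra_\<P> by (auto simp: subalgebra_def)
    have B: "W' \<inter> A \<in> sets borel" "bounded (W' \<inter> A)" "W \<inter> (W' \<inter> A) = {}"
      using W' A disjoint by (auto simp: bounded_Int)
    have meas: "(\<lambda>\<omega>. indicator (V' p) \<omega> * indicator (A \<times> D) (Y' p \<omega>, \<omega>) :: ennreal) \<in> borel_measurable M" for p
    proof (rule borel_measurable_times_ennreal)
      show "indicator (V' p) \<in> borel_measurable M" using YV'(6) by (rule borel_measurable_indicator)
      have "(\<lambda>\<omega>. (Y' p \<omega>, \<omega>)) \<in> M \<rightarrow>\<^sub>M borel \<Otimes>\<^sub>M \<P>" by (intro measurable_Pair YV' id_P)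
      then show "(\<lambda>\<omega>. indicator (A \<times> D) (Y' p \<omega>, \<omega>) :: ennreal) \<in> borel_measurable M"
        by (rule measurable_compose) (use A D in auto)
    qed
    have "(\<integral>\<^sup>+p. (\<integral>\<^sup>+\<omega>. indicator (V' p) \<omega> * indicator (A \<times> D) (Y' p \<omega>, \<omega>) \<partial>M) \<partial>count_space UNIV) =
        (\<integral>\<^sup>+\<omega>. (\<integral>\<^sup>+p. indicator (V' p) \<omega> * indicator (A \<times> D) (Y' p \<omega>, \<omega>) \<partial>count_space UNIV) \<partial>M)"
      by (rule nn_integral_count_space_swap[OF sigma_finite_measure_axioms meas])
    also have "\<dots> = (\<integral>\<^sup>+\<omega>. indicator D \<omega> * of_nat (card (\<Phi> \<omega> \<inter> (W' \<inter> A))) \<partial>M)"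
    proof (rule nn_integral_cong)
      fix \<omega> assume \<omega>: "\<omega> \<in> space M"
      let ?I = "{n. \<omega> \<in> V' n \<and> Y' n \<omega> \<in> A}"
      have bij: "bij_betw (\<lambda>n. Y' n \<omega>) ?I (\<Phi> \<omega> \<inter> W' \<inter> A)"
        by (rule enumerates_bij_betw[OF enum']) (simp add: \<omega>)
      have fin: "finite ?I"
        unfolding bij_betw_finite[OF bij] using \<Phi>_finite[OF \<omega> A(2)] by (rule finite_subset[rotated]) auto
      have "(\<integral>\<^sup>+p. indicator (V' p) \<omega> * indicator (A \<times> D) (Y' p \<omega>, \<omega>) \<partial>count_space UNIV) =
          (\<integral>\<^sup>+p. indicator D \<omega> * indicator ?I p \<partial>count_space UNIV)"
        by (intro nn_integral_cong) (auto simp: indicator_def)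
      also have "\<dots> = indicator D \<omega> * of_nat (card ?I)"
        using fin by (simp add: nn_integral_cmult)
      finally show "(\<integral>\<^sup>+p. indicator (V' p) \<omega> * indicator (A \<times> D) (Y' p \<omega>, \<omega>) \<partial>count_space UNIV) =
          indicator D \<omega> * of_nat (card (\<Phi> \<omega> \<inter> (W' \<inter> A)))"
        unfolding bij_betw_same_card[OF bij] Int_assoc .
    qed
    also have "\<dots> = emeasure M D * emeasure (intensity UNIV) (W' \<inter> A)" by (rule past_indep[OF D B])
    also have "\<dots> = emeasure (intensity W') A * emeasure ?P D"
      using W' A B by (simp add: emeasure_intensity emeasure_restr_to_subalg[OF subalgebra_\<P> D] mult.commute)
    finally show "(\<integral>\<^sup>+p. (\<integral>\<^sup>+\<omega>. indicator (V' p) \<omega> * indicator (A \<times> D) (Y' p \<omega>, \<omega>) \<partial>M) \<partial>count_space UNIV) =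
        emeasure (intensity W') A * emeasure ?P D" .
  qed (use f' YV'(6) space_P sigma_finite_intensity[OF W'] in \<open>auto intro: sigma_finite_measure_axioms P.sigma_finite_measure_axioms\<close>)
  also have "\<dots> = (\<integral>\<^sup>+z. (\<integral>\<^sup>+\<omega>. f (z, \<omega>) \<partial>?P) \<partial>intensity W')"
    by (rule P.nn_integral_fst[OF f', symmetric])
  also have "\<dots> = (\<integral>\<^sup>+z. (\<integral>\<^sup>+\<omega>. f (z, \<omega>) \<partial>M) \<partial>intensity W')"
  proof (rule nn_integral_cong)
    fix z
    have "(\<lambda>\<omega>. f (z, \<omega>)) \<in> borel_measurable \<P>"
      by (rule measurable_compose[OF measurable_Pair1' f]) simp
    then show "(\<integral>\<^sup>+\<omega>. f (z, \<omega>) \<partial>?P) = (\<integral>\<^sup>+\<omega>. f (z, \<omega>) \<partial>M)"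
      by (rule nn_integral_subalgebra2[OF subalgebra_\<P>])
  qed
  finally show ?thesis .
qed

text \<open>This supplies the term with \<open>h\<close> in the error caused by pairs of new
  points.\<close>

lemma new_link:
  assumes "p \<noteq> q" and U: "U \<in> borel_measurable \<G>"
  shows "{\<omega>\<in>V' p \<inter> V' q. C \<omega> (Y' p \<omega>) (Y' q \<omega>)} \<in> events"
    and "(\<integral>\<^sup>+\<omega>. U \<omega> * indicator {\<omega>\<in>V' p \<inter> V' q. C \<omega> (Y' p \<omega>) (Y' q \<omega>)} \<omega> \<partial>M) =
      (\<integral>\<^sup>+\<omega>. U \<omega> * (indicator (V' p \<inter> V' q) \<omega> * ennreal (h (fst (Y' p \<omega>)) (fst (Y' q \<omega>)))) \<partial>M)"
proof -
  have A: "V' p \<inter> V' q \<in> sets \<G>" using YV'(4) by auto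
  note * = contention_nn_integral[where J = "{()}" and X = "\<lambda>_. Y' p" and Y = "\<lambda>_. Y' q" and b = "\<lambda>_. True",
      OF _ A YV'(3) YV'(3) _ _ U]
  show "{\<omega>\<in>V' p \<inter> V' q. C \<omega> (Y' p \<omega>) (Y' q \<omega>)} \<in> events"
    using *(1) assms(1) Y'_mem(1) by (simp add: Y'_eq_iff)
  show "(\<integral>\<^sup>+\<omega>. U \<omega> * indicator {\<omega>\<in>V' p \<inter> V' q. C \<omega> (Y' p \<omega>) (Y' q \<omega>)} \<omega> \<partial>M) =
      (\<integral>\<^sup>+\<omega>. U \<omega> * (indicator (V' p \<inter> V' q) \<omega> * ennreal (h (fst (Y' p \<omega>)) (fst (Y' q \<omega>)))) \<partial>M)"
    using *(2) assms(1) Y'_mem(1) by (simp add: Y'_eq_iff link_prob_def)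
qed

end

section \<open>The generating function\<close>

definition weights :: "nat \<Rightarrow> (nat \<Rightarrow> plane \<Rightarrow> real) \<Rightarrow> bool" where
  "weights k u \<longleftrightarrow> (\<forall>j\<le>k. u j \<in> borel_measurable borel \<and> (\<forall>x. 0 \<le> u j x \<and> u j x \<le> 1))"

lemma weightsD:
  assumes "weights k u" "j \<le> k"
  shows "u j \<in> borel_measurable borel" "0 \<le> u j x" "u j x \<le> 1"
  using assms by (auto simp: weights_def)

definition past_product ::
  "('w \<Rightarrow> tpoint set) \<Rightarrow> ('w \<Rightarrow> tpoint \<Rightarrow> tpoint \<Rightarrow> bool) \<Rightarrow> nat \<Rightarrow> real \<Rightarrow> (nat \<Rightarrow> plane \<Rightarrow> real) \<Rightarrow> 'w \<Rightarrow> real" where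
  "past_product \<Phi> C k t u \<omega> = infprod (\<lambda>z. u (level k (\<Phi> \<omega>) (C \<omega>) z) (fst z)) (timers_below t (\<Phi> \<omega>))"

lemma past_product_bounds:
  assumes "weights k u"
  shows "0 \<le> past_product \<Phi> C k t u \<omega>" "past_product \<Phi> C k t u \<omega> \<le> 1"
  unfolding past_product_def by (intro infprod_bounds; simp add: weightsD[OF assms level_le])+

lemma matern_gf_eq:
  assumes "weights k u"
  shows "matern_gf M \<Phi> C k t u = (\<integral>\<omega>. past_product \<Phi> C k t u \<omega> \<partial>M)"
proof -
  have "(\<Prod>j\<le>k. infprod (\<lambda>z. u j (fst z)) (matern_class k j (timers_below t (\<Phi> \<omega>)) (C \<omega>))) =
      past_product \<Phi> C k t u \<omega>" for \<omega>
    unfolding past_product_def using weightsD[OF assms] by (intro prod_infprod_matern_class) auto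
  then show ?thesis unfolding matern_gf_def by simp
qed

locale slab = two_windows M h \<Lambda> \<Phi> C "UNIV \<times> {..<t}" "UNIV \<times> {t..<t + s}" Y Y' V V'
  for M :: "'w measure" and h \<Lambda> \<Phi> C and t s :: real and Y Y' V V' +
  fixes k :: nat
  assumes t: "0 \<le> t" and s: "0 \<le> s"
begin

abbreviation "lev \<omega> z \<equiv> level k (\<Phi> \<omega>) (C \<omega>) z"

abbreviation "P \<equiv> past_product \<Phi> C k t"

section \<open>Measurability of past levels and past products\<close>

lemma timers_below_eq: "timers_below t (\<Phi> \<omega>) = \<Phi> \<omega> \<inter> UNIV \<times> {..<t}"
  by (auto simp: timers_below_def)

lemma snd_Y: "\<omega> \<in> V n \<Longrightarrow> snd (Y n \<omega>) < t"
  using Y_mem(2)[of \<omega> n] by (auto simp: mem_Times_iff)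

lemma snd_Y': "\<omega> \<in> V' n \<Longrightarrow> t \<le> snd (Y' n \<omega>) \<and> snd (Y' n \<omega>) < t + s"
  using Y'_mem(2)[of \<omega> n] by (auto simp: mem_Times_iff)

lemma sets_window_P: "A \<in> sets (window_algebra (UNIV \<times> {..<t})) \<Longrightarrow> A \<in> sets \<P>"
  using subalgebra_\<P>_window by (auto simp: subalgebra_def)

lemma V_P: "V n \<in> sets \<P>" and Y_P: "Y n \<in> \<P> \<rightarrow>\<^sub>M borel"
  using sets_window_P[OF YV(2)] measurable_from_subalg[OF subalgebra_\<P>_window YV(1)] by auto

lemma id_\<P>: "(\<lambda>\<omega>. \<omega>) \<in> M \<rightarrow>\<^sub>M \<P>"
  by (rule measurable_from_subalg[OF subalgebra_\<P>]) simp

text \<open>Retention at \<open>m + 1\<close> fails through some past label that is linked, strictly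
  earlier and retained at \<open>m\<close>: a countable union of events. Strict inequality of timers
  confines the search to past points and excludes \<open>n\<close> itself, a case outside the scope
  of \<open>link_event\<close>.\<close>

lemma retained_event: "{\<omega>\<in>V n. retained (\<Phi> \<omega>) (C \<omega>) m (Y n \<omega>)} \<in> sets \<P>"
proof (induction m arbitrary: n)
  case 0
  then show ?case using V_P by simp
next
  case (Suc m)
  let ?B = "\<lambda>l. {\<omega>\<in>V n \<inter> V l. C \<omega> (Y n \<omega>) (Y l \<omega>)} \<inter> {\<omega>\<in>V l. retained (\<Phi> \<omega>) (C \<omega>) m (Y l \<omega>)} \<inter>
    {\<omega>\<in>space \<P>. snd (Y l \<omega>) < snd (Y n \<omega>)}"
  have "{\<omega>\<in>V n. retained (\<Phi> \<omega>) (C \<omega>) (Suc m) (Y n \<omega>)} = V n - (\<Union>l\<in>UNIV - {n}. ?B l)"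
  proof (intro equalityI subsetI)
    fix \<omega> assume "\<omega> \<in> {\<omega>\<in>V n. retained (\<Phi> \<omega>) (C \<omega>) (Suc m) (Y n \<omega>)}"
    then show "\<omega> \<in> V n - (\<Union>l\<in>UNIV - {n}. ?B l)" using Y_mem(1) by auto
  next
    fix \<omega> assume \<omega>: "\<omega> \<in> V n - (\<Union>l\<in>UNIV - {n}. ?B l)"
    have sp: "\<omega> \<in> space M" using \<omega> V_space by auto
    have "\<not> C \<omega> (Y n \<omega>) w" if w: "w \<in> \<Phi> \<omega>" "snd w < snd (Y n \<omega>)" "retained (\<Phi> \<omega>) (C \<omega>) m w" for w
    proof -
      have "snd w < t" using w(2) snd_Y[of \<omega> n] \<omega> by simp
      then have "w \<in> \<Phi> \<omega> \<inter> UNIV \<times> {..<t}" using w(1) by (simp add: mem_Times_iff)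
      then obtain l where l: "\<omega> \<in> V l" "w = Y l \<omega>" unfolding points(1)[OF sp] by blast
      then have "l \<noteq> n" using w(2) by auto
      then show ?thesis using \<omega> l w sp by auto
    qed
    then show "\<omega> \<in> {\<omega>\<in>V n. retained (\<Phi> \<omega>) (C \<omega>) (Suc m) (Y n \<omega>)}" using \<omega> by auto
  qed
  also have "\<dots> \<in> sets \<P>"
  proof -
    have "(\<lambda>\<omega>. snd (Y l \<omega>)) \<in> borel_measurable \<P>" for l by (intro measurable_snd_tpoint Y_P)
    then have "{\<omega>\<in>space \<P>. snd (Y l \<omega>) < snd (Y n \<omega>)} \<in> sets \<P>" for l
      by (intro borel_measurable_less)
    then have "?B l \<in> sets \<P>" if "l \<in> UNIV - {n}" for l
      using that link_event[of n l] by (intro sets.Int Suc.IH) auto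
    then show ?thesis by (intro sets.Diff V_P sets.countable_UN') auto
  qed
  finally show ?case .
qed

definition at_level :: "nat \<Rightarrow> nat \<Rightarrow> 'w set" where
  "at_level m n = {\<omega>\<in>V n. m \<le> lev \<omega> (Y n \<omega>)}"

lemma at_level_P: "at_level m n \<in> sets \<P>"
proof -
  consider "m = 0" | i where "m = Suc i" "i < k" | "k < m" by (cases m) (auto simp: not_less_eq[symmetric])
  then show ?thesis
  proof cases
    case 1
    then show ?thesis using V_P by (simp add: at_level_def)
  next
    case 2
    then show ?thesis
      using retained_event[of n "level_index k i"] by (simp add: at_level_def Suc_le_eq less_level_iff)
  next
    case 3
    then have "at_level m n = {}"
      unfolding at_level_def using level_le order_trans by (metis (no_types, lifting) empty_Collect_eq not_le)
    then show ?thesis by simp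
  qed
qed

lemma at_level_V: "at_level m n \<subseteq> V n"
  by (auto simp: at_level_def)

definition factor :: "(nat \<Rightarrow> plane \<Rightarrow> real) \<Rightarrow> nat \<Rightarrow> 'w \<Rightarrow> real" where
  "factor u n \<omega> = (if \<omega> \<in> V n then u (lev \<omega> (Y n \<omega>)) (fst (Y n \<omega>)) else 1)"

lemma factor_bounds:
  assumes "weights k u"
  shows "0 \<le> factor u n \<omega>" "factor u n \<omega> \<le> 1"
  using weightsD[OF assms level_le] by (auto simp: factor_def)

lemma prod_factor_bounds:
  assumes "weights k u"
  shows "0 \<le> (\<Prod>n<N. factor u n \<omega>)" "(\<Prod>n<N. factor u n \<omega>) \<le> 1"
  using factor_bounds[OF assms] by (auto intro!: prod_nonneg prod_le_1)

lemma factor_LIMSEQ: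
  assumes u: "weights k u" and \<omega>: "\<omega> \<in> space M"
  shows "(\<lambda>N. \<Prod>n<N. factor u n \<omega>) \<longlonglongrightarrow> P u \<omega>"
proof -
  have "(\<lambda>N. \<Prod>n<N. if n \<in> {n. \<omega> \<in> V n} then (\<lambda>z. u (lev \<omega> z) (fst z)) (Y n \<omega>) else 1) \<longlonglongrightarrow>
      infprod (\<lambda>z. u (lev \<omega> z) (fst z)) (\<Phi> \<omega> \<inter> UNIV \<times> {..<t})"
    by (rule infprod_LIMSEQ[OF points(1,2)[OF \<omega>]]) (simp add: weightsD[OF u level_le])
  then show ?thesis by (simp add: past_product_def timers_below_eq factor_def)
qed

lemma factor_joint_measurable:
  fixes u :: "'b \<Rightarrow> nat \<Rightarrow> plane \<Rightarrow> real"
  assumes u: "\<And>j. j \<le> k \<Longrightarrow> (\<lambda>(x, y). u x j y) \<in> borel_measurable (N \<Otimes>\<^sub>M borel)"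
  shows "(\<lambda>(x, \<omega>). factor (u x) n \<omega>) \<in> borel_measurable (N \<Otimes>\<^sub>M \<P>)"
proof -
  let ?L = "\<lambda>j. at_level j n - at_level (Suc j) n"
  have L: "(\<lambda>x\<omega>. indicator (?L j) (snd x\<omega>) :: real) \<in> borel_measurable (N \<Otimes>\<^sub>M \<P>)" for j
    by (rule measurable_compose[OF measurable_snd]) (use at_level_P in auto)
  have nV: "(\<lambda>x\<omega>. indicator (space \<P> - V n) (snd x\<omega>) :: real) \<in> borel_measurable (N \<Otimes>\<^sub>M \<P>)"
    by (rule measurable_compose[OF measurable_snd])
      (intro borel_measurable_indicator sets.compl_sets V_P)
  have U: "(\<lambda>x\<omega>. u (fst x\<omega>) j (fst (Y n (snd x\<omega>)))) \<in> borel_measurable (N \<Otimes>\<^sub>M \<P>)" if "j \<le> k" for j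
  proof -
    have "(\<lambda>x\<omega>. (fst x\<omega>, fst (Y n (snd x\<omega>)))) \<in> N \<Otimes>\<^sub>M \<P> \<rightarrow>\<^sub>M N \<Otimes>\<^sub>M borel"
      by (intro measurable_Pair measurable_fst measurable_fst_tpoint measurable_compose[OF measurable_snd Y_P])
    from measurable_compose[OF this u[OF that]] show ?thesis by simp
  qed
  have "(\<lambda>x\<omega>. (\<Sum>j\<le>k. indicator (?L j) (snd x\<omega>) * u (fst x\<omega>) j (fst (Y n (snd x\<omega>)))) +
      indicator (space \<P> - V n) (snd x\<omega>)) \<in> borel_measurable (N \<Otimes>\<^sub>M \<P>)"
    by (intro borel_measurable_add borel_measurable_sum borel_measurable_times L nV U) simp
  then show ?thesis
  proof (rule measurable_cong[THEN iffD1, rotated])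
    fix x\<omega> assume "x\<omega> \<in> space (N \<Otimes>\<^sub>M \<P>)"
    then obtain x \<omega> where x: "x\<omega> = (x, \<omega>)" "\<omega> \<in> space M" by (auto simp: space_pair_measure)
    show "(\<Sum>j\<le>k. indicator (?L j) (snd x\<omega>) * u (fst x\<omega>) j (fst (Y n (snd x\<omega>)))) +
      indicator (space \<P> - V n) (snd x\<omega>) = (case x\<omega> of (x, \<omega>) \<Rightarrow> factor (u x) n \<omega>)"
    proof (cases "\<omega> \<in> V n")
      case True
      have "indicator (?L j) \<omega> * u x j (fst (Y n \<omega>)) =
          (if j = lev \<omega> (Y n \<omega>) then u x j (fst (Y n \<omega>)) else 0)" for j
        using True by (auto simp: at_level_def indicator_def)
      then show ?thesis using True level_le[of k "\<Phi> \<omega>" "C \<omega>" "Y n \<omega>"] by (simp add: x factor_def)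
    next
      case False
      then have "indicator (?L j) \<omega> = (0::real)" for j using at_level_V by (auto simp: indicator_def)
      then show ?thesis using False x(2) by (simp add: x(1) factor_def)
    qed
  qed
qed

lemma P_joint_measurable:
  fixes u :: "'b \<Rightarrow> nat \<Rightarrow> plane \<Rightarrow> real"
  assumes u: "\<And>j. j \<le> k \<Longrightarrow> (\<lambda>(x, y). u x j y) \<in> borel_measurable (N \<Otimes>\<^sub>M borel)"
    and w: "\<And>x. x \<in> space N \<Longrightarrow> weights k (u x)"
  shows "(\<lambda>(x, \<omega>). P (u x) \<omega>) \<in> borel_measurable (N \<Otimes>\<^sub>M \<P>)"
proof (rule borel_measurable_LIMSEQ_real)
  fix x\<omega> assume "x\<omega> \<in> space (N \<Otimes>\<^sub>M \<P>)"
  then obtain x \<omega> where x: "x\<omega> = (x, \<omega>)" "x \<in> space N" "\<omega> \<in> space M" by (auto simp: space_pair_measure)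
  show "(\<lambda>i. \<Prod>n<i. case x\<omega> of (x, \<omega>) \<Rightarrow> factor (u x) n \<omega>) \<longlonglongrightarrow> (case x\<omega> of (x, \<omega>) \<Rightarrow> P (u x) \<omega>)"
    using factor_LIMSEQ[OF w[OF x(2)] x(3)] by (simp add: x(1))
qed (intro borel_measurable_prod factor_joint_measurable u)

lemma const_joint_measurable:
  "u \<in> borel_measurable borel \<Longrightarrow> (\<lambda>(x, y). u y) \<in> borel_measurable (N \<Otimes>\<^sub>M borel)"
  unfolding split_beta' by (rule measurable_compose[OF measurable_snd])

lemma P_measurable:
  assumes "weights k u"
  shows "P u \<in> borel_measurable \<P>" "P u \<in> borel_measurable M"
proof -
  \<comment> \<open>A one-point parameter space specialises the joint statement to a fixed
    weight.\<close>
  have "(\<lambda>(x, \<omega>). P u \<omega>) \<in> borel_measurable (count_space {()} \<Otimes>\<^sub>M \<P>)"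
    by (rule P_joint_measurable) (use assms weightsD[OF assms] const_joint_measurable in auto)
  from measurable_compose[OF measurable_Pair1' this, of "()"]
  show "P u \<in> borel_measurable \<P>" by simp
  then show "P u \<in> borel_measurable M" by (rule measurable_from_subalg[OF subalgebra_\<P>])
qed

lemma factor_measurable:
  assumes "weights k u"
  shows "factor u n \<in> borel_measurable \<P>"
proof -
  have "(\<lambda>(x, \<omega>). factor u n \<omega>) \<in> borel_measurable (count_space {()} \<Otimes>\<^sub>M \<P>)"
    by (rule factor_joint_measurable) (use weightsD[OF assms] const_joint_measurable in auto)
  from measurable_compose[OF measurable_Pair1' this, of "()"] show ?thesis by simp
qed

lemma thin_from_joint_measurable:
  assumes "weights k v" "j \<le> k"
  shows "(\<lambda>(x, y). thin_from h m v x j y) \<in> borel_measurable (borel \<Otimes>\<^sub>M borel)"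
proof -
  have v: "(\<lambda>(x, y). v j y) \<in> borel_measurable (borel \<Otimes>\<^sub>M borel)"
    by (rule const_joint_measurable[OF weightsD(1)[OF assms]])
  have vh: "(\<lambda>z. (\<lambda>(x, y). v j y) z * (1 - case_prod h z)) \<in> borel_measurable (borel \<Otimes>\<^sub>M borel)"
    by (intro borel_measurable_times v borel_measurable_diff h_measurable borel_measurable_const)
  show ?thesis
  proof (cases "m \<le> j")
    case True
    then have "(\<lambda>(x, y). thin_from h m v x j y) = (\<lambda>z. (\<lambda>(x, y). v j y) z * (1 - case_prod h z))"
      by (auto simp: fun_eq_iff thin_from_def thin_def)
    then show ?thesis using vh by (simp only:)
  next
    case False
    then have "(\<lambda>(x, y). thin_from h m v x j y) = (\<lambda>(x, y). v j y)"
      by (auto simp: fun_eq_iff thin_from_def)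
    then show ?thesis using v by (simp only:)
  qed
qed

lemma weights_thin_from:
  assumes "weights k v"
  shows "weights k (thin_from h m v x)"
  unfolding weights_def
proof (intro allI impI conjI)
  fix j y assume j: "j \<le> k"
  show "thin_from h m v x j \<in> borel_measurable borel"
    using measurable_compose[OF measurable_Pair1' thin_from_joint_measurable[OF assms j], of x] by simp
  have v: "0 \<le> v j y" "v j y \<le> 1" by (rule weightsD[OF assms j])+
  then have "v j y * (1 - h x y) \<le> 1 * 1" using h_range[of x y] by (intro mult_mono) auto
  then show "0 \<le> thin_from h m v x j y" "thin_from h m v x j y \<le> 1"
    using v h_range[of x y] by (simp_all add: thin_from_def thin_def)
qed

lemma P_thin_measurable:
  assumes "weights k v"
  shows "(\<lambda>(x, \<omega>). P (thin_from h m v x) \<omega>) \<in> borel_measurable (borel \<Otimes>\<^sub>M \<P>)"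
proof (rule P_joint_measurable[where u = "thin_from h m v"])
  show "(\<lambda>(x, y). thin_from h m v x j y) \<in> borel_measurable (borel \<Otimes>\<^sub>M borel)" if "j \<le> k" for j
    by (rule thin_from_joint_measurable[OF assms that])
  show "weights k (thin_from h m v x)" for x by (rule weights_thin_from[OF assms])
qed

lemma P_bounds: "weights k u \<Longrightarrow> 0 \<le> P u \<omega>" "weights k u \<Longrightarrow> P u \<omega> \<le> 1"
  by (rule past_product_bounds; assumption)+

lemma gf_thin_measurable:
  assumes "weights k v"
  shows "(\<lambda>x. matern_gf M \<Phi> C k t (thin_from h m v x)) \<in> borel_measurable borel"
    and "ennreal (matern_gf M \<Phi> C k t (thin_from h m v x)) = (\<integral>\<^sup>+\<omega>. ennreal (P (thin_from h m v x) \<omega>) \<partial>M)"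
    and "0 \<le> matern_gf M \<Phi> C k t (thin_from h m v x)" "matern_gf M \<Phi> C k t (thin_from h m v x) \<le> 1"
proof -
  note w = weights_thin_from[OF assms]
  have "(\<lambda>z. (fst z, snd z)) \<in> (borel :: plane measure) \<Otimes>\<^sub>M M \<rightarrow>\<^sub>M borel \<Otimes>\<^sub>M \<P>"
    by (rule measurable_Pair[OF measurable_fst measurable_compose[OF measurable_snd id_\<P>]])
  from measurable_compose[OF this P_thin_measurable[OF assms]]
  have "(\<lambda>(x, \<omega>). P (thin_from h m v x) \<omega>) \<in> borel_measurable (borel \<Otimes>\<^sub>M M)" by simp
  then show "(\<lambda>x. matern_gf M \<Phi> C k t (thin_from h m v x)) \<in> borel_measurable borel"
    unfolding matern_gf_eq[OF w] by (rule borel_measurable_lebesgue_integral)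
  have "\<bar>P (thin_from h m v x) \<omega>\<bar> \<le> 1" for \<omega>
    using P_bounds[OF w] by (simp add: abs_of_nonneg)
  then have "integrable M (P (thin_from h m v x))"
    using P_measurable(2)[OF w] by (intro integrable_const_bound[of _ 1]) auto
  then show "ennreal (matern_gf M \<Phi> C k t (thin_from h m v x)) = (\<integral>\<^sup>+\<omega>. ennreal (P (thin_from h m v x) \<omega>) \<partial>M)"
    unfolding matern_gf_eq[OF w] using P_bounds[OF w]
    by (intro nn_integral_eq_integral[symmetric]) auto
  show "0 \<le> matern_gf M \<Phi> C k t (thin_from h m v x)"
    unfolding matern_gf_eq[OF w] using P_bounds[OF w] by simp
  show "matern_gf M \<Phi> C k t (thin_from h m v x) \<le> 1"
    unfolding matern_gf_eq[OF w] using P_bounds[OF w]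
    by (intro integral_le_const \<open>integrable M _\<close>) auto
qed

text \<open>For \<open>m = level_threshold k i\<close> this is the event that the new point would
  have class above \<open>i\<close> if it were the only new one; for \<open>m = Suc k\<close> it is
  all of \<open>V' p\<close>.\<close>

definition isolated :: "nat \<Rightarrow> nat \<Rightarrow> 'w set" where
  "isolated m p = {\<omega>\<in>V' p. \<forall>i. \<omega> \<in> at_level m i \<longrightarrow> \<not> C \<omega> (Y' p \<omega>) (Y i \<omega>)}"

lemma isolated_event: "isolated m p \<in> events"
proof -
  have "at_level m i \<in> sets \<H>" for i
    using at_level_P subalgebra_\<H>_\<P> by (auto simp: subalgebra_def)
  then have "{\<omega>\<in>V' p. \<forall>i<N. \<omega> \<in> at_level m i \<longrightarrow> \<not> C \<omega> (Y' p \<omega>) (Y i \<omega>)} \<in> events" for N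
    by (rule fresh(2)[where Sel = "at_level m", OF borel_measurable_const[of 0] _ at_level_V])
  then have "(\<Inter>N. {\<omega>\<in>V' p. \<forall>i<N. \<omega> \<in> at_level m i \<longrightarrow> \<not> C \<omega> (Y' p \<omega>) (Y i \<omega>)}) \<in> events"
    by (intro sets.countable_INT) blast+
  moreover have "isolated m p = (\<Inter>N. {\<omega>\<in>V' p. \<forall>i<N. \<omega> \<in> at_level m i \<longrightarrow> \<not> C \<omega> (Y' p \<omega>) (Y i \<omega>)})"
    by (auto simp: isolated_def)
  ultimately show ?thesis by (simp only:)
qed

text \<open>Integrating out the links of the new point turns each absent link to a past point of
  level at least \<open>m\<close> into a factor \<open>1 - h\<close>; merged with the weight of that
  point it becomes \<open>thin_from\<close>. Truncation to \<open>N\<close> labels makes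
  \<open>fresh\<close> applicable, and both sides converge under the constant bound 1.\<close>

lemma fresh_limit:
  assumes v: "weights k v" and b: "b \<in> borel_measurable borel" "\<And>x. 0 \<le> b x \<and> b x \<le> 1"
  shows "(\<integral>\<^sup>+\<omega>. indicator (isolated m p) \<omega> * ennreal (b (fst (Y' p \<omega>)) * P v \<omega>) \<partial>M) =
    (\<integral>\<^sup>+\<omega>. indicator (V' p) \<omega> * ennreal (b (fst (Y' p \<omega>)) * P (thin_from h m v (fst (Y' p \<omega>))) \<omega>) \<partial>M)"
proof -
  let ?b = "\<lambda>\<omega>. b (fst (Y' p \<omega>))"
  let ?F = "\<lambda>N. {\<omega>\<in>V' p. \<forall>i<N. \<omega> \<in> at_level m i \<longrightarrow> \<not> C \<omega> (Y' p \<omega>) (Y i \<omega>)}"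
  let ?U = "\<lambda>N \<omega>. ennreal (?b \<omega> * (\<Prod>n<N. factor v n \<omega>))"
  let ?u = "\<lambda>\<omega>. thin_from h m v (fst (Y' p \<omega>))"
  note w = weights_thin_from[OF v]
  have Sel: "at_level m i \<in> sets \<H>" for i
    using at_level_P subalgebra_\<H>_\<P> by (auto simp: subalgebra_def)
  have bG: "?b \<in> borel_measurable \<G>"
    by (rule measurable_compose[OF measurable_fst_tpoint[OF YV'(3)] b(1)])
  have UH: "?U N \<in> borel_measurable \<H>" for N
    using measurable_from_subalg[OF subalgebra_\<H>_\<P> factor_measurable[OF v]]
      measurable_from_subalg[OF subalgebra_\<H>_\<G> bG]
    by (intro measurable_compose[OF _ measurable_ennreal] borel_measurable_times borel_measurable_prod)
  have eq: "(\<integral>\<^sup>+\<omega>. ?U N \<omega> * indicator (?F N) \<omega> \<partial>M) =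
      (\<integral>\<^sup>+\<omega>. indicator (V' p) \<omega> * ennreal (?b \<omega> * (\<Prod>n<N. factor (?u \<omega>) n \<omega>)) \<partial>M)" for N
  proof -
    have "(\<integral>\<^sup>+\<omega>. ?U N \<omega> * indicator (?F N) \<omega> \<partial>M) = (\<integral>\<^sup>+\<omega>. ?U N \<omega> * (indicator (V' p) \<omega> *
      ennreal (\<Prod>i<N. if \<omega> \<in> at_level m i then link_prob False (Y' p \<omega>) (Y i \<omega>) else 1)) \<partial>M)"
      by (rule fresh(1)[OF UH Sel at_level_V])
    also have "\<dots> = (\<integral>\<^sup>+\<omega>. indicator (V' p) \<omega> * ennreal (?b \<omega> * (\<Prod>n<N. factor (?u \<omega>) n \<omega>)) \<partial>M)"
    proof (rule nn_integral_cong)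
      fix \<omega>
      \<comment> \<open>The past points tested for links are those of level at least
        \<open>m\<close>, and \<open>thin_from\<close> changes exactly the weights from index
        \<open>m\<close> on, so the two selections match point by point.\<close>
      have "factor (?u \<omega>) n \<omega> = factor v n \<omega> *
          (if \<omega> \<in> at_level m n then link_prob False (Y' p \<omega>) (Y n \<omega>) else 1)" for n
        by (simp add: factor_def at_level_def thin_from_def thin_def link_prob_def)
      then have "?b \<omega> * (\<Prod>n<N. factor (?u \<omega>) n \<omega>) = (?b \<omega> * (\<Prod>n<N. factor v n \<omega>)) *
          (\<Prod>i<N. if \<omega> \<in> at_level m i then link_prob False (Y' p \<omega>) (Y i \<omega>) else 1)"
        by (simp add: prod.distrib)
      moreover have "0 \<le> ?b \<omega> * (\<Prod>n<N. factor v n \<omega>)"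
        using b(2) prod_factor_bounds[OF v] by simp
      ultimately have "ennreal (?b \<omega> * (\<Prod>n<N. factor (?u \<omega>) n \<omega>)) = ?U N \<omega> *
          ennreal (\<Prod>i<N. if \<omega> \<in> at_level m i then link_prob False (Y' p \<omega>) (Y i \<omega>) else 1)"
        by (simp only: ennreal_mult')
      then show "?U N \<omega> * (indicator (V' p) \<omega> *
          ennreal (\<Prod>i<N. if \<omega> \<in> at_level m i then link_prob False (Y' p \<omega>) (Y i \<omega>) else 1)) =
          indicator (V' p) \<omega> * ennreal (?b \<omega> * (\<Prod>n<N. factor (?u \<omega>) n \<omega>))"
        by (simp only: mult_ac)
    qed
    finally show ?thesis .
  qed
  have one: "(\<integral>\<^sup>+\<omega>. 1 \<partial>M) < \<infinity>" by (simp add: emeasure_space_1)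
  have bnd: "ennreal (?b \<omega> * r) \<le> 1" if "r \<le> 1" "0 \<le> r" for \<omega> r
    using b(2) that mult_le_one[of "?b \<omega>" r] by (simp add: ennreal_le_1)
  have bM: "?b \<in> borel_measurable M" by (rule measurable_from_subalg[OF subalgebra_\<G> bG])
  have pairM: "(\<lambda>\<omega>. (fst (Y' p \<omega>), \<omega>)) \<in> M \<rightarrow>\<^sub>M borel \<Otimes>\<^sub>M \<P>"
    by (rule measurable_Pair[OF measurable_fst_tpoint[OF YV'(5)] id_\<P>])
  have L1: "(\<lambda>N. \<integral>\<^sup>+\<omega>. ?U N \<omega> * indicator (?F N) \<omega> \<partial>M) \<longlonglongrightarrow>
      (\<integral>\<^sup>+\<omega>. ennreal (?b \<omega> * P v \<omega>) * indicator (isolated m p) \<omega> \<partial>M)"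
  proof (rule nn_integral_dominated_convergence[where w = "\<lambda>_. 1"])
    show "(\<lambda>\<omega>. ?U N \<omega> * indicator (?F N) \<omega>) \<in> borel_measurable M" for N
      by (rule borel_measurable_times_ennreal[OF measurable_from_subalg[OF subalgebra_\<H> UH]
            borel_measurable_indicator[OF fresh(2)[where Sel = "at_level m", OF borel_measurable_const[of 0] Sel at_level_V]]])
    show "(\<lambda>\<omega>. ennreal (?b \<omega> * P v \<omega>) * indicator (isolated m p) \<omega>) \<in> borel_measurable M"
      using bM P_measurable(2)[OF v] isolated_event
      by (intro borel_measurable_times_ennreal borel_measurable_indicator measurable_compose[OF _ measurable_ennreal] borel_measurable_times)
    show "AE \<omega> in M. ?U N \<omega> * indicator (?F N) \<omega> \<le> 1" for N
      using bnd[OF prod_factor_bounds(2,1)[OF v]] by (intro AE_I2) (auto simp: indicator_def)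
    show "AE \<omega> in M. (\<lambda>N. ?U N \<omega> * indicator (?F N) \<omega>) \<longlonglongrightarrow> ennreal (?b \<omega> * P v \<omega>) * indicator (isolated m p) \<omega>"
    proof (rule AE_I2)
      fix \<omega> assume \<omega>: "\<omega> \<in> space M"
      have U: "(\<lambda>N. ?U N \<omega>) \<longlonglongrightarrow> ennreal (?b \<omega> * P v \<omega>)"
        by (intro tendsto_ennrealI tendsto_mult tendsto_const factor_LIMSEQ[OF v \<omega>])
      show "(\<lambda>N. ?U N \<omega> * indicator (?F N) \<omega>) \<longlonglongrightarrow> ennreal (?b \<omega> * P v \<omega>) * indicator (isolated m p) \<omega>"
      proof (cases "\<omega> \<in> isolated m p")
        case True
        then have "\<omega> \<in> ?F N" for N by (simp add: isolated_def)
        then show ?thesis using U True by simp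
      next
        case False
        \<comment> \<open>A past label that blocks the new point is taken into account from some
          \<open>N\<close> on; the truncated events decrease to \<open>isolated m p\<close>.\<close>
        have "\<forall>\<^sub>F N in sequentially. \<omega> \<notin> ?F N"
        proof (cases "\<omega> \<in> V' p")
          case True
          then obtain i where "\<omega> \<in> at_level m i" "C \<omega> (Y' p \<omega>) (Y i \<omega>)" using False by (auto simp: isolated_def)
          then show ?thesis unfolding eventually_sequentially by (intro exI[of _ "Suc i"]) (auto simp: Suc_le_eq)
        qed simp
        then have "\<forall>\<^sub>F N in sequentially. ?U N \<omega> * indicator (?F N) \<omega> = 0"
          by (rule eventually_mono) simp
        then show ?thesis using False by (simp add: tendsto_eventually)
      qed
    qed
  qed (use one in auto)
  have L2: "(\<lambda>N. \<integral>\<^sup>+\<omega>. indicator (V' p) \<omega> * ennreal (?b \<omega> * (\<Prod>n<N. factor (?u \<omega>) n \<omega>)) \<partial>M) \<longlonglongrightarrow>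
      (\<integral>\<^sup>+\<omega>. indicator (V' p) \<omega> * ennreal (?b \<omega> * P (?u \<omega>) \<omega>) \<partial>M)"
  proof (rule nn_integral_dominated_convergence[where w = "\<lambda>_. 1"])
    have "(\<lambda>\<omega>. factor (?u \<omega>) n \<omega>) \<in> borel_measurable M" for n
      using measurable_compose[OF pairM factor_joint_measurable[OF thin_from_joint_measurable[OF v, where m = m], where n = n]] by simp
    then show "(\<lambda>\<omega>. indicator (V' p) \<omega> * ennreal (?b \<omega> * (\<Prod>n<N. factor (?u \<omega>) n \<omega>))) \<in> borel_measurable M" for N
      using bM by (intro borel_measurable_times_ennreal borel_measurable_indicator YV'(6)
        measurable_compose[OF _ measurable_ennreal] borel_measurable_times borel_measurable_prod)
    have "(\<lambda>\<omega>. P (?u \<omega>) \<omega>) \<in> borel_measurable M"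
      using measurable_compose[OF pairM P_thin_measurable[OF v]] by simp
    then show "(\<lambda>\<omega>. indicator (V' p) \<omega> * ennreal (?b \<omega> * P (?u \<omega>) \<omega>)) \<in> borel_measurable M"
      using bM by (intro borel_measurable_times_ennreal borel_measurable_indicator YV'(6)
        measurable_compose[OF _ measurable_ennreal] borel_measurable_times)
    show "AE \<omega> in M. indicator (V' p) \<omega> * ennreal (?b \<omega> * (\<Prod>n<N. factor (?u \<omega>) n \<omega>)) \<le> 1" for N
      using bnd[OF prod_factor_bounds(2,1)[OF w]] by (intro AE_I2) (auto simp: indicator_def)
    show "AE \<omega> in M. (\<lambda>N. indicator (V' p) \<omega> * ennreal (?b \<omega> * (\<Prod>n<N. factor (?u \<omega>) n \<omega>))) \<longlonglongrightarrow>
        indicator (V' p) \<omega> * ennreal (?b \<omega> * P (?u \<omega>) \<omega>)"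
    proof (rule AE_I2)
      fix \<omega> assume \<omega>: "\<omega> \<in> space M"
      have "(\<lambda>N. ennreal (?b \<omega> * (\<Prod>n<N. factor (?u \<omega>) n \<omega>))) \<longlonglongrightarrow> ennreal (?b \<omega> * P (?u \<omega>) \<omega>)"
        by (intro tendsto_ennrealI tendsto_mult tendsto_const factor_LIMSEQ[OF w \<omega>])
      then show "(\<lambda>N. indicator (V' p) \<omega> * ennreal (?b \<omega> * (\<Prod>n<N. factor (?u \<omega>) n \<omega>))) \<longlonglongrightarrow>
        indicator (V' p) \<omega> * ennreal (?b \<omega> * P (?u \<omega>) \<omega>)"
        by (cases "\<omega> \<in> V' p") simp_all
    qed
  qed (use one in auto)
  have "(\<integral>\<^sup>+\<omega>. ennreal (?b \<omega> * P v \<omega>) * indicator (isolated m p) \<omega> \<partial>M) =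
      (\<integral>\<^sup>+\<omega>. indicator (V' p) \<omega> * ennreal (?b \<omega> * P (?u \<omega>) \<omega>) \<partial>M)"
    using LIMSEQ_unique[OF L1[unfolded eq] L2] .
  then show ?thesis by (simp only: mult.commute)
qed

text \<open>Here \<open>b\<close> will be a deficit \<open>1 - v j\<close>; the right-hand side is
  then \<open>s\<close> times one of the integrals from which the derivative is assembled.\<close>

lemma isolated_sum:
  assumes v: "weights k v" and b: "b \<in> borel_measurable borel" "\<And>x. 0 \<le> b x \<and> b x \<le> 1"
  shows "(\<integral>\<^sup>+p. (\<integral>\<^sup>+\<omega>. indicator (isolated m p) \<omega> * ennreal (b (fst (Y' p \<omega>)) * P v \<omega>) \<partial>M) \<partial>count_space UNIV) =
    ennreal s * (\<integral>\<^sup>+x. ennreal (b x * matern_gf M \<Phi> C k t (thin_from h m v x)) \<partial>\<Lambda>)"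
proof -
  let ?f = "\<lambda>z :: tpoint \<times> 'w. ennreal (b (fst (fst z)) * P (thin_from h m v (fst (fst z))) (snd z))"
  have "(\<lambda>z. (fst (fst z), snd z)) \<in> (borel :: tpoint measure) \<Otimes>\<^sub>M \<P> \<rightarrow>\<^sub>M borel \<Otimes>\<^sub>M \<P>"
    by (rule measurable_Pair[OF measurable_fst_tpoint[OF measurable_fst] measurable_snd])
  from measurable_compose[OF this P_thin_measurable[OF v]]
  have "(\<lambda>z. P (thin_from h m v (fst (fst z))) (snd z)) \<in> borel_measurable ((borel :: tpoint measure) \<Otimes>\<^sub>M \<P>)" by simp
  moreover have "(\<lambda>z. b (fst (fst z))) \<in> borel_measurable ((borel :: tpoint measure) \<Otimes>\<^sub>M \<P>)"
    by (rule measurable_compose[OF measurable_fst_tpoint[OF measurable_fst] b(1)])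
  ultimately have f: "?f \<in> borel_measurable (borel \<Otimes>\<^sub>M \<P>)"
    by (intro measurable_compose[OF _ measurable_ennreal] borel_measurable_times)
  have bg: "(\<lambda>x. ennreal (b x * matern_gf M \<Phi> C k t (thin_from h m v x))) \<in> borel_measurable borel"
    by (intro measurable_compose[OF _ measurable_ennreal] borel_measurable_times b(1) gf_thin_measurable(1)[OF v])
  have "(\<integral>\<^sup>+p. (\<integral>\<^sup>+\<omega>. indicator (isolated m p) \<omega> * ennreal (b (fst (Y' p \<omega>)) * P v \<omega>) \<partial>M) \<partial>count_space UNIV) =
      (\<integral>\<^sup>+p. (\<integral>\<^sup>+\<omega>. indicator (V' p) \<omega> * ?f (Y' p \<omega>, \<omega>) \<partial>M) \<partial>count_space UNIV)"
    unfolding fresh_limit[OF v b] by simp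
  also have "\<dots> = (\<integral>\<^sup>+z. (\<integral>\<^sup>+\<omega>. ?f (z, \<omega>) \<partial>M) \<partial>intensity (UNIV \<times> {t..<t + s}))"
    by (rule campbell[OF f])
  also have "\<dots> = (\<integral>\<^sup>+z. ennreal (b (fst z) * matern_gf M \<Phi> C k t (thin_from h m v (fst z))) \<partial>intensity (UNIV \<times> {t..<t + s}))"
  proof (rule nn_integral_cong)
    fix z :: tpoint
    have "(\<integral>\<^sup>+\<omega>. ?f (z, \<omega>) \<partial>M) = (\<integral>\<^sup>+\<omega>. ennreal (b (fst z)) * ennreal (P (thin_from h m v (fst z)) \<omega>) \<partial>M)"
      using b(2) by (simp add: ennreal_mult')
    also have "\<dots> = ennreal (b (fst z)) * (\<integral>\<^sup>+\<omega>. ennreal (P (thin_from h m v (fst z)) \<omega>) \<partial>M)"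
      by (intro nn_integral_cmult measurable_compose[OF _ measurable_ennreal] P_measurable(2) weights_thin_from v)
    finally show "(\<integral>\<^sup>+\<omega>. ?f (z, \<omega>) \<partial>M) = ennreal (b (fst z) * matern_gf M \<Phi> C k t (thin_from h m v (fst z)))"
      using b(2) by (simp add: gf_thin_measurable(2)[OF v, symmetric] ennreal_mult')
  qed
  also have "\<dots> = ennreal s * (\<integral>\<^sup>+x. ennreal (b x * matern_gf M \<Phi> C k t (thin_from h m v x)) \<partial>\<Lambda>)"
    by (rule nn_integral_intensity_slab[OF t s bg])
  finally show ?thesis .
qed

end

section \<open>First-order expansion in time\<close>

text \<open>The first two Bonferroni inequalities, for numbers in the unit interval in place of
  events.\<close>

lemma prod_one_minus_expansion:
  fixes a :: "nat \<Rightarrow> real"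
  assumes "\<And>p. 0 \<le> a p \<and> a p \<le> 1"
  shows "1 - (\<Sum>p<N. a p) \<le> (\<Prod>p<N. 1 - a p)" (is "?A N")
    and "(\<Prod>p<N. 1 - a p) \<le> 1 - (\<Sum>p<N. a p) + (\<Sum>p<N. \<Sum>q<p. a p * a q)" (is "?B N")
proof -
  have A: "?A N" for N
  proof (induction N)
    case (Suc N)
    have "(\<Prod>p<N. 1 - a p) * a N \<le> 1 * a N"
      using assms by (intro mult_right_mono prod_le_1) auto
    then show ?case using Suc by (simp add: algebra_simps)
  qed simp
  show "?A N" by (rule A)
  show "?B N"
  proof (induction N)
    case (Suc N)
    have "a N * (1 - (\<Sum>p<N. a p)) \<le> a N * (\<Prod>p<N. 1 - a p)"
      using assms by (intro mult_left_mono A) auto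
    then show ?case using Suc by (simp add: algebra_simps sum_distrib_left)
  qed simp
qed

text \<open>The expansion at \<open>t\<close> gives the right derivative; from the left one expands at \<open>y < t\<close> and
  uses the continuity of \<open>F\<close>.\<close>

lemma has_derivative_from_right_expansion:
  fixes g F :: "real \<Rightarrow> real"
  assumes g: "\<And>t s. 0 \<le> t \<Longrightarrow> 0 \<le> s \<Longrightarrow> \<bar>g (t + s) - g t - s * F t\<bar> \<le> K * s\<^sup>2"
    and F: "\<And>t s. 0 \<le> t \<Longrightarrow> 0 \<le> s \<Longrightarrow> \<bar>F (t + s) - F t\<bar> \<le> L * s"
    and t: "0 \<le> t"
  shows "(g has_real_derivative F t) (at t within {0..})"
proof -
  \<comment> \<open>An absolute value is bounded by \<open>L * 1\<close>. The sign allows both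
    one-sided estimates to be stated with the common constant \<open>K + L\<close>.\<close>
  have L: "0 \<le> L" using F[of 0 1] by simp
  have quotient: "\<bar>x / d - f\<bar> = \<bar>x - d * f\<bar> / d" if "d > 0" for x d f :: real
  proof -
    have "x / d - f = (x - d * f) / d" using that by (simp add: diff_divide_distrib)
    then show ?thesis using that by (simp add: abs_divide)
  qed
  have bound: "\<bar>(g y - g t) / (y - t) - F t\<bar> \<le> (K + L) * \<bar>y - t\<bar>" if y: "0 \<le> y" "y \<noteq> t" for y
  proof (cases "t < y")
    case True
    define d where "d = y - t"
    have d: "d > 0" "y = t + d" using True by (auto simp: d_def)
    have "\<bar>(g y - g t) / d - F t\<bar> = \<bar>g (t + d) - g t - d * F t\<bar> / d"
      using d by (simp add: quotient)
    also have "\<dots> \<le> K * d\<^sup>2 / d" using g[OF t, of d] d by (intro divide_right_mono) auto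
    also have "\<dots> = K * d" using d by (simp add: power2_eq_square)
    also have "\<dots> \<le> (K + L) * d" using d L by (intro mult_right_mono) auto
    finally show ?thesis using d by simp
  next
    case False
    define d where "d = t - y"
    have d: "d > 0" "t = y + d" using False y by (auto simp: d_def)
    have "(g y - g t) / (y - t) = (g t - g y) / d" using d by (simp add: field_simps)
    then have "\<bar>(g y - g t) / (y - t) - F t\<bar> = \<bar>((g t - g y) / d - F y) - (F t - F y)\<bar>" by simp
    also have "\<dots> \<le> \<bar>(g t - g y) / d - F y\<bar> + \<bar>F t - F y\<bar>" by (rule abs_triangle_ineq4)
    also have "\<bar>(g t - g y) / d - F y\<bar> = \<bar>g (y + d) - g y - d * F y\<bar> / d"
      using d by (simp add: quotient)
    also have "\<dots> \<le> K * d\<^sup>2 / d" using g[OF y(1), of d] d by (intro divide_right_mono) auto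
    also have "\<dots> = K * d" using d by (simp add: power2_eq_square)
    also have "\<bar>F t - F y\<bar> \<le> L * d" using F[OF y(1), of d] d by simp
    finally show ?thesis using d by (simp add: algebra_simps)
  qed
  have "((\<lambda>y. (K + L) * \<bar>y - t\<bar>) \<longlongrightarrow> (K + L) * \<bar>t - t\<bar>) (at t within {0..})"
    by (intro tendsto_intros)
  then have lim: "((\<lambda>y. (K + L) * \<bar>y - t\<bar>) \<longlongrightarrow> 0) (at t within {0..})" by simp
  have "((\<lambda>y. (g y - g t) / (y - t) - F t) \<longlongrightarrow> 0) (at t within {0..})"
    by (rule Lim_null_comparison[OF _ lim])
      (use bound in \<open>auto simp: eventually_at_filter intro!: always_eventually\<close>)
  then have "((\<lambda>y. (g y - g t) / (y - t)) \<longlongrightarrow> F t) (at t within {0..})"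
    by (simp add: LIM_zero_iff)
  then show ?thesis by (simp add: has_field_derivative_iff)
qed

lemma nn_integral_count_space_nat_LIMSEQ:
  fixes f :: "nat \<Rightarrow> real"
  assumes "\<And>n. 0 \<le> f n" "(\<integral>\<^sup>+n. ennreal (f n) \<partial>count_space UNIV) < \<infinity>"
  shows "(\<lambda>N. \<Sum>n<N. f n) \<longlonglongrightarrow> enn2real (\<integral>\<^sup>+n. ennreal (f n) \<partial>count_space UNIV)"
proof -
  have "(\<Sum>n. ennreal (f n)) \<noteq> \<top>" using assms(2) by (simp add: nn_integral_count_space_nat)
  then have sm: "summable f" using assms(1) by (intro summable_suminf_not_top) auto
  then have "(\<Sum>n. ennreal (f n)) = ennreal (suminf f)" using assms(1) by (intro suminf_ennreal2) auto
  then have "enn2real (\<integral>\<^sup>+n. ennreal (f n) \<partial>count_space UNIV) = suminf f"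
    using assms(1) sm by (simp add: nn_integral_count_space_nat suminf_nonneg)
  then show ?thesis using summable_LIMSEQ[OF sm] by simp
qed

lemma sum_le_nn_integral_count_space_nat:
  fixes f :: "nat \<Rightarrow> ennreal"
  shows "(\<Sum>n<N. f n) \<le> (\<integral>\<^sup>+n. f n \<partial>count_space UNIV)"
  unfolding nn_integral_count_space_nat by (rule sum_le_suminf) auto

text \<open>It dominates the deficit of a point whatever its class, hence independently of all
  links. Its integral over \<open>\<Lambda>\<close> is the source of the constant
  \<open>B\<close>.\<close>

definition total_defect :: "nat \<Rightarrow> (nat \<Rightarrow> plane \<Rightarrow> real) \<Rightarrow> plane \<Rightarrow> real" where
  "total_defect k u x = (\<Sum>j\<le>k. 1 - u j x)"

lemma total_defect_ge:
  assumes "weights k u" "j \<le> k"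
  shows "1 - u j x \<le> total_defect k u x"
  unfolding total_defect_def
  using weightsD[OF assms(1)] assms(2) by (intro member_le_sum) auto

lemma total_defect_nonneg: "weights k u \<Longrightarrow> 0 \<le> total_defect k u x"
  unfolding total_defect_def using weightsD by (intro sum_nonneg) auto

lemma total_defect_measurable: "weights k u \<Longrightarrow> total_defect k u \<in> borel_measurable borel"
  unfolding total_defect_def[abs_def] using weightsD(1)
  by (intro borel_measurable_sum borel_measurable_diff) auto

context slab
begin

section \<open>Deficits of the new points\<close>

lemma new_points_sum:
  assumes b: "b \<in> borel_measurable borel"
  shows "(\<integral>\<^sup>+p. (\<integral>\<^sup>+\<omega>. indicator (V' p) \<omega> * b (fst (Y' p \<omega>)) \<partial>M) \<partial>count_space UNIV) =
    ennreal s * (\<integral>\<^sup>+x. b x \<partial>\<Lambda>)"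
proof -
  have "(\<lambda>z. b (fst (fst z))) \<in> borel_measurable ((borel :: tpoint measure) \<Otimes>\<^sub>M \<P>)"
    by (rule measurable_compose[OF measurable_fst_tpoint[OF measurable_fst] b])
  from campbell[OF this] show ?thesis
    using nn_integral_intensity_slab[OF t s b] by (simp add: emeasure_space_1)
qed

definition new_product :: "(nat \<Rightarrow> plane \<Rightarrow> real) \<Rightarrow> 'w \<Rightarrow> real" where
  "new_product v \<omega> = infprod (\<lambda>z. v (lev \<omega> z) (fst z)) (\<Phi> \<omega> \<inter> UNIV \<times> {t..<t + s})"

text \<open>\<open>past_defect\<close> is the deficit that a new point would have if there were no other new points.\<close>

definition defect :: "(nat \<Rightarrow> plane \<Rightarrow> real) \<Rightarrow> nat \<Rightarrow> 'w \<Rightarrow> real" where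
  "defect v p \<omega> = (if \<omega> \<in> V' p then 1 - v (lev \<omega> (Y' p \<omega>)) (fst (Y' p \<omega>)) else 0)"

definition past_defect :: "(nat \<Rightarrow> plane \<Rightarrow> real) \<Rightarrow> nat \<Rightarrow> 'w \<Rightarrow> real" where
  "past_defect v p \<omega> = (if \<omega> \<in> V' p
     then 1 - v (level k (timers_below t (\<Phi> \<omega>)) (C \<omega>) (Y' p \<omega>)) (fst (Y' p \<omega>)) else 0)"

lemma defect_bounds:
  assumes "weights k v"
  shows "0 \<le> defect v p \<omega> \<and> defect v p \<omega> \<le> 1"
    and "defect v p \<omega> \<le> indicator (V' p) \<omega> * total_defect k v (fst (Y' p \<omega>))"
  using weightsD[OF assms level_le] total_defect_ge[OF assms level_le]
  by (auto simp: defect_def)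

lemma past_product_add:
  assumes "weights k v"
  shows "past_product \<Phi> C k (t + s) v \<omega> = P v \<omega> * new_product v \<omega>"
proof -
  have "timers_below (t + s) (\<Phi> \<omega>) = timers_below t (\<Phi> \<omega>) \<union> \<Phi> \<omega> \<inter> UNIV \<times> {t..<t + s}"
    using s by (auto simp: timers_below_def)
  moreover have "timers_below t (\<Phi> \<omega>) \<inter> (\<Phi> \<omega> \<inter> UNIV \<times> {t..<t + s}) = {}"
    by (auto simp: timers_below_def)
  ultimately show ?thesis
    using weightsD[OF assms level_le] unfolding past_product_def new_product_def
    by (simp add: infprod_Un_disjoint)
qed

lemma new_product_bounds:
  assumes "weights k v"
  shows "0 \<le> new_product v \<omega>" "new_product v \<omega> \<le> 1"
  unfolding new_product_def by (intro infprod_bounds; simp add: weightsD[OF assms level_le])+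

lemma new_product_LIMSEQ:
  assumes v: "weights k v" and \<omega>: "\<omega> \<in> space M"
  shows "(\<lambda>N. \<Prod>p<N. 1 - defect v p \<omega>) \<longlonglongrightarrow> new_product v \<omega>"
proof -
  have "(\<lambda>N. \<Prod>n<N. if n \<in> {n. \<omega> \<in> V' n} then (\<lambda>z. v (lev \<omega> z) (fst z)) (Y' n \<omega>) else 1) \<longlonglongrightarrow>
      infprod (\<lambda>z. v (lev \<omega> z) (fst z)) (\<Phi> \<omega> \<inter> UNIV \<times> {t..<t + s})"
    by (rule infprod_LIMSEQ[OF points(3,4)[OF \<omega>]]) (simp add: weightsD[OF v level_le])
  moreover have "(if n \<in> {n. \<omega> \<in> V' n} then (\<lambda>z. v (lev \<omega> z) (fst z)) (Y' n \<omega>) else 1) = 1 - defect v n \<omega>" for n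
    by (simp add: defect_def)
  ultimately show ?thesis unfolding new_product_def by simp
qed

text \<open>The two products differ by the factor of the new points, and 1 minus a product is at
  most the sum of the deficits. Applied to thinned weights, this yields the Lipschitz bound for the
  right-hand side of the differential equation.\<close>

lemma past_product_Lipschitz:
  assumes v: "weights k v" and B: "(\<integral>\<^sup>+x. ennreal (total_defect k v x) \<partial>\<Lambda>) \<le> ennreal B" "0 \<le> B"
  shows "(\<integral>\<^sup>+\<omega>. ennreal \<bar>past_product \<Phi> C k (t + s) v \<omega> - P v \<omega>\<bar> \<partial>M) \<le> ennreal (s * B)"
proof -
  let ?f = "\<lambda>p \<omega>. indicator (V' p) \<omega> * ennreal (total_defect k v (fst (Y' p \<omega>)))"
  have td: "(\<lambda>x. ennreal (total_defect k v x)) \<in> borel_measurable borel"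
    using total_defect_measurable[OF v] by simp
  have fM: "?f p \<in> borel_measurable M" for p
    by (intro borel_measurable_times_ennreal borel_measurable_indicator YV'(6)
        measurable_compose[OF measurable_fst_tpoint[OF YV'(5)] td])
  have "ennreal \<bar>past_product \<Phi> C k (t + s) v \<omega> - P v \<omega>\<bar> \<le> (\<integral>\<^sup>+p. ?f p \<omega> \<partial>count_space UNIV)"
    if \<omega>: "\<omega> \<in> space M" for \<omega>
  proof -
    have "P v \<omega> * new_product v \<omega> \<le> P v \<omega> * 1"
      by (rule mult_left_mono[OF new_product_bounds(2)[OF v] P_bounds(1)[OF v]])
    then have "\<bar>past_product \<Phi> C k (t + s) v \<omega> - P v \<omega>\<bar> = P v \<omega> * (1 - new_product v \<omega>)"
      unfolding past_product_add[OF v] by (simp add: right_diff_distrib)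
    also have "\<dots> \<le> 1 * (1 - new_product v \<omega>)"
      using P_bounds(2)[OF v] new_product_bounds(2)[OF v] by (intro mult_right_mono) auto
    finally have "ennreal \<bar>past_product \<Phi> C k (t + s) v \<omega> - P v \<omega>\<bar> \<le> ennreal (1 - new_product v \<omega>)"
      by (intro ennreal_leI) simp
    also have "\<dots> \<le> (\<integral>\<^sup>+p. ?f p \<omega> \<partial>count_space UNIV)"
    proof (rule LIMSEQ_le_const2)
      show "(\<lambda>N. ennreal (1 - (\<Prod>p<N. 1 - defect v p \<omega>))) \<longlonglongrightarrow> ennreal (1 - new_product v \<omega>)"
        by (intro tendsto_ennrealI tendsto_diff tendsto_const new_product_LIMSEQ[OF v \<omega>])
      have "ennreal (1 - (\<Prod>p<N. 1 - defect v p \<omega>)) \<le> (\<integral>\<^sup>+p. ?f p \<omega> \<partial>count_space UNIV)" for N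
      proof -
        have "1 - (\<Prod>p<N. 1 - defect v p \<omega>) \<le> (\<Sum>p<N. defect v p \<omega>)"
          using prod_one_minus_expansion(1)[of "\<lambda>p. defect v p \<omega>" N, OF defect_bounds(1)[OF v]] by simp
        then have "ennreal (1 - (\<Prod>p<N. 1 - defect v p \<omega>)) \<le> ennreal (\<Sum>p<N. defect v p \<omega>)"
          by (rule ennreal_leI)
        also have "\<dots> = (\<Sum>p<N. ennreal (defect v p \<omega>))"
          using defect_bounds(1)[OF v] by (intro sum_ennreal[symmetric]) auto
        also have "\<dots> \<le> (\<Sum>p<N. ?f p \<omega>)"
        proof (rule sum_mono)
          fix p
          have "ennreal (defect v p \<omega>) \<le> ennreal (indicator (V' p) \<omega> * total_defect k v (fst (Y' p \<omega>)))"
            by (rule ennreal_leI[OF defect_bounds(2)[OF v]])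
          then show "ennreal (defect v p \<omega>) \<le> ?f p \<omega>" by (cases "\<omega> \<in> V' p") simp_all
        qed
        also have "\<dots> \<le> (\<integral>\<^sup>+p. ?f p \<omega> \<partial>count_space UNIV)" by (rule sum_le_nn_integral_count_space_nat)
        finally show ?thesis .
      qed
      then show "\<exists>N. \<forall>n\<ge>N. ennreal (1 - (\<Prod>p<n. 1 - defect v p \<omega>)) \<le> (\<integral>\<^sup>+p. ?f p \<omega> \<partial>count_space UNIV)"
        by blast
    qed
    finally show ?thesis .
  qed
  then have "(\<integral>\<^sup>+\<omega>. ennreal \<bar>past_product \<Phi> C k (t + s) v \<omega> - P v \<omega>\<bar> \<partial>M) \<le>
      (\<integral>\<^sup>+\<omega>. (\<integral>\<^sup>+p. ?f p \<omega> \<partial>count_space UNIV) \<partial>M)"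
    by (rule nn_integral_mono)
  also have "\<dots> = (\<integral>\<^sup>+p. (\<integral>\<^sup>+\<omega>. ?f p \<omega> \<partial>M) \<partial>count_space UNIV)"
    by (rule nn_integral_count_space_swap[OF sigma_finite_measure_axioms fM, symmetric])
  also have "\<dots> = ennreal s * (\<integral>\<^sup>+x. ennreal (total_defect k v x) \<partial>\<Lambda>)"
    by (rule new_points_sum[OF td])
  also have "\<dots> \<le> ennreal s * ennreal B" by (rule mult_left_mono[OF B(1)]) simp
  also have "\<dots> = ennreal (s * B)" using s by (simp add: ennreal_mult')
  finally show ?thesis .
qed

text \<open>Seen from a new point every past point is earlier, so the timer condition of
  \<open>less_level_iff_neighbours\<close> disappears.\<close>

lemma less_level_iff_isolated:
  assumes "i < k" "\<omega> \<in> V' p"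
  shows "i < level k (timers_below t (\<Phi> \<omega>)) (C \<omega>) (Y' p \<omega>) \<longleftrightarrow> \<omega> \<in> isolated (level_threshold k i) p"
proof -
  have sp: "\<omega> \<in> space M" using assms(2) V'_space by auto
  have lt: "snd (Y n \<omega>) < snd (Y' p \<omega>)" if "\<omega> \<in> V n" for n
    using snd_Y[OF that] snd_Y'[OF assms(2)] by simp
  have lv: "level k (timers_below t (\<Phi> \<omega>)) (C \<omega>) (Y n \<omega>) = lev \<omega> (Y n \<omega>)" if "\<omega> \<in> V n" for n
    using snd_Y[OF that] by (intro level_timers_below) simp
  have all: "(\<forall>w\<in>timers_below t (\<Phi> \<omega>). Q w) \<longleftrightarrow> (\<forall>n. \<omega> \<in> V n \<longrightarrow> Q (Y n \<omega>))" for Q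
    unfolding timers_below_eq points(1)[OF sp] by auto
  have "i < level k (timers_below t (\<Phi> \<omega>)) (C \<omega>) (Y' p \<omega>) \<longleftrightarrow>
    (\<forall>n. \<omega> \<in> V n \<longrightarrow> level_threshold k i \<le> lev \<omega> (Y n \<omega>) \<longrightarrow> \<not> C \<omega> (Y' p \<omega>) (Y n \<omega>))"
    unfolding less_level_iff_neighbours[OF assms(1)] all using lt lv by auto
  then show ?thesis using assms(2) by (auto simp: isolated_def at_level_def)
qed

text \<open>No level exceeds \<open>k\<close>, so the condition is void. This brings the term with
  \<open>1 - v 0\<close> into the same shape as the others.\<close>

lemma isolated_Suc_k: "isolated (Suc k) p = V' p"
proof -
  have "at_level (Suc k) i = {}" for i
    using level_le[of k] by (auto simp: at_level_def not_less_eq_eq[symmetric])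
  then show ?thesis by (simp add: isolated_def)
qed

text \<open>Telescoping over the indices below the level of the new point. Each
  \<open>v i - v (Suc i)\<close>, which may be negative, is written as a difference of two deficits,
  since \<open>isolated_sum\<close> treats functions with values in the unit interval.\<close>

lemma past_defect_eq:
  "past_defect v p \<omega> = indicator (isolated (Suc k) p) \<omega> * (1 - v 0 (fst (Y' p \<omega>))) +
    (\<Sum>i<k. indicator (isolated (level_threshold k i) p) \<omega> * (1 - v (Suc i) (fst (Y' p \<omega>))) -
      indicator (isolated (level_threshold k i) p) \<omega> * (1 - v i (fst (Y' p \<omega>))))"
proof (cases "\<omega> \<in> V' p")
  case True
  let ?l = "level k (timers_below t (\<Phi> \<omega>)) (C \<omega>) (Y' p \<omega>)"
  have "(\<Sum>i<k. indicator (isolated (level_threshold k i) p) \<omega> * (1 - v (Suc i) (fst (Y' p \<omega>))) -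
      indicator (isolated (level_threshold k i) p) \<omega> * (1 - v i (fst (Y' p \<omega>)))) =
      (\<Sum>i<k. if i \<in> {..<?l} then v i (fst (Y' p \<omega>)) - v (Suc i) (fst (Y' p \<omega>)) else 0)"
    by (intro sum.cong refl) (auto simp: less_level_iff_isolated[OF _ True, symmetric] indicator_def)
  also have "\<dots> = (\<Sum>i\<in>{..<k} \<inter> {..<?l}. v i (fst (Y' p \<omega>)) - v (Suc i) (fst (Y' p \<omega>)))"
    by (subst sum.inter_restrict) simp_all
  also have "{..<k} \<inter> {..<?l} = {..<?l}" using level_le[of k "timers_below t (\<Phi> \<omega>)" "C \<omega>" "Y' p \<omega>"] by auto
  also have "(\<Sum>i\<in>{..<?l}. v i (fst (Y' p \<omega>)) - v (Suc i) (fst (Y' p \<omega>))) =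
      v 0 (fst (Y' p \<omega>)) - v ?l (fst (Y' p \<omega>))"
    by (rule sum_lessThan_telescope')
  finally show ?thesis using True by (simp add: past_defect_def isolated_Suc_k)
next
  case False
  then have "\<omega> \<notin> isolated m p" for m by (simp add: isolated_def)
  then show ?thesis using False by (simp add: past_defect_def)
qed

text \<open>Other new points can alter the level of \<open>p\<close> only through a link to an
  earlier new point. The sum over all linked \<open>q\<close> bounds the indicator that one exists,
  and the total deficit bounds the change between any two levels.\<close>

lemma defect_diff:
  assumes v: "weights k v"
  shows "ennreal \<bar>defect v p \<omega> - past_defect v p \<omega>\<bar> \<le>
    (\<integral>\<^sup>+q. (if p \<noteq> q \<and> \<omega> \<in> V' p \<inter> V' q \<and> C \<omega> (Y' p \<omega>) (Y' q \<omega>)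
      then ennreal (total_defect k v (fst (Y' p \<omega>))) else 0) \<partial>count_space UNIV)" (is "_ \<le> (\<integral>\<^sup>+q. ?e q \<partial>_)")
proof (cases "\<omega> \<in> V' p \<and> lev \<omega> (Y' p \<omega>) \<noteq> level k (timers_below t (\<Phi> \<omega>)) (C \<omega>) (Y' p \<omega>)")
  case True
  then have p: "\<omega> \<in> V' p" by simp
  have sp: "\<omega> \<in> space M" using p V'_space by auto
  have "\<exists>w\<in>\<Phi> \<omega>. t \<le> snd w \<and> snd w < snd (Y' p \<omega>) \<and> C \<omega> (Y' p \<omega>) w"
  proof (rule ccontr)
    assume "\<not> ?thesis"
    then have no: "\<not> C \<omega> (Y' p \<omega>) w" if "w \<in> \<Phi> \<omega>" "t \<le> snd w" "snd w < snd (Y' p \<omega>)" for w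
      using that by blast
    \<comment> \<open>One unfolding suffices: points with timer below \<open>t\<close> are retained
      alike in both configurations, and earlier new points drop out for want of a link.\<close>
    have "retained (timers_below t (\<Phi> \<omega>)) (C \<omega>) m (Y' p \<omega>) = retained (\<Phi> \<omega>) (C \<omega>) m (Y' p \<omega>)" for m
    proof (cases m)
      case (Suc n)
      have "retained (timers_below t (\<Phi> \<omega>)) (C \<omega>) n w = retained (\<Phi> \<omega>) (C \<omega>) n w" if "snd w < t" for w
        using that by (intro retained_timers_below) simp
      then show ?thesis using no snd_Y'[OF p] unfolding Suc retained.simps timers_below_def
        by (smt (verit) mem_Collect_eq)
    qed simp
    then show False using True by (simp add: level_def)
  qed
  then obtain w where w: "w \<in> \<Phi> \<omega>" "t \<le> snd w" "snd w < snd (Y' p \<omega>)" "C \<omega> (Y' p \<omega>) w" by blast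
  then have "w \<in> \<Phi> \<omega> \<inter> UNIV \<times> {t..<t + s}" using snd_Y'[OF p] by (auto simp: mem_Times_iff)
  then obtain q where q: "\<omega> \<in> V' q" "w = Y' q \<omega>" unfolding points(3)[OF sp] by blast
  then have pq: "p \<noteq> q" using w(3) by auto
  have "\<bar>defect v p \<omega> - past_defect v p \<omega>\<bar> \<le> total_defect k v (fst (Y' p \<omega>))"
  proof -
    have "0 \<le> defect v p \<omega> \<and> defect v p \<omega> \<le> total_defect k v (fst (Y' p \<omega>))"
      using defect_bounds[OF v, of p \<omega>] p by simp
    moreover have "0 \<le> past_defect v p \<omega> \<and> past_defect v p \<omega> \<le> total_defect k v (fst (Y' p \<omega>))"
      using weightsD[OF v level_le] total_defect_ge[OF v level_le] p by (simp add: past_defect_def)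
    ultimately show ?thesis by linarith
  qed
  then have "ennreal \<bar>defect v p \<omega> - past_defect v p \<omega>\<bar> \<le> ?e q"
    using p q pq w(4) by (simp add: ennreal_leI)
  also have "?e q \<le> (\<Sum>r<Suc q. ?e r)" by (rule member_le_sum) auto
  also have "\<dots> \<le> (\<integral>\<^sup>+q. ?e q \<partial>count_space UNIV)" by (rule sum_le_nn_integral_count_space_nat)
  finally show ?thesis .
next
  case False
  then have "defect v p \<omega> = past_defect v p \<omega>" by (auto simp: defect_def past_defect_def)
  then show ?thesis by simp
qed

text \<open>Two second-order effects are charged to an ordered pair of distinct new points: the
  product of their deficits, and a link that may alter the level of the first.\<close>

definition pair_error :: "(nat \<Rightarrow> plane \<Rightarrow> real) \<Rightarrow> nat \<times> nat \<Rightarrow> 'w \<Rightarrow> ennreal" where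
  "pair_error v pq \<omega> = (if fst pq \<noteq> snd pq \<and> \<omega> \<in> V' (fst pq) \<inter> V' (snd pq)
     then ennreal (total_defect k v (fst (Y' (fst pq) \<omega>))) *
       (ennreal (total_defect k v (fst (Y' (snd pq) \<omega>))) +
         (if C \<omega> (Y' (fst pq) \<omega>) (Y' (snd pq) \<omega>) then 1 else 0)) else 0)"

text \<open>Bonferroni compares the product with the sum of the true deficits, and
  \<open>defect_diff\<close> replaces these by the deficits relative to the past. Both errors are
  sums over pairs, bounded uniformly in \<open>N\<close>, which permits the passage to the
  limit.\<close>

lemma product_expansion:
  assumes v: "weights k v"
  shows "ennreal \<bar>(\<Prod>p<N. 1 - defect v p \<omega>) - 1 + (\<Sum>p<N. past_defect v p \<omega>)\<bar> \<le>
    (\<integral>\<^sup>+pq. pair_error v pq \<omega> \<partial>count_space UNIV)"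
proof -
  let ?d = "\<lambda>p. defect v p \<omega>" and ?d' = "\<lambda>p. past_defect v p \<omega>"
  let ?td = "\<lambda>p. ennreal (total_defect k v (fst (Y' p \<omega>)))"
  let ?e = "\<lambda>p q. if p \<noteq> q \<and> \<omega> \<in> V' p \<inter> V' q \<and> C \<omega> (Y' p \<omega>) (Y' q \<omega>) then ?td p else 0"
  let ?w = "\<lambda>p q. if p \<noteq> q \<and> \<omega> \<in> V' p \<inter> V' q then ?td p * ?td q else 0"
  note d = defect_bounds[OF v]
  have d_td: "ennreal (?d p) \<le> indicator (V' p) \<omega> * ?td p" for p
    using ennreal_leI[OF d(2)[of p \<omega>]] by (cases "\<omega> \<in> V' p") simp_all
  have "\<bar>(\<Prod>p<N. 1 - ?d p) - 1 + (\<Sum>p<N. ?d' p)\<bar> \<le>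
      \<bar>(\<Prod>p<N. 1 - ?d p) - 1 + (\<Sum>p<N. ?d p)\<bar> + \<bar>(\<Sum>p<N. ?d p) - (\<Sum>p<N. ?d' p)\<bar>" by linarith
  also have "\<bar>(\<Prod>p<N. 1 - ?d p) - 1 + (\<Sum>p<N. ?d p)\<bar> \<le> (\<Sum>p<N. \<Sum>q<p. ?d p * ?d q)"
    using prod_one_minus_expansion[of ?d N, OF d(1)] by linarith
  also have "\<bar>(\<Sum>p<N. ?d p) - (\<Sum>p<N. ?d' p)\<bar> \<le> (\<Sum>p<N. \<bar>?d p - ?d' p\<bar>)"
    unfolding sum_subtractf[symmetric] by (rule sum_abs)
  finally have "\<bar>(\<Prod>p<N. 1 - ?d p) - 1 + (\<Sum>p<N. ?d' p)\<bar> \<le> (\<Sum>p<N. (\<Sum>q<p. ?d p * ?d q) + \<bar>?d p - ?d' p\<bar>)"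
    by (simp add: sum.distrib)
  then have "ennreal \<bar>(\<Prod>p<N. 1 - ?d p) - 1 + (\<Sum>p<N. ?d' p)\<bar> \<le>
      ennreal (\<Sum>p<N. (\<Sum>q<p. ?d p * ?d q) + \<bar>?d p - ?d' p\<bar>)" by (rule ennreal_leI)
  also have "\<dots> = (\<Sum>p<N. (\<Sum>q<p. ennreal (?d p) * ennreal (?d q)) + ennreal \<bar>?d p - ?d' p\<bar>)"
    using d(1) by (simp add: sum_ennreal[symmetric] ennreal_plus sum_nonneg ennreal_mult add_nonneg_nonneg)
  also have "\<dots> \<le> (\<Sum>p<N. \<integral>\<^sup>+q. pair_error v (p, q) \<omega> \<partial>count_space UNIV)"
  proof (rule sum_mono)
    fix p
    have "(\<Sum>q<p. ennreal (?d p) * ennreal (?d q)) \<le> (\<Sum>q<p. ?w p q)"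
    proof (rule sum_mono)
      fix q assume "q \<in> {..<p}"
      then show "ennreal (?d p) * ennreal (?d q) \<le> ?w p q"
        using mult_mono[OF d_td[of p] d_td[of q]] by (auto simp: indicator_def split: if_splits)
    qed
    also have "\<dots> \<le> (\<integral>\<^sup>+q. ?w p q \<partial>count_space UNIV)" by (rule sum_le_nn_integral_count_space_nat)
    finally have "(\<Sum>q<p. ennreal (?d p) * ennreal (?d q)) + ennreal \<bar>?d p - ?d' p\<bar> \<le>
        (\<integral>\<^sup>+q. ?w p q \<partial>count_space UNIV) + (\<integral>\<^sup>+q. ?e p q \<partial>count_space UNIV)"
      by (rule add_mono[OF _ defect_diff[OF v]])
    also have "\<dots> = (\<integral>\<^sup>+q. ?w p q + ?e p q \<partial>count_space UNIV)"
      by (rule nn_integral_add[symmetric]) simp_all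
    also have "\<dots> = (\<integral>\<^sup>+q. pair_error v (p, q) \<omega> \<partial>count_space UNIV)"
      by (intro nn_integral_cong) (auto simp: pair_error_def distrib_left)
    finally show "(\<Sum>q<p. ennreal (?d p) * ennreal (?d q)) + ennreal \<bar>?d p - ?d' p\<bar> \<le>
        (\<integral>\<^sup>+q. pair_error v (p, q) \<omega> \<partial>count_space UNIV)" .
  qed
  also have "\<dots> \<le> (\<integral>\<^sup>+p. \<integral>\<^sup>+q. pair_error v (p, q) \<omega> \<partial>count_space UNIV \<partial>count_space UNIV)"
    by (rule sum_le_nn_integral_count_space_nat)
  also have "\<dots> = (\<integral>\<^sup>+pq. pair_error v pq \<omega> \<partial>count_space UNIV)"
    by (rule nn_integral_fst_count_space)
  finally show ?thesis .
qed

end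

section \<open>Mean of the pair error and of the first-order terms\<close>

context slab
begin

text \<open>The second-order Campbell formula gives \<open>s\<^sup>2\<close> times the double
  integral of d(x) (d(y) + h(x, y)), with d the total deficit. The integral over y is at most
  \<open>B + K\<close> uniformly in x, and the remaining integral over x is at most
  \<open>B\<close>.\<close>

lemma pair_error_integral:
  assumes v: "weights k v" and B: "(\<integral>\<^sup>+x. ennreal (total_defect k v x) \<partial>\<Lambda>) \<le> ennreal B" "0 \<le> B"
    and K: "\<And>x. (\<integral>\<^sup>+y. ennreal (h x y) \<partial>\<Lambda>) \<le> ennreal K" "0 \<le> K"
  shows "(\<integral>\<^sup>+\<omega>. (\<integral>\<^sup>+pq. pair_error v pq \<omega> \<partial>count_space UNIV) \<partial>M) \<le> ennreal (B * (B + K) * s\<^sup>2)"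
proof -
  let ?td = "\<lambda>z :: tpoint. ennreal (total_defect k v (fst z))"
  let ?I = "\<lambda>pq. if fst pq = snd pq then {} else V' (fst pq) \<inter> V' (snd pq)"
  let ?L = "\<lambda>pq. {\<omega>\<in>?I pq. C \<omega> (Y' (fst pq) \<omega>) (Y' (snd pq) \<omega>)}"
  let ?f = "\<lambda>zw. ?td (fst zw) * (?td (snd zw) + ennreal (h (fst (fst zw)) (fst (snd zw))))"
  have td: "(\<lambda>x. ennreal (total_defect k v x)) \<in> borel_measurable borel"
    using total_defect_measurable[OF v] by simp
  have td': "?td \<in> borel_measurable borel"
    by (rule measurable_compose[OF measurable_fst_tpoint[OF measurable_ident[unfolded id_def]] td])
  have tdG: "(\<lambda>\<omega>. ?td (Y' p \<omega>)) \<in> borel_measurable \<G>" for p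
    by (rule measurable_compose[OF YV'(3) td'])
  have tdM: "(\<lambda>\<omega>. ?td (Y' p \<omega>)) \<in> borel_measurable M" for p
    by (rule measurable_compose[OF YV'(5) td'])
  have h1: "(\<lambda>zw. ennreal (h (fst (fst zw)) (fst (snd zw)))) \<in> borel_measurable ((borel :: tpoint measure) \<Otimes>\<^sub>M (borel :: tpoint measure))"
    by (intro measurable_compose[OF _ measurable_ennreal] h_compose_measurable measurable_fst_tpoint)
      (rule measurable_fst measurable_snd)+
  have f: "?f \<in> borel_measurable (borel \<Otimes>\<^sub>M borel)"
    by (rule borel_measurable_times_ennreal[OF measurable_compose[OF measurable_fst td']
          borel_measurable_add[OF measurable_compose[OF measurable_snd td'] h1]])
  have I: "?I pq \<in> events" for pq using YV'(6) by auto
  have L: "?L pq \<in> events" for pq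
    using new_link(1)[of "fst pq" "snd pq" "\<lambda>_. 0"] by (cases "fst pq = snd pq") auto
  have split: "pair_error v pq \<omega> = indicator (?I pq) \<omega> * (?td (Y' (fst pq) \<omega>) * ?td (Y' (snd pq) \<omega>)) +
      ?td (Y' (fst pq) \<omega>) * indicator (?L pq) \<omega>" for pq \<omega>
    by (cases "fst pq \<noteq> snd pq \<and> \<omega> \<in> V' (fst pq) \<and> \<omega> \<in> V' (snd pq)")
      (auto simp: pair_error_def indicator_def distrib_left)
  have m1: "(\<lambda>\<omega>. indicator (?I pq) \<omega> * (?td (Y' (fst pq) \<omega>) * ?td (Y' (snd pq) \<omega>))) \<in> borel_measurable M" for pq
    by (rule borel_measurable_times_ennreal[OF borel_measurable_indicator[OF I] borel_measurable_times_ennreal[OF tdM tdM]])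
  have m2: "(\<lambda>\<omega>. ?td (Y' (fst pq) \<omega>) * indicator (?L pq) \<omega>) \<in> borel_measurable M" for pq
    by (rule borel_measurable_times_ennreal[OF tdM borel_measurable_indicator[OF L]])
  have meas: "pair_error v pq \<in> borel_measurable M" for pq
    unfolding split[abs_def] by (rule borel_measurable_add[OF m1 m2])
  have hM: "(\<lambda>\<omega>. ?td (Y' p \<omega>) * (indicator (?I pq) \<omega> * ennreal (h (fst (Y' p \<omega>)) (fst (Y' q \<omega>))))) \<in> borel_measurable M" for p q pq
    by (intro borel_measurable_times_ennreal tdM borel_measurable_indicator I
        measurable_compose[OF _ measurable_ennreal] h_compose_measurable measurable_fst_tpoint YV'(5))
  have "(\<integral>\<^sup>+\<omega>. (\<integral>\<^sup>+pq. pair_error v pq \<omega> \<partial>count_space UNIV) \<partial>M) =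
      (\<integral>\<^sup>+pq. (\<integral>\<^sup>+\<omega>. pair_error v pq \<omega> \<partial>M) \<partial>count_space UNIV)"
    by (rule nn_integral_count_space_swap[OF sigma_finite_measure_axioms meas, symmetric])
  also have "\<dots> = (\<integral>\<^sup>+pq. (\<integral>\<^sup>+\<omega>. indicator (?I pq) \<omega> * ?f (Y' (fst pq) \<omega>, Y' (snd pq) \<omega>) \<partial>M) \<partial>count_space UNIV)"
  proof (rule nn_integral_cong)
    fix pq :: "nat \<times> nat"
    let ?p = "fst pq" and ?q = "snd pq"
    have "(\<integral>\<^sup>+\<omega>. pair_error v pq \<omega> \<partial>M) =
        (\<integral>\<^sup>+\<omega>. indicator (?I pq) \<omega> * (?td (Y' ?p \<omega>) * ?td (Y' ?q \<omega>)) \<partial>M) +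
        (\<integral>\<^sup>+\<omega>. ?td (Y' ?p \<omega>) * indicator (?L pq) \<omega> \<partial>M)"
      unfolding split by (rule nn_integral_add[OF m1 m2])
    also have "(\<integral>\<^sup>+\<omega>. ?td (Y' ?p \<omega>) * indicator (?L pq) \<omega> \<partial>M) =
        (\<integral>\<^sup>+\<omega>. ?td (Y' ?p \<omega>) * (indicator (?I pq) \<omega> * ennreal (h (fst (Y' ?p \<omega>)) (fst (Y' ?q \<omega>)))) \<partial>M)"
      using new_link(2)[OF _ tdG, of ?p ?q ?p] by (cases "?p = ?q") simp_all
    also have "(\<integral>\<^sup>+\<omega>. indicator (?I pq) \<omega> * (?td (Y' ?p \<omega>) * ?td (Y' ?q \<omega>)) \<partial>M) + \<dots> =
        (\<integral>\<^sup>+\<omega>. indicator (?I pq) \<omega> * (?td (Y' ?p \<omega>) * ?td (Y' ?q \<omega>)) +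
          ?td (Y' ?p \<omega>) * (indicator (?I pq) \<omega> * ennreal (h (fst (Y' ?p \<omega>)) (fst (Y' ?q \<omega>)))) \<partial>M)"
      by (rule nn_integral_add[OF m1 hM, symmetric])
    also have "\<dots> = (\<integral>\<^sup>+\<omega>. indicator (?I pq) \<omega> * ?f (Y' ?p \<omega>, Y' ?q \<omega>) \<partial>M)"
      by (intro nn_integral_cong) (simp add: indicator_def distrib_left)
    finally show "(\<integral>\<^sup>+\<omega>. pair_error v pq \<omega> \<partial>M) = (\<integral>\<^sup>+\<omega>. indicator (?I pq) \<omega> * ?f (Y' ?p \<omega>, Y' ?q \<omega>) \<partial>M)" .
  qed
  also have "\<dots> = (\<integral>\<^sup>+z. (\<integral>\<^sup>+w. ?f (z, w) \<partial>intensity (UNIV \<times> {t..<t + s})) \<partial>intensity (UNIV \<times> {t..<t + s}))"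
    by (rule pair_campbell[OF W' enum' f])
  also have "\<dots> \<le> (\<integral>\<^sup>+z. ?td z * ennreal (s * (B + K)) \<partial>intensity (UNIV \<times> {t..<t + s}))"
  proof (rule nn_integral_mono)
    fix z :: tpoint
    have hz: "(\<lambda>y. ennreal (h (fst z) y)) \<in> borel_measurable borel"
      by (intro measurable_compose[OF _ measurable_ennreal] h_compose_measurable) simp_all
    have g: "(\<lambda>y. ennreal (total_defect k v y) + ennreal (h (fst z) y)) \<in> borel_measurable borel"
      by (rule borel_measurable_add[OF td hz])
    have g': "(\<lambda>w. ?td w + ennreal (h (fst z) (fst w))) \<in> borel_measurable (intensity (UNIV \<times> {t..<t + s}))"
      using measurable_compose[OF measurable_fst_tpoint[OF measurable_ident[unfolded id_def]] g]
        measurable_cong_sets[OF sets_intensity refl] by blast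
    have td\<Lambda>: "(\<lambda>y. ennreal (total_defect k v y)) \<in> borel_measurable \<Lambda>" "(\<lambda>y. ennreal (h (fst z) y)) \<in> borel_measurable \<Lambda>"
      using td hz measurable_cong_sets[OF sets_\<Lambda> refl] by blast+
    have "(\<integral>\<^sup>+w. ?f (z, w) \<partial>intensity (UNIV \<times> {t..<t + s})) =
        ?td z * (\<integral>\<^sup>+w. ?td w + ennreal (h (fst z) (fst w)) \<partial>intensity (UNIV \<times> {t..<t + s}))"
      using nn_integral_cmult[OF g'] by simp
    also have "(\<integral>\<^sup>+w. ?td w + ennreal (h (fst z) (fst w)) \<partial>intensity (UNIV \<times> {t..<t + s})) =
        ennreal s * (\<integral>\<^sup>+y. ennreal (total_defect k v y) + ennreal (h (fst z) y) \<partial>\<Lambda>)"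
      by (rule nn_integral_intensity_slab[OF t s g])
    also have "(\<integral>\<^sup>+y. ennreal (total_defect k v y) + ennreal (h (fst z) y) \<partial>\<Lambda>) =
        (\<integral>\<^sup>+y. ennreal (total_defect k v y) \<partial>\<Lambda>) + (\<integral>\<^sup>+y. ennreal (h (fst z) y) \<partial>\<Lambda>)"
      by (rule nn_integral_add[OF td\<Lambda>])
    also have "\<dots> \<le> ennreal B + ennreal K" by (rule add_mono[OF B(1) K(1)])
    finally have "(\<integral>\<^sup>+w. ?f (z, w) \<partial>intensity (UNIV \<times> {t..<t + s})) \<le> ?td z * (ennreal s * (ennreal B + ennreal K))"
      by (simp add: mult_left_mono)
    then show "(\<integral>\<^sup>+w. ?f (z, w) \<partial>intensity (UNIV \<times> {t..<t + s})) \<le> ?td z * ennreal (s * (B + K))"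
      using s B(2) K(2) by (simp add: ennreal_mult ennreal_plus)
  qed
  also have "\<dots> = (\<integral>\<^sup>+z. ?td z \<partial>intensity (UNIV \<times> {t..<t + s})) * ennreal (s * (B + K))"
    using td' measurable_cong_sets[OF sets_intensity refl] by (intro nn_integral_multc) blast
  also have "(\<integral>\<^sup>+z. ?td z \<partial>intensity (UNIV \<times> {t..<t + s})) = ennreal s * (\<integral>\<^sup>+x. ennreal (total_defect k v x) \<partial>\<Lambda>)"
    by (rule nn_integral_intensity_slab[OF t s td])
  also have "ennreal s * (\<integral>\<^sup>+x. ennreal (total_defect k v x) \<partial>\<Lambda>) * ennreal (s * (B + K)) \<le>
      ennreal s * ennreal B * ennreal (s * (B + K))"
    by (intro mult_right_mono mult_left_mono B(1)) simp_all
  also have "\<dots> = ennreal (B * (B + K) * s\<^sup>2)"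
    using s B(2) K(2) by (simp add: ennreal_mult'[symmetric] power2_eq_square mult_ac)
  finally show "(\<integral>\<^sup>+\<omega>. (\<integral>\<^sup>+pq. pair_error v pq \<omega> \<partial>count_space UNIV) \<partial>M) \<le> ennreal (B * (B + K) * s\<^sup>2)" .
qed

text \<open>The series over all labels may diverge on a null set, where \<open>enn2real\<close>
  returns 0.\<close>

definition isolated_series :: "nat \<Rightarrow> (plane \<Rightarrow> real) \<Rightarrow> 'w \<Rightarrow> real" where
  "isolated_series m b \<omega> =
    enn2real (\<integral>\<^sup>+p. ennreal (indicator (isolated m p) \<omega> * b (fst (Y' p \<omega>))) \<partial>count_space UNIV)"

text \<open>Almost sure finiteness follows by dropping the isolation condition: the expected sum
  over the whole slab is \<open>s\<close> times the integral of \<open>b\<close>. The second part is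
  the exact mean of one first-order term weighted by the past product.\<close>

lemma isolated_series:
  assumes v: "weights k v" and b: "b \<in> borel_measurable borel" "\<And>x. 0 \<le> b x \<and> b x \<le> 1"
    and fin: "(\<integral>\<^sup>+x. ennreal (b x) \<partial>\<Lambda>) < \<infinity>"
  shows "AE \<omega> in M. (\<lambda>N. \<Sum>p<N. indicator (isolated m p) \<omega> * b (fst (Y' p \<omega>))) \<longlonglongrightarrow> isolated_series m b \<omega>"
    and "has_bochner_integral M (\<lambda>\<omega>. P v \<omega> * isolated_series m b \<omega>)
      (s * (\<integral>x. b x * matern_gf M \<Phi> C k t (thin_from h m v x) \<partial>\<Lambda>))"
proof -
  let ?f = "\<lambda>p \<omega>. indicator (isolated m p) \<omega> * b (fst (Y' p \<omega>))"
  let ?S = "\<lambda>\<omega>. \<integral>\<^sup>+p. ennreal (?f p \<omega>) \<partial>count_space UNIV"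
  let ?g = "\<lambda>x. matern_gf M \<Phi> C k t (thin_from h m v x)"
  have bM: "(\<lambda>\<omega>. b (fst (Y' p \<omega>))) \<in> borel_measurable M" for p
    by (rule measurable_compose[OF measurable_fst_tpoint[OF YV'(5)] b(1)])
  have fM: "(\<lambda>\<omega>. ennreal (?f p \<omega>)) \<in> borel_measurable M" for p
    by (rule measurable_compose[OF borel_measurable_times[OF borel_measurable_indicator[OF isolated_event] bM] measurable_ennreal])
  have SM: "?S \<in> borel_measurable M"
    unfolding nn_integral_count_space_nat by (rule borel_measurable_suminf_order[OF fM])
  have be: "(\<lambda>x. ennreal (b x)) \<in> borel_measurable borel" by (rule measurable_compose[OF b(1) measurable_ennreal])
  have "(\<integral>\<^sup>+\<omega>. ?S \<omega> \<partial>M) = (\<integral>\<^sup>+p. (\<integral>\<^sup>+\<omega>. ennreal (?f p \<omega>) \<partial>M) \<partial>count_space UNIV)"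
    by (rule nn_integral_count_space_swap[OF sigma_finite_measure_axioms fM, symmetric])
  also have "\<dots> \<le> (\<integral>\<^sup>+p. (\<integral>\<^sup>+\<omega>. indicator (V' p) \<omega> * ennreal (b (fst (Y' p \<omega>))) \<partial>M) \<partial>count_space UNIV)"
    by (intro nn_integral_mono) (auto simp: indicator_def isolated_def)
  also have "\<dots> = ennreal s * (\<integral>\<^sup>+x. ennreal (b x) \<partial>\<Lambda>)" by (rule new_points_sum[OF be])
  also have "\<dots> < \<infinity>" using fin by (simp add: ennreal_mult_less_top)
  finally have "AE \<omega> in M. ?S \<omega> \<noteq> \<infinity>" by (intro nn_integral_noteq_infinite SM) simp
  then have AE_fin: "AE \<omega> in M. ?S \<omega> < \<infinity>" by (simp add: less_top)
  show "AE \<omega> in M. (\<lambda>N. \<Sum>p<N. ?f p \<omega>) \<longlonglongrightarrow> isolated_series m b \<omega>"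
    using AE_fin
  proof (rule AE_mp, intro AE_I2 impI)
    fix \<omega> assume "?S \<omega> < \<infinity>"
    then show "(\<lambda>N. \<Sum>p<N. ?f p \<omega>) \<longlonglongrightarrow> isolated_series m b \<omega>"
      unfolding isolated_series_def using b(2) by (intro nn_integral_count_space_nat_LIMSEQ) simp_all
  qed
  have pos: "0 \<le> P v \<omega> * isolated_series m b \<omega>" for \<omega>
    using P_bounds(1)[OF v] by (simp add: isolated_series_def)
  have PM: "(\<lambda>\<omega>. ennreal (P v \<omega>)) \<in> borel_measurable M"
    by (rule measurable_compose[OF P_measurable(2)[OF v] measurable_ennreal])
  have "(\<integral>\<^sup>+\<omega>. ennreal (P v \<omega> * isolated_series m b \<omega>) \<partial>M) = (\<integral>\<^sup>+\<omega>. ennreal (P v \<omega>) * ?S \<omega> \<partial>M)"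
  proof (rule nn_integral_cong_AE)
    show "AE \<omega> in M. ennreal (P v \<omega> * isolated_series m b \<omega>) = ennreal (P v \<omega>) * ?S \<omega>"
      using AE_fin
    proof (rule AE_mp, intro AE_I2 impI)
      fix \<omega> assume "?S \<omega> < \<infinity>"
      then have "ennreal (isolated_series m b \<omega>) = ?S \<omega>" by (simp add: isolated_series_def)
      then show "ennreal (P v \<omega> * isolated_series m b \<omega>) = ennreal (P v \<omega>) * ?S \<omega>"
        using P_bounds(1)[OF v, of \<omega>] by (simp add: ennreal_mult')
    qed
  qed
  also have "\<dots> = (\<integral>\<^sup>+\<omega>. (\<integral>\<^sup>+p. ennreal (P v \<omega>) * ennreal (?f p \<omega>) \<partial>count_space UNIV) \<partial>M)"
    by (simp add: nn_integral_cmult)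
  also have "\<dots> = (\<integral>\<^sup>+p. (\<integral>\<^sup>+\<omega>. ennreal (P v \<omega>) * ennreal (?f p \<omega>) \<partial>M) \<partial>count_space UNIV)"
    by (rule nn_integral_count_space_swap[OF sigma_finite_measure_axioms borel_measurable_times_ennreal[OF PM fM], symmetric])
  also have "\<dots> = (\<integral>\<^sup>+p. (\<integral>\<^sup>+\<omega>. indicator (isolated m p) \<omega> * ennreal (b (fst (Y' p \<omega>)) * P v \<omega>) \<partial>M) \<partial>count_space UNIV)"
    using b(2) by (intro nn_integral_cong) (simp add: indicator_def ennreal_mult' mult.commute)
  also have "\<dots> = ennreal s * (\<integral>\<^sup>+x. ennreal (b x * ?g x) \<partial>\<Lambda>)" by (rule isolated_sum[OF v b])
  also have "(\<integral>\<^sup>+x. ennreal (b x * ?g x) \<partial>\<Lambda>) = ennreal (\<integral>x. b x * ?g x \<partial>\<Lambda>)"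
  proof (rule nn_integral_eq_integral)
    have bg: "b x * ?g x \<le> b x" for x
      using b(2) gf_thin_measurable(4)[OF v] by (simp add: mult_left_le)
    have "(\<lambda>x. b x * ?g x) \<in> borel_measurable \<Lambda>"
      using borel_measurable_times[OF b(1) gf_thin_measurable(1)[OF v]] measurable_cong_sets[OF sets_\<Lambda> refl] by blast
    moreover have "(\<integral>\<^sup>+x. ennreal (b x * ?g x) \<partial>\<Lambda>) \<le> (\<integral>\<^sup>+x. ennreal (b x) \<partial>\<Lambda>)"
      by (intro nn_integral_mono ennreal_leI bg)
    ultimately show "integrable \<Lambda> (\<lambda>x. b x * ?g x)"
      using fin b(2) gf_thin_measurable(3)[OF v] by (intro integrableI_nonneg) (auto intro: le_less_trans)
    show "AE x in \<Lambda>. 0 \<le> b x * ?g x" using b(2) gf_thin_measurable(3)[OF v] by simp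
  qed
  also have "ennreal s * ennreal (\<integral>x. b x * ?g x \<partial>\<Lambda>) = ennreal (s * (\<integral>x. b x * ?g x \<partial>\<Lambda>))"
    using s by (simp add: ennreal_mult')
  finally show "has_bochner_integral M (\<lambda>\<omega>. P v \<omega> * isolated_series m b \<omega>) (s * (\<integral>x. b x * ?g x \<partial>\<Lambda>))"
  proof (rule has_bochner_integral_nn_integral[rotated 3])
    show "(\<lambda>\<omega>. P v \<omega> * isolated_series m b \<omega>) \<in> borel_measurable M"
      unfolding isolated_series_def
      by (rule borel_measurable_times[OF P_measurable(2)[OF v] measurable_compose[OF SM borel_measurable_enn2real[OF measurable_ident[unfolded id_def]]]])
    show "AE \<omega> in M. 0 \<le> P v \<omega> * isolated_series m b \<omega>" using pos by simp
    show "0 \<le> s * (\<integral>x. b x * ?g x \<partial>\<Lambda>)"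
      using s b(2) gf_thin_measurable(3)[OF v] by simp
  qed
qed

end

section \<open>Differentiation in time\<close>

context contention_process
begin

lemma slab_exists:
  assumes "0 \<le> t" "0 \<le> s"
  obtains Y Y' V V' where "slab M h \<Lambda> \<Phi> C t s Y Y' V V'"
proof -
  obtain Y V where YV: "enumerates (window_algebra (UNIV \<times> {..<t})) (\<lambda>\<omega>. \<Phi> \<omega> \<inter> UNIV \<times> {..<t}) Y V"
    by (rule window_enumeration)
  obtain Y' V' where YV': "enumerates (window_algebra (UNIV \<times> {t..<t + s})) (\<lambda>\<omega>. \<Phi> \<omega> \<inter> UNIV \<times> {t..<t + s}) Y' V'"
    by (rule window_enumeration)
  have "slab M h \<Lambda> \<Phi> C t s Y Y' V V'"
    by unfold_locales (use assms YV YV' in \<open>auto simp: borel_prod[symmetric]\<close>)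
  then show ?thesis by (rule that)
qed

lemma past_product_integrable:
  assumes t: "0 \<le> t" and u: "weights k u"
  shows "integrable M (past_product \<Phi> C k t u)"
proof -
  \<comment> \<open>With length 0 the window of new points is empty; the slab serves to access the
    measurability of the past product.\<close>
  obtain Y Y' V V' where "slab M h \<Lambda> \<Phi> C t 0 Y Y' V V'" by (rule slab_exists[OF t order_refl])
  then interpret slab M h \<Lambda> \<Phi> C t 0 Y Y' V V' k .
  show ?thesis
    using P_measurable(2)[OF u] P_bounds[OF u] by (intro integrable_const_bound[of _ 1]) auto
qed

lemma matern_gf_Lipschitz:
  assumes ts: "0 \<le> t" "0 \<le> s" and v: "weights k v"
    and B: "(\<integral>\<^sup>+x. ennreal (total_defect k v x) \<partial>\<Lambda>) \<le> ennreal B" "0 \<le> B"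
  shows "\<bar>matern_gf M \<Phi> C k (t + s) v - matern_gf M \<Phi> C k t v\<bar> \<le> s * B"
proof -
  obtain Y Y' V V' where "slab M h \<Lambda> \<Phi> C t s Y Y' V V'" by (rule slab_exists[OF ts])
  then interpret slab M h \<Lambda> \<Phi> C t s Y Y' V V' k .
  have i: "integrable M (past_product \<Phi> C k (t + s) v)" "integrable M (P v)"
    using past_product_integrable[OF _ v] ts by auto
  have "ennreal \<bar>matern_gf M \<Phi> C k (t + s) v - matern_gf M \<Phi> C k t v\<bar> =
      ennreal (norm (\<integral>\<omega>. past_product \<Phi> C k (t + s) v \<omega> - P v \<omega> \<partial>M))"
    unfolding matern_gf_eq[OF v] using i by simp
  also have "\<dots> \<le> (\<integral>\<^sup>+\<omega>. ennreal (norm (past_product \<Phi> C k (t + s) v \<omega> - P v \<omega>)) \<partial>M)"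
    using i by (intro integral_norm_bound_ennreal) simp
  also have "\<dots> \<le> ennreal (s * B)" using past_product_Lipschitz[OF v B] by simp
  finally show ?thesis using ts B by (subst (asm) ennreal_le_iff) auto
qed

text \<open>With \<open>S\<close> the sum of the deficits relative to the past, the increment of the
  product plus \<open>P v * S\<close> is bounded path by path by the pair errors, using that
  \<open>P v\<close> is at most 1. The mean of \<open>P v * S\<close> is known exactly from
  \<open>isolated_series\<close>, so only the mean pair error remains.\<close>

lemma matern_gf_expansion:
  assumes ts: "0 \<le> t" "0 \<le> s" and v: "weights k v"
    and B: "(\<integral>\<^sup>+x. ennreal (total_defect k v x) \<partial>\<Lambda>) \<le> ennreal B" "0 \<le> B"
    and K: "\<And>x. (\<integral>\<^sup>+y. ennreal (h x y) \<partial>\<Lambda>) \<le> ennreal K" "0 \<le> K"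
  defines "D \<equiv> \<lambda>m j. \<integral>x. (1 - v j x) * matern_gf M \<Phi> C k t (thin_from h m v x) \<partial>\<Lambda>"
  shows "\<bar>matern_gf M \<Phi> C k (t + s) v - matern_gf M \<Phi> C k t v +
    s * (D (Suc k) 0 + (\<Sum>i<k. D (level_threshold k i) (Suc i) - D (level_threshold k i) i))\<bar> \<le> B * (B + K) * s\<^sup>2"
proof -
  obtain Y Y' V V' where "slab M h \<Lambda> \<Phi> C t s Y Y' V V'" by (rule slab_exists[OF ts])
  then interpret slab M h \<Lambda> \<Phi> C t s Y Y' V V' k .
  let ?b = "\<lambda>j x. 1 - v j x"
  let ?T = "\<lambda>m j. isolated_series m (?b j)"
  let ?th = "level_threshold k"
  define S where "S \<omega> = ?T (Suc k) 0 \<omega> + (\<Sum>i<k. ?T (?th i) (Suc i) \<omega> - ?T (?th i) i \<omega>)" for \<omega>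
  have b: "?b j \<in> borel_measurable borel" "0 \<le> ?b j x \<and> ?b j x \<le> 1" if "j \<le> k" for j x
    using weightsD[OF v that] by auto
  have fin: "(\<integral>\<^sup>+x. ennreal (?b j x) \<partial>\<Lambda>) < \<infinity>" if "j \<le> k" for j
  proof -
    have "(\<integral>\<^sup>+x. ennreal (?b j x) \<partial>\<Lambda>) \<le> (\<integral>\<^sup>+x. ennreal (total_defect k v x) \<partial>\<Lambda>)"
      by (intro nn_integral_mono ennreal_leI total_defect_ge[OF v that])
    also have "\<dots> \<le> ennreal B" by (rule B(1))
    finally show ?thesis by (rule le_less_trans) simp
  qed
  have lim: "AE \<omega> in M. (\<lambda>N. \<Sum>p<N. indicator (isolated m p) \<omega> * ?b j (fst (Y' p \<omega>))) \<longlonglongrightarrow> ?T m j \<omega>"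
    if "j \<le> k" for m j
    by (rule isolated_series(1)[OF v b[OF that] fin[OF that]])
  have int: "has_bochner_integral M (\<lambda>\<omega>. P v \<omega> * ?T m j \<omega>) (s * D m j)" if "j \<le> k" for m j
    unfolding D_def by (rule isolated_series(2)[OF v b[OF that] fin[OF that]])
  have "has_bochner_integral M
      (\<lambda>\<omega>. P v \<omega> * ?T (Suc k) 0 \<omega> + (\<Sum>i<k. P v \<omega> * ?T (?th i) (Suc i) \<omega> - P v \<omega> * ?T (?th i) i \<omega>))
      (s * D (Suc k) 0 + (\<Sum>i<k. s * D (?th i) (Suc i) - s * D (?th i) i))"
    by (intro has_bochner_integral_add has_bochner_integral_sum has_bochner_integral_diff int) auto
  then have intS: "has_bochner_integral M (\<lambda>\<omega>. P v \<omega> * S \<omega>)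
      (s * (D (Suc k) 0 + (\<Sum>i<k. D (?th i) (Suc i) - D (?th i) i)))"
    by (simp add: S_def distrib_left sum_distrib_left right_diff_distrib)
  have gf: "has_bochner_integral M (past_product \<Phi> C k u v) (matern_gf M \<Phi> C k u v)" if "0 \<le> u" for u
    unfolding matern_gf_eq[OF v] by (rule has_bochner_integral_integrable[OF past_product_integrable[OF that v]])
  let ?f = "\<lambda>\<omega>. past_product \<Phi> C k (t + s) v \<omega> - P v \<omega> + P v \<omega> * S \<omega>"
  have intf: "has_bochner_integral M ?f (matern_gf M \<Phi> C k (t + s) v - matern_gf M \<Phi> C k t v +
      s * (D (Suc k) 0 + (\<Sum>i<k. D (?th i) (Suc i) - D (?th i) i)))"
    using ts by (intro has_bochner_integral_add has_bochner_integral_diff gf intS) auto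
  \<comment> \<open>Finitely many series occur, so all of them converge outside one null
    set.\<close>
  have "AE \<omega> in M. \<forall>j\<in>{..k}. \<forall>m\<in>insert (Suc k) (?th ` {..<k}).
      (\<lambda>N. \<Sum>p<N. indicator (isolated m p) \<omega> * ?b j (fst (Y' p \<omega>))) \<longlonglongrightarrow> ?T m j \<omega>"
    by (intro AE_finite_allI lim) auto
  then have "AE \<omega> in M. ennreal (norm (?f \<omega>)) \<le> (\<integral>\<^sup>+pq. pair_error v pq \<omega> \<partial>count_space UNIV)"
  proof (rule AE_mp, intro AE_I2 impI)
    fix \<omega> assume \<omega>: "\<omega> \<in> space M"
    assume L: "\<forall>j\<in>{..k}. \<forall>m\<in>insert (Suc k) (?th ` {..<k}).
      (\<lambda>N. \<Sum>p<N. indicator (isolated m p) \<omega> * ?b j (fst (Y' p \<omega>))) \<longlonglongrightarrow> ?T m j \<omega>"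
    have "(\<lambda>N. (\<Sum>p<N. indicator (isolated (Suc k) p) \<omega> * ?b 0 (fst (Y' p \<omega>))) +
        (\<Sum>i<k. (\<Sum>p<N. indicator (isolated (?th i) p) \<omega> * ?b (Suc i) (fst (Y' p \<omega>))) -
          (\<Sum>p<N. indicator (isolated (?th i) p) \<omega> * ?b i (fst (Y' p \<omega>))))) \<longlonglongrightarrow> S \<omega>"
      unfolding S_def using L by (intro tendsto_add tendsto_sum tendsto_diff) auto
    also have "(\<lambda>N. (\<Sum>p<N. indicator (isolated (Suc k) p) \<omega> * ?b 0 (fst (Y' p \<omega>))) +
        (\<Sum>i<k. (\<Sum>p<N. indicator (isolated (?th i) p) \<omega> * ?b (Suc i) (fst (Y' p \<omega>))) -
          (\<Sum>p<N. indicator (isolated (?th i) p) \<omega> * ?b i (fst (Y' p \<omega>))))) = (\<lambda>N. \<Sum>p<N. past_defect v p \<omega>)"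
    proof
      fix N
      have "(\<Sum>i<k. (\<Sum>p<N. indicator (isolated (?th i) p) \<omega> * ?b (Suc i) (fst (Y' p \<omega>))) -
          (\<Sum>p<N. indicator (isolated (?th i) p) \<omega> * ?b i (fst (Y' p \<omega>)))) =
        (\<Sum>p<N. \<Sum>i<k. indicator (isolated (?th i) p) \<omega> * ?b (Suc i) (fst (Y' p \<omega>)) -
          indicator (isolated (?th i) p) \<omega> * ?b i (fst (Y' p \<omega>)))"
        unfolding sum_subtractf[symmetric] by (rule sum.swap)
      then show "(\<Sum>p<N. indicator (isolated (Suc k) p) \<omega> * ?b 0 (fst (Y' p \<omega>))) +
        (\<Sum>i<k. (\<Sum>p<N. indicator (isolated (?th i) p) \<omega> * ?b (Suc i) (fst (Y' p \<omega>))) -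
          (\<Sum>p<N. indicator (isolated (?th i) p) \<omega> * ?b i (fst (Y' p \<omega>)))) = (\<Sum>p<N. past_defect v p \<omega>)"
        unfolding past_defect_eq sum.distrib by simp
    qed
    finally have S: "(\<lambda>N. \<Sum>p<N. past_defect v p \<omega>) \<longlonglongrightarrow> S \<omega>" .
    have "\<bar>?f \<omega>\<bar> = P v \<omega> * \<bar>new_product v \<omega> - 1 + S \<omega>\<bar>"
    proof -
      have "?f \<omega> = P v \<omega> * (new_product v \<omega> - 1 + S \<omega>)"
        unfolding past_product_add[OF v] by (simp add: algebra_simps)
      then show ?thesis using P_bounds(1)[OF v, of \<omega>] by (simp add: abs_mult)
    qed
    also have "\<dots> \<le> 1 * \<bar>new_product v \<omega> - 1 + S \<omega>\<bar>"
      by (rule mult_right_mono[OF P_bounds(2)[OF v]]) simp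
    finally have "ennreal (norm (?f \<omega>)) \<le> ennreal \<bar>new_product v \<omega> - 1 + S \<omega>\<bar>"
      by (intro ennreal_leI) simp
    also have "\<dots> \<le> (\<integral>\<^sup>+pq. pair_error v pq \<omega> \<partial>count_space UNIV)"
    proof (rule LIMSEQ_le_const2)
      show "(\<lambda>N. ennreal \<bar>(\<Prod>p<N. 1 - defect v p \<omega>) - 1 + (\<Sum>p<N. past_defect v p \<omega>)\<bar>) \<longlonglongrightarrow>
          ennreal \<bar>new_product v \<omega> - 1 + S \<omega>\<bar>"
        by (intro tendsto_ennrealI tendsto_rabs tendsto_add tendsto_diff tendsto_const new_product_LIMSEQ[OF v \<omega>] S)
      show "\<exists>N. \<forall>n\<ge>N. ennreal \<bar>(\<Prod>p<n. 1 - defect v p \<omega>) - 1 + (\<Sum>p<n. past_defect v p \<omega>)\<bar> \<le>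
          (\<integral>\<^sup>+pq. pair_error v pq \<omega> \<partial>count_space UNIV)"
        using product_expansion[OF v] by blast
    qed
    finally show "ennreal (norm (?f \<omega>)) \<le> (\<integral>\<^sup>+pq. pair_error v pq \<omega> \<partial>count_space UNIV)" .
  qed
  then have "(\<integral>\<^sup>+\<omega>. ennreal (norm (?f \<omega>)) \<partial>M) \<le> (\<integral>\<^sup>+\<omega>. (\<integral>\<^sup>+pq. pair_error v pq \<omega> \<partial>count_space UNIV) \<partial>M)"
    by (rule nn_integral_mono_AE)
  also have "\<dots> \<le> ennreal (B * (B + K) * s\<^sup>2)" by (rule pair_error_integral[OF v B K])
  finally have "ennreal (norm (integral\<^sup>L M ?f)) \<le> ennreal (B * (B + K) * s\<^sup>2)"
    using integral_norm_bound_ennreal[of M ?f] intf by (auto simp: has_bochner_integral_iff intro: order_trans)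
  then have "norm (integral\<^sup>L M ?f) \<le> B * (B + K) * s\<^sup>2"
    using B K by (subst (asm) ennreal_le_iff) auto
  then show ?thesis using intf by (simp add: has_bochner_integral_iff)
qed

lemma matern_gf_thin_measurable:
  assumes "0 \<le> t" "weights k v"
  shows "(\<lambda>x. matern_gf M \<Phi> C k t (thin_from h m v x)) \<in> borel_measurable borel"
    and "0 \<le> matern_gf M \<Phi> C k t (thin_from h m v x)" "matern_gf M \<Phi> C k t (thin_from h m v x) \<le> 1"
    and "weights k (thin_from h m v x)"
proof -
  obtain Y Y' V V' where "slab M h \<Lambda> \<Phi> C t 0 Y Y' V V'" by (rule slab_exists[OF assms(1) order_refl])
  then interpret slab M h \<Lambda> \<Phi> C t 0 Y Y' V V' k .
  show "(\<lambda>x. matern_gf M \<Phi> C k t (thin_from h m v x)) \<in> borel_measurable borel"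
    "0 \<le> matern_gf M \<Phi> C k t (thin_from h m v x)" "matern_gf M \<Phi> C k t (thin_from h m v x) \<le> 1"
    by (rule gf_thin_measurable[OF assms(2)])+
  show "weights k (thin_from h m v x)" by (rule weights_thin_from[OF assms(2)])
qed

lemma integrable_matern_gf_thin:
  assumes t: "0 \<le> t" and v: "weights k v" and b: "integrable \<Lambda> b"
  shows "integrable \<Lambda> (\<lambda>x. b x * matern_gf M \<Phi> C k t (thin_from h m v x))"
proof (rule Bochner_Integration.integrable_bound[OF b])
  note g = matern_gf_thin_measurable[OF t v]
  show "(\<lambda>x. b x * matern_gf M \<Phi> C k t (thin_from h m v x)) \<in> borel_measurable \<Lambda>"
    using b g(1) measurable_cong_sets[OF sets_\<Lambda> refl] by (intro borel_measurable_times) blast+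
  show "AE x in \<Lambda>. norm (b x * matern_gf M \<Phi> C k t (thin_from h m v x)) \<le> norm (b x)"
    using g(2,3) by (auto simp: abs_mult mult_left_le)
qed

text \<open>The estimate 1 - v (1 - h) \<le> (1 - v) + h, summed over the \<open>k + 1\<close>
  weights. The resulting bound does not depend on the position \<open>x\<close>.\<close>

lemma total_defect_thin:
  assumes v: "weights k v" and B: "(\<integral>\<^sup>+x. ennreal (total_defect k v x) \<partial>\<Lambda>) \<le> ennreal B" "0 \<le> B"
    and K: "\<And>x. (\<integral>\<^sup>+y. ennreal (h x y) \<partial>\<Lambda>) \<le> ennreal K" "0 \<le> K"
  shows "(\<integral>\<^sup>+y. ennreal (total_defect k (thin_from h m v x) y) \<partial>\<Lambda>) \<le> ennreal (B + real (Suc k) * K)"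
proof -
  have "total_defect k (thin_from h m v x) y \<le> total_defect k v y + real (Suc k) * h x y" for y
  proof -
    have "1 - thin_from h m v x j y \<le> (1 - v j y) + h x y" if "j \<le> k" for j
    proof -
      have "v j y * h x y \<le> 1 * h x y"
        using weightsD[OF v that] h_range by (intro mult_right_mono) auto
      then show ?thesis using h_range[of x y] by (simp add: thin_from_def thin_def algebra_simps)
    qed
    then have "total_defect k (thin_from h m v x) y \<le> (\<Sum>j\<le>k. (1 - v j y) + h x y)"
      unfolding total_defect_def by (intro sum_mono) auto
    also have "\<dots> = total_defect k v y + real (Suc k) * h x y"
      unfolding sum.distrib total_defect_def by simp
    finally show ?thesis .
  qed
  then have "(\<integral>\<^sup>+y. ennreal (total_defect k (thin_from h m v x) y) \<partial>\<Lambda>) \<le>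
      (\<integral>\<^sup>+y. ennreal (total_defect k v y + real (Suc k) * h x y) \<partial>\<Lambda>)"
    by (intro nn_integral_mono ennreal_leI)
  also have "\<dots> = (\<integral>\<^sup>+y. ennreal (total_defect k v y) + ennreal (real (Suc k)) * ennreal (h x y) \<partial>\<Lambda>)"
    using total_defect_nonneg[OF v] h_range by (intro nn_integral_cong) (simp add: ennreal_plus ennreal_mult)
  also have "\<dots> = (\<integral>\<^sup>+y. ennreal (total_defect k v y) \<partial>\<Lambda>) + ennreal (real (Suc k)) * (\<integral>\<^sup>+y. ennreal (h x y) \<partial>\<Lambda>)"
  proof -
    have h: "(\<lambda>y. ennreal (h x y)) \<in> borel_measurable borel"
      by (intro measurable_compose[OF _ measurable_ennreal] h_compose_measurable) simp_all
    have "(\<lambda>y. ennreal (total_defect k v y)) \<in> borel_measurable borel"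
      using total_defect_measurable[OF v] by simp
    with h have m: "(\<lambda>y. ennreal (total_defect k v y)) \<in> borel_measurable \<Lambda>" "(\<lambda>y. ennreal (h x y)) \<in> borel_measurable \<Lambda>"
      using measurable_cong_sets[OF sets_\<Lambda> refl] by blast+
    show ?thesis
      unfolding nn_integral_add[OF m(1) borel_measurable_times_ennreal[OF borel_measurable_const m(2)]]
        nn_integral_cmult[OF m(2)] ..
  qed
  also have "\<dots> \<le> ennreal B + ennreal (real (Suc k)) * ennreal K"
    by (intro add_mono mult_left_mono B K) simp
  also have "\<dots> = ennreal (B + real (Suc k) * K)"
    using B(2) K(2) by (simp add: ennreal_plus ennreal_mult)
  finally show ?thesis .
qed

text \<open>By \<open>total_defect_thin\<close> the Lipschitz constant in time is the same for all
  \<open>x\<close>, so it can be taken out of the integral against \<open>b\<close>.\<close>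

lemma integral_matern_gf_thin_Lipschitz:
  assumes ts: "0 \<le> t" "0 \<le> s" and v: "weights k v"
    and B: "(\<integral>\<^sup>+x. ennreal (total_defect k v x) \<partial>\<Lambda>) \<le> ennreal B" "0 \<le> B"
    and K: "\<And>x. (\<integral>\<^sup>+y. ennreal (h x y) \<partial>\<Lambda>) \<le> ennreal K" "0 \<le> K"
    and b: "integrable \<Lambda> b" "\<And>x. 0 \<le> b x"
  shows "\<bar>(\<integral>x. b x * matern_gf M \<Phi> C k (t + s) (thin_from h m v x) \<partial>\<Lambda>) -
    (\<integral>x. b x * matern_gf M \<Phi> C k t (thin_from h m v x) \<partial>\<Lambda>)\<bar> \<le> (\<integral>x. b x \<partial>\<Lambda>) * (B + real (Suc k) * K) * s"
proof -
  let ?g = "\<lambda>t x. matern_gf M \<Phi> C k t (thin_from h m v x)" and ?L = "B + real (Suc k) * K"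
  have int: "integrable \<Lambda> (\<lambda>x. b x * ?g u x)" if "0 \<le> u" for u
    by (rule integrable_matern_gf_thin[OF that v b(1)])
  have L: "\<bar>?g (t + s) x - ?g t x\<bar> \<le> s * ?L" for x
    using B K by (intro matern_gf_Lipschitz[OF ts matern_gf_thin_measurable(4)[OF ts(1) v]] total_defect_thin v) auto
  have i: "integrable \<Lambda> (\<lambda>x. b x * ?g (t + s) x)" "integrable \<Lambda> (\<lambda>x. b x * ?g t x)"
    using ts by (auto intro!: int)
  have "\<bar>(\<integral>x. b x * ?g (t + s) x \<partial>\<Lambda>) - (\<integral>x. b x * ?g t x \<partial>\<Lambda>)\<bar> =
      \<bar>\<integral>x. b x * ?g (t + s) x - b x * ?g t x \<partial>\<Lambda>\<bar>"
    using i by (simp add: Bochner_Integration.integral_diff)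
  also have "\<dots> \<le> (\<integral>x. \<bar>b x * ?g (t + s) x - b x * ?g t x\<bar> \<partial>\<Lambda>)" by (rule integral_abs_bound)
  also have "\<dots> \<le> (\<integral>x. b x * (s * ?L) \<partial>\<Lambda>)"
  proof (rule integral_mono)
    show "integrable \<Lambda> (\<lambda>x. \<bar>b x * ?g (t + s) x - b x * ?g t x\<bar>)" using i by simp
    show "integrable \<Lambda> (\<lambda>x. b x * (s * ?L))" using b(1) by simp
    show "\<bar>b x * ?g (t + s) x - b x * ?g t x\<bar> \<le> b x * (s * ?L)" for x
      using mult_left_mono[OF L[of x] b(2)[of x]] b(2)[of x]
      by (simp add: right_diff_distrib[symmetric] abs_mult)
  qed
  also have "\<dots> = (\<integral>x. b x \<partial>\<Lambda>) * ?L * s" by simp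
  finally show ?thesis .
qed

lemma matern_gf_derivative:
  assumes v: "weights k v" and fin: "\<And>j. j \<le> k \<Longrightarrow> (\<integral>\<^sup>+x. ennreal (1 - v j x) \<partial>\<Lambda>) < \<infinity>"
    and t: "0 \<le> t"
  defines "D \<equiv> \<lambda>t m j. \<integral>x. (1 - v j x) * matern_gf M \<Phi> C k t (thin_from h m v x) \<partial>\<Lambda>"
  shows "((\<lambda>s. matern_gf M \<Phi> C k s v) has_real_derivative
    - (D t (Suc k) 0 + (\<Sum>i<k. D t (level_threshold k i) (Suc i) - D t (level_threshold k i) i))) (at t within {0..})"
proof -
  let ?th = "level_threshold k"
  define F where "F u = - (D u (Suc k) 0 + (\<Sum>i<k. D u (?th i) (Suc i) - D u (?th i) i))" for u
  \<comment> \<open>Both quantities are finite, by integrability of the deficits and by the bound on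
    the integrals of \<open>h\<close>, so \<open>enn2real\<close> is exact here.\<close>
  define B where "B = enn2real (\<integral>\<^sup>+x. ennreal (total_defect k v x) \<partial>\<Lambda>)"
  define K where "K = enn2real (SUP x. \<integral>\<^sup>+ y. ennreal (h x y) \<partial>\<Lambda>)"
  have meas: "(\<lambda>x. 1 - v j x) \<in> borel_measurable \<Lambda>" if "j \<le> k" for j
  proof -
    have "(\<lambda>x. 1 - v j x) \<in> borel_measurable borel" using weightsD(1)[OF v that] by simp
    then show ?thesis using measurable_cong_sets[OF sets_\<Lambda> refl] by blast
  qed
  have "(\<integral>\<^sup>+x. ennreal (total_defect k v x) \<partial>\<Lambda>) = (\<integral>\<^sup>+x. (\<Sum>j\<le>k. ennreal (1 - v j x)) \<partial>\<Lambda>)"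
    unfolding total_defect_def using weightsD(3)[OF v] by (intro nn_integral_cong sum_ennreal[symmetric]) auto
  also have "\<dots> = (\<Sum>j\<le>k. \<integral>\<^sup>+x. ennreal (1 - v j x) \<partial>\<Lambda>)"
    using meas by (intro nn_integral_sum measurable_compose[OF _ measurable_ennreal]) auto
  also have "\<dots> < \<infinity>" using fin by simp
  finally have B: "(\<integral>\<^sup>+x. ennreal (total_defect k v x) \<partial>\<Lambda>) \<le> ennreal B" "0 \<le> B"
    by (simp_all add: B_def)
  have K: "(\<integral>\<^sup>+y. ennreal (h x y) \<partial>\<Lambda>) \<le> ennreal K" "0 \<le> K" for x
  proof -
    have "(\<integral>\<^sup>+y. ennreal (h x y) \<partial>\<Lambda>) \<le> (SUP x. \<integral>\<^sup>+ y. ennreal (h x y) \<partial>\<Lambda>)"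
      by (rule SUP_upper) simp
    then show "(\<integral>\<^sup>+y. ennreal (h x y) \<partial>\<Lambda>) \<le> ennreal K" "0 \<le> K"
      using \<Lambda>_h by (simp_all add: K_def)
  qed
  have int: "integrable \<Lambda> (\<lambda>x. 1 - v j x)" if "j \<le> k" for j
    using meas[OF that] fin[OF that] weightsD(3)[OF v that] by (intro integrableI_nonneg) auto
  have nonneg: "0 \<le> 1 - v j x" if "j \<le> k" for j x using weightsD(3)[OF v that] by simp
  define L where "L j = (\<integral>x. 1 - v j x \<partial>\<Lambda>) * (B + real (Suc k) * K)" for j
  have D_Lip: "\<bar>D (u + s) m j - D u m j\<bar> \<le> L j * s" if "0 \<le> u" "0 \<le> s" "j \<le> k" for u s m j
    unfolding D_def L_def
    by (rule integral_matern_gf_thin_Lipschitz[OF that(1,2) v B K int[OF that(3)] nonneg[OF that(3)]])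
  have "((\<lambda>s. matern_gf M \<Phi> C k s v) has_real_derivative F t) (at t within {0..})"
  proof (rule has_derivative_from_right_expansion[OF _ _ t])
    fix u s :: real assume us: "0 \<le> u" "0 \<le> s"
    show "\<bar>matern_gf M \<Phi> C k (u + s) v - matern_gf M \<Phi> C k u v - s * F u\<bar> \<le> B * (B + K) * s\<^sup>2"
      using matern_gf_expansion[OF us v B K] unfolding F_def D_def
      by (simp only: mult_minus_right diff_minus_eq_add)
    have "\<bar>F (u + s) - F u\<bar> = \<bar>(D (u + s) (Suc k) 0 - D u (Suc k) 0) +
        (\<Sum>i<k. (D (u + s) (?th i) (Suc i) - D u (?th i) (Suc i)) - (D (u + s) (?th i) i - D u (?th i) i))\<bar>"
      unfolding F_def by (simp add: sum_subtractf)
    also have "\<dots> \<le> L 0 * s + (\<Sum>i<k. L (Suc i) * s + L i * s)"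
    proof (intro order_trans[OF abs_triangle_ineq] add_mono order_trans[OF sum_abs] sum_mono)
      \<comment> \<open>The right-hand side is a finite combination of the integrals
        \<open>D\<close>, so its Lipschitz constant is the sum of theirs.\<close>
      show "\<bar>D (u + s) (Suc k) 0 - D u (Suc k) 0\<bar> \<le> L 0 * s" by (rule D_Lip[OF us]) simp
      fix i assume "i \<in> {..<k}"
      then show "\<bar>(D (u + s) (?th i) (Suc i) - D u (?th i) (Suc i)) - (D (u + s) (?th i) i - D u (?th i) i)\<bar> \<le>
          L (Suc i) * s + L i * s"
        using D_Lip[OF us, of "Suc i" "?th i"] D_Lip[OF us, of i "?th i"] by auto
    qed
    also have "\<dots> = (L 0 + (\<Sum>i<k. L (Suc i) + L i)) * s"
      by (simp add: distrib_right sum_distrib_right)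
    finally show "\<bar>F (u + s) - F u\<bar> \<le> (L 0 + (\<Sum>i<k. L (Suc i) + L i)) * s" .
  qed
  then show ?thesis by (simp add: F_def)
qed

end

theorem theorem2:
  fixes h :: "plane \<Rightarrow> plane \<Rightarrow> real"
    and \<Lambda> :: "plane measure"
    and M :: "'w measure"
    and \<Phi> :: "'w \<Rightarrow> tpoint set"
    and C :: "'w \<Rightarrow> tpoint \<Rightarrow> tpoint \<Rightarrow> bool"
    and k :: nat
    and v :: "nat \<Rightarrow> plane \<Rightarrow> real"
  assumes h_measurable: "case_prod h \<in> borel_measurable (borel \<Otimes>\<^sub>M borel)"
    and h_range: "\<And>x y. 0 \<le> h x y \<and> h x y \<le> 1"
    and h_symmetric: "\<And>x y. h x y = h y x"
    and h_translation: "\<And>x y. h x y = h 0 (y - x)"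
    and \<Lambda>_borel: "sets \<Lambda> = sets borel"
    and \<Lambda>_locally_finite: "locally_finite_measure \<Lambda>"
    and \<Lambda>_h: "(SUP x. \<integral>\<^sup>+ y. ennreal (h x y) \<partial>\<Lambda>) < \<infinity>"
    and M_prob: "prob_space M"
    and \<Phi>_poisson: "poisson_process M (timed_intensity \<Lambda>) \<Phi>"
    and C_contention: "contention_variables M (timed_intensity \<Lambda>) \<Phi> h C"
    and k: "1 \<le> k"
    and v_measurable: "\<And>i. i \<le> k \<Longrightarrow> v i \<in> borel_measurable borel"
    and v_range: "\<And>i x. i \<le> k \<Longrightarrow> 0 \<le> v i x \<and> v i x \<le> 1"
    and v_integrable: "\<And>i. i \<le> k \<Longrightarrow> (\<integral>\<^sup>+ x. ennreal \<bar>1 - v i x\<bar> \<partial>\<Lambda>) < \<infinity>"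
  shows "matern_gf M \<Phi> C k 0 v = 1 \<and>
    (\<forall>t\<ge>0. ((\<lambda>s. matern_gf M \<Phi> C k s v) has_real_derivative
       (- (\<integral>x. (1 - v 0 x) * matern_gf M \<Phi> C k t v \<partial>\<Lambda>)
        - (\<Sum>i\<in>{0..<k div 2}.
             \<integral>x. (v i x - v (i + 1) x) * matern_gf M \<Phi> C k t (thin_from h (k - i) v x) \<partial>\<Lambda>)
        - (\<Sum>i\<in>{k div 2..<k}.
             \<integral>x. (v i x - v (i + 1) x) * matern_gf M \<Phi> C k t (thin_from h (k - i - 1) v x) \<partial>\<Lambda>)))
       (at t within {0..}))"
proof -
  interpret prob_space M by (rule M_prob)
  interpret contention_process M h \<Lambda> \<Phi> C
    by unfold_locales fact+
  have v: "weights k v" using v_measurable v_range by (simp add: weights_def)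
  have fin: "(\<integral>\<^sup>+x. ennreal (1 - v j x) \<partial>\<Lambda>) < \<infinity>" if "j \<le> k" for j
    using v_integrable[OF that] v_range[OF that] by (simp add: abs_of_nonneg)
  have int: "integrable \<Lambda> (\<lambda>x. 1 - v j x)" if "j \<le> k" for j
  proof (rule integrableI_nonneg)
    have "(\<lambda>x. 1 - v j x) \<in> borel_measurable borel" using v_measurable[OF that] by simp
    then show "(\<lambda>x. 1 - v j x) \<in> borel_measurable \<Lambda>" using measurable_cong_sets[OF sets_\<Lambda> refl] by blast
  qed (use fin[OF that] v_range[OF that] in auto)
  have "past_product \<Phi> C k 0 v \<omega> = 1" if "\<omega> \<in> space M" for \<omega>
  proof -
    \<comment> \<open>The space of \<open>\<mu>\<close> contains only nonnegative timers, so at time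
      0 the product is empty.\<close>
    have "timers_below 0 (\<Phi> \<omega>) = {}"
      using \<Phi>_subset[OF that] by (auto simp: timers_below_def space_\<mu>)
    then show ?thesis by (simp add: past_product_def infprod_finite)
  qed
  then have "matern_gf M \<Phi> C k 0 v = (\<integral>\<omega>. 1 \<partial>M)"
    unfolding matern_gf_eq[OF v] by (intro Bochner_Integration.integral_cong) auto
  then have start: "matern_gf M \<Phi> C k 0 v = 1" by (simp add: prob_space)
  let ?g = "\<lambda>t m x. matern_gf M \<Phi> C k t (thin_from h m v x)"
  \<comment> \<open>Thinning from index \<open>k + 1\<close> leaves unchanged every weight that
    \<open>matern_gf\<close> reads.\<close>
  have full: "?g t (Suc k) x = matern_gf M \<Phi> C k t v" for t x
    unfolding matern_gf_def by (simp add: thin_from_def)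
  \<comment> \<open>The deficits separated in \<open>past_defect_eq\<close> are joined again into
    the coefficient of the statement; this needs each integral to be finite.\<close>
  have diff: "(\<integral>x. (1 - v (Suc i) x) * ?g t m x \<partial>\<Lambda>) - (\<integral>x. (1 - v i x) * ?g t m x \<partial>\<Lambda>) =
      (\<integral>x. (v i x - v (i + 1) x) * ?g t m x \<partial>\<Lambda>)" if "i < k" "0 \<le> t" for i m t
  proof -
    have "integrable \<Lambda> (\<lambda>x. (1 - v j x) * ?g t m x)" if "j \<le> k" for j
      by (rule integrable_matern_gf_thin[OF \<open>0 \<le> t\<close> v int[OF that]])
    then have "(\<integral>x. (1 - v (Suc i) x) * ?g t m x \<partial>\<Lambda>) - (\<integral>x. (1 - v i x) * ?g t m x \<partial>\<Lambda>) =
        (\<integral>x. (1 - v (Suc i) x) * ?g t m x - (1 - v i x) * ?g t m x \<partial>\<Lambda>)"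
      using \<open>i < k\<close> by (intro Bochner_Integration.integral_diff[symmetric]) auto
    also have "\<dots> = (\<integral>x. (v i x - v (i + 1) x) * ?g t m x \<partial>\<Lambda>)"
      by (intro Bochner_Integration.integral_cong) (auto simp: algebra_simps)
    finally show ?thesis .
  qed
  have "((\<lambda>s. matern_gf M \<Phi> C k s v) has_real_derivative
       (- (\<integral>x. (1 - v 0 x) * matern_gf M \<Phi> C k t v \<partial>\<Lambda>)
        - (\<Sum>i\<in>{0..<k div 2}. \<integral>x. (v i x - v (i + 1) x) * ?g t (k - i) x \<partial>\<Lambda>)
        - (\<Sum>i\<in>{k div 2..<k}. \<integral>x. (v i x - v (i + 1) x) * ?g t (k - i - 1) x \<partial>\<Lambda>)))
       (at t within {0..})" if t: "0 \<le> t" for t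
  proof -
    let ?J = "\<lambda>i. \<integral>x. (v i x - v (i + 1) x) * ?g t (level_threshold k i) x \<partial>\<Lambda>"
    \<comment> \<open>\<open>level_threshold\<close> changes its form at \<open>k div 2\<close>,
      which is the origin of the two sums.\<close>
    have "{..<k} = {0..<k div 2} \<union> {k div 2..<k}" by auto
    then have "(\<Sum>i<k. ?J i) = (\<Sum>i\<in>{0..<k div 2}. ?J i) + (\<Sum>i\<in>{k div 2..<k}. ?J i)"
      by (simp add: sum.union_disjoint)
    also have "(\<Sum>i\<in>{0..<k div 2}. ?J i) = (\<Sum>i\<in>{0..<k div 2}. \<integral>x. (v i x - v (i + 1) x) * ?g t (k - i) x \<partial>\<Lambda>)"
      by (intro sum.cong refl) (simp add: level_threshold_def)
    also have "(\<Sum>i\<in>{k div 2..<k}. ?J i) = (\<Sum>i\<in>{k div 2..<k}. \<integral>x. (v i x - v (i + 1) x) * ?g t (k - i - 1) x \<partial>\<Lambda>)"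
      by (intro sum.cong refl) (simp add: level_threshold_def)
    finally have J: "(\<Sum>i<k. ?J i) = (\<Sum>i\<in>{0..<k div 2}. \<integral>x. (v i x - v (i + 1) x) * ?g t (k - i) x \<partial>\<Lambda>) +
      (\<Sum>i\<in>{k div 2..<k}. \<integral>x. (v i x - v (i + 1) x) * ?g t (k - i - 1) x \<partial>\<Lambda>)" .
    have "(\<Sum>i<k. (\<integral>x. (1 - v (Suc i) x) * ?g t (level_threshold k i) x \<partial>\<Lambda>) -
        (\<integral>x. (1 - v i x) * ?g t (level_threshold k i) x \<partial>\<Lambda>)) = (\<Sum>i<k. ?J i)"
      by (intro sum.cong refl diff t) auto
    with matern_gf_derivative[OF v fin t] J show ?thesis by (simp add: full algebra_simps)
  qed
  with start show ?thesis by blast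
qed

end
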